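(* Let $\mathfrak g$ be of type $D_n$ ($n\geqslant4$), $E_6$, $E_7$ or $E_8$. For every $\gamma\in Q^\vee$ and every $i\in\{0,1,\dots,r\}$, the value at $q=1$ of the affine inverse Kazhdan–Lusztig polynomial $\mathbf m^{w_\gamma}_{w_i}(q)$ is $$\mathbf m^{w_\gamma}_{w_i}=\Big\langle\Lambda_i,\ -\gamma+\frac{|\gamma|^2}{2}K\Big\rangle .$$
   Context: $\mathfrak g$ is simple, simply laced, of rank $r$, with Cartan subalgebra $\mathfrak h$, simple coroots $\alpha_1^\vee,\dots,\alpha_r^\vee$, coroot lattice $Q^\vee\subset\mathfrak h$, Weyl group $W$, highest coroot $\theta^\vee$, invariant form normalized by $(\theta,\theta)=2$, $|\gamma|^2=(\gamma,\gamma)$. $\Lambda_i$ are the fundamental weights of $\widehat{\mathfrak g}$: linear functions on $\mathfrak h\oplus\mathbb{C}K$ with $\langle\Lambda_i,\alpha_j^\vee\rangle=\delta_{ij}$ for $0\leqslant i,j\leqslant r$, where $\alpha_0^\vee=K-\theta^\vee$. $\widehat W=Q^\vee\rtimes W$ is the affine Weyl group, with $t_\gamma$ the element attached to $\gamma\in Q^\vee$ and simple reflections $s_1,\dots,s_r\in W$, $s_0=t_{\theta^\vee}s_\theta$; $\ell$ is the length, $\varepsilon(w)=(-1)^{\ell(w)}$, $\preccurlyeq$ the Bruhat order. $w_\gamma$ is the shortest element of the coset $t_\gamma W$. For $i\in\{0,\dots,r\}$, if $0=j_0,j_1,\dots,j_{l-1},j_l=i$ is the unique segment from $0$ to $i$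 in the affine Dynkin diagram, $w_i=s_is_{j_{l-1}}\cdots s_{j_1}s_0$ (so $w_0=s_0$). The Hecke algebra of $\widehat W$ over $\mathbb{Z}[q^{\pm1}]$ has basis $H_w$ with $H_wH_v=H_{wv}$ if $\ell(wv)=\ell(w)+\ell(v)$ and $(H_s+1)(H_s-q)=0$ for simple reflections $s$. $C_v=\sum_{w\preccurlyeq v}P_{w,v}(q)H_w$ is the Kazhdan–Lusztig basis: $P_{v,v}=1$, $P_{w,v}\in\mathbb{Z}[q]$ of degree $\leqslant(\ell(v)-\ell(w)-1)/2$ for $w\prec v$, and $\overline{C_v}=q^{-\ell(v)}C_v$ for the involution $\overline q=q^{-1}$, $\overline{H_w}=H_{w^{-1}}^{-1}$. The inverse Kazhdan–Lusztig polynomials are defined by $H_w=\sum_{v\preccurlyeq w}\varepsilon(wv^{-1})\mathbf m^w_v(q)C_v$ (and $\mathbf m^w_v(q)=0$ if $v\not\preccurlyeq w$); $\mathbf m^w_v=\mathbf m^w_v(1)$. *)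

theory Defs
  imports
    Complex_Main
    "HOL-Algebra.Ring"
    "HOL-Algebra.Coset"
    "HOL-Computational_Algebra.Polynomial"
    "HOL-Library.Poly_Mapping"
    "HOL-Library.Function_Algebras"
    "HOL-Library.Product_Plus"
begin

definition word_prod :: "('a, 'b) monoid_scheme \<Rightarrow> 'a list \<Rightarrow> 'a"
  where "word_prod G ss = foldr (\<otimes>\<^bsub>G\<^esub>) ss \<one>\<^bsub>G\<^esub>"

definition cox_length :: "('a, 'b) monoid_scheme \<Rightarrow> 'a set \<Rightarrow> 'a \<Rightarrow> nat"
  where "cox_length G S w = (LEAST k. \<exists>ss. set ss \<subseteq> S \<and> length ss = k \<and> word_prod G ss = w)"

definition cox_sign :: "('a, 'b) monoid_scheme \<Rightarrow> 'a set \<Rightarrow> 'a \<Rightarrow> int"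
  where "cox_sign G S w = (- 1) ^ cox_length G S w"

definition cox_reflections :: "('a, 'b) monoid_scheme \<Rightarrow> 'a set \<Rightarrow> 'a set"
  where "cox_reflections G S = {g \<otimes>\<^bsub>G\<^esub> s \<otimes>\<^bsub>G\<^esub> inv\<^bsub>G\<^esub> g | g s. g \<in> carrier G \<and> s \<in> S}"

definition bruhat_step :: "('a, 'b) monoid_scheme \<Rightarrow> 'a set \<Rightarrow> 'a \<Rightarrow> 'a \<Rightarrow> bool"
  where "bruhat_step G S u v \<longleftrightarrow>
    u \<in> carrier G \<and> (\<exists>t \<in> cox_reflections G S. v = u \<otimes>\<^bsub>G\<^esub> t) \<and> cox_length G S u < cox_length G S v"

definition bruhat_le :: "('a, 'b) monoid_scheme \<Rightarrow> 'a set \<Rightarrow> 'a \<Rightarrow> 'a \<Rightarrow> bool"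
  where "bruhat_le G S u v \<longleftrightarrow> u \<in> carrier G \<and> v \<in> carrier G \<and> (bruhat_step G S)\<^sup>*\<^sup>* u v"

text \<open>Laurent polynomials over the integers are the monoid algebra of the additive group
  of exponents; the product of \<^typ>\<open>int \<Rightarrow>\<^sub>0 int\<close> is the convolution product.\<close>

type_synonym laurent = "int \<Rightarrow>\<^sub>0 int"

definition q_pow :: "int \<Rightarrow> laurent"
  where "q_pow k = Poly_Mapping.single k 1"

definition poly_at_q :: "int poly \<Rightarrow> laurent"
  where "poly_at_q p = poly (map_poly of_int p) (q_pow 1)"

definition laurent_bar :: "laurent \<Rightarrow> laurent"
  where "laurent_bar = Poly_Mapping.map_key uminus"

definition hscale :: "laurent \<Rightarrow> ('a \<Rightarrow>\<^sub>0 laurent) \<Rightarrow> ('a \<Rightarrow>\<^sub>0 laurent)"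
  where "hscale c = Poly_Mapping.map ((*) c)"

definition Hb :: "'a \<Rightarrow> ('a \<Rightarrow>\<^sub>0 laurent)"
  where "Hb w = Poly_Mapping.single w 1"

text \<open>The ring \<open>A\<close> is the Hecke algebra of the Coxeter system \<open>(G, S)\<close>: its underlying
  module is the free module over the Laurent polynomials on the symbols \<open>H\<^sub>w\<close> (so only its
  product and its unit have to be described). The unit is \<open>H\<^sub>1\<close>, because \<open>H\<^sub>1 H\<^sub>v = H\<^sub>v = H\<^sub>v H\<^sub>1\<close>.\<close>

definition is_hecke_algebra ::
    "('a, 'b) monoid_scheme \<Rightarrow> 'a set \<Rightarrow> ('a \<Rightarrow>\<^sub>0 laurent) ring \<Rightarrow> bool"
  where "is_hecke_algebra G S A \<longleftrightarrow>
    ring A \<and>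
    carrier A = {x. Poly_Mapping.keys x \<subseteq> carrier G} \<and>
    (\<forall>x \<in> carrier A. \<forall>y \<in> carrier A. x \<oplus>\<^bsub>A\<^esub> y = x + y) \<and>
    (\<forall>c. \<forall>x \<in> carrier A. \<forall>y \<in> carrier A.
       hscale c x \<otimes>\<^bsub>A\<^esub> y = hscale c (x \<otimes>\<^bsub>A\<^esub> y) \<and> x \<otimes>\<^bsub>A\<^esub> hscale c y = hscale c (x \<otimes>\<^bsub>A\<^esub> y)) \<and>
    (\<forall>w \<in> carrier G. \<forall>v \<in> carrier G.
       cox_length G S (w \<otimes>\<^bsub>G\<^esub> v) = cox_length G S w + cox_length G S v \<longrightarrow>
       Hb w \<otimes>\<^bsub>A\<^esub> Hb v = Hb (w \<otimes>\<^bsub>G\<^esub> v)) \<and>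
    (\<forall>s \<in> S. (Hb s \<oplus>\<^bsub>A\<^esub> \<one>\<^bsub>A\<^esub>) \<otimes>\<^bsub>A\<^esub> (Hb s \<ominus>\<^bsub>A\<^esub> hscale (q_pow 1) \<one>\<^bsub>A\<^esub>) = \<zero>\<^bsub>A\<^esub>)"

text \<open>The semilinear extension of \<open>H\<^sub>w \<mapsto> (H\<^bsub>w\<inverse>\<^esub>)\<inverse>\<close> to the whole algebra.\<close>

definition hecke_bar ::
    "('a, 'b) monoid_scheme \<Rightarrow> ('a \<Rightarrow>\<^sub>0 laurent) ring \<Rightarrow> ('a \<Rightarrow>\<^sub>0 laurent) \<Rightarrow> ('a \<Rightarrow>\<^sub>0 laurent)"
  where "hecke_bar G A x =
    (\<Sum>w \<in> Poly_Mapping.keys x.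
       hscale (laurent_bar (Poly_Mapping.lookup x w)) (inv\<^bsub>A\<^esub> (Hb (inv\<^bsub>G\<^esub> w))))"

definition KL_elt ::
    "('a, 'b) monoid_scheme \<Rightarrow> 'a set \<Rightarrow> ('a \<Rightarrow> 'a \<Rightarrow> int poly) \<Rightarrow> 'a \<Rightarrow> ('a \<Rightarrow>\<^sub>0 laurent)"
  where "KL_elt G S P v = (\<Sum>w | bruhat_le G S w v. hscale (poly_at_q (P w v)) (Hb w))"

text \<open>For \<open>w \<prec> v\<close> the bound \<open>deg P\<^bsub>w,v\<^esub> \<le> (\<ell>(v) - \<ell>(w) - 1)/2\<close> is written without
  subtraction.\<close>

definition is_KL_polynomials ::
    "('a, 'b) monoid_scheme \<Rightarrow> 'a set \<Rightarrow> ('a \<Rightarrow>\<^sub>0 laurent) ring \<Rightarrow> ('a \<Rightarrow> 'a \<Rightarrow> int poly) \<Rightarrow> bool"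
  where "is_KL_polynomials G S A P \<longleftrightarrow>
    (\<forall>v \<in> carrier G.
       P v v = 1 \<and>
       (\<forall>w. bruhat_le G S w v \<and> w \<noteq> v \<longrightarrow>
          2 * degree (P w v) + cox_length G S w + 1 \<le> cox_length G S v) \<and>
       hecke_bar G A (KL_elt G S P v) = hscale (q_pow (- int (cox_length G S v))) (KL_elt G S P v))"

definition is_inverse_KL_polynomials ::
    "('a, 'b) monoid_scheme \<Rightarrow> 'a set \<Rightarrow> ('a \<Rightarrow> 'a \<Rightarrow> int poly) \<Rightarrow> ('a \<Rightarrow> 'a \<Rightarrow> int poly) \<Rightarrow> bool"
  where "is_inverse_KL_polynomials G S P m \<longleftrightarrow>
    (\<forall>w \<in> carrier G.
       Hb w = (\<Sum>v | bruhat_le G S v w.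
         hscale (of_int (cox_sign G S (w \<otimes>\<^bsub>G\<^esub> inv\<^bsub>G\<^esub> v)) * poly_at_q (m w v)) (KL_elt G S P v)) \<and>
       (\<forall>v \<in> carrier G. \<not> bruhat_le G S v w \<longrightarrow> m w v = 0))"

text \<open>Nodes are numbered \<open>1, \<dots>, r\<close> as in Bourbaki.\<close>

datatype dynkin_type = TypeD nat | TypeE6 | TypeE7 | TypeE8

fun valid_type :: "dynkin_type \<Rightarrow> bool" where
  "valid_type (TypeD n) \<longleftrightarrow> n \<ge> 4"
| "valid_type _ \<longleftrightarrow> True"

fun dynkin_rank :: "dynkin_type \<Rightarrow> nat" where
  "dynkin_rank (TypeD n) = n"
| "dynkin_rank TypeE6 = 6"
| "dynkin_rank TypeE7 = 7"
| "dynkin_rank TypeE8 = 8"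

fun dynkin_edges :: "dynkin_type \<Rightarrow> (nat \<times> nat) set" where
  "dynkin_edges (TypeD n) = {(k, k + 1) | k. 1 \<le> k \<and> k + 2 \<le> n} \<union> {(n - 2, n)}"
| "dynkin_edges T = {(1, 3), (2, 4)} \<union> {(k, k + 1) | k. 3 \<le> k \<and> k < dynkin_rank T}"

definition cartan :: "dynkin_type \<Rightarrow> nat \<Rightarrow> nat \<Rightarrow> int"
  where "cartan T i j =
    (if i = j then 2 else if (i, j) \<in> dynkin_edges T \<or> (j, i) \<in> dynkin_edges T then - 1 else 0)"

text \<open>Elements of the coroot lattice are given by their coordinates with respect to the
  simple coroots. Since all coroots have the same length, normalizing \<open>(\<theta>, \<theta>) = 2\<close> makes
  the Cartan matrix the Gram matrix of the simple coroots.\<close>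

type_synonym coroot_vec = "nat \<Rightarrow> int"

definition coroot_lattice :: "dynkin_type \<Rightarrow> coroot_vec set"
  where "coroot_lattice T = {x. \<forall>k. k \<notin> {1..dynkin_rank T} \<longrightarrow> x k = 0}"

definition simple_coroot :: "nat \<Rightarrow> coroot_vec"
  where "simple_coroot i = (\<lambda>k. if k = i then 1 else 0)"

definition form :: "dynkin_type \<Rightarrow> coroot_vec \<Rightarrow> coroot_vec \<Rightarrow> int"
  where "form T x y = (\<Sum>i = 1..dynkin_rank T. \<Sum>j = 1..dynkin_rank T. x i * cartan T i j * y j)"

text \<open>The orthogonal reflection in a vector of square length 2. It is defined for all
  coordinate functions, and leaves the coordinates outside \<open>{1..r}\<close> alone, so that maps
  generated by such reflections are determined by their restrictions to the coroot lattice.\<close>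

definition reflection :: "dynkin_type \<Rightarrow> coroot_vec \<Rightarrow> coroot_vec \<Rightarrow> coroot_vec"
  where "reflection T b x = (\<lambda>k. x k - form T x b * b k)"

inductive_set weyl_group :: "dynkin_type \<Rightarrow> (coroot_vec \<Rightarrow> coroot_vec) set" for T where
  weyl_id: "id \<in> weyl_group T"
| weyl_step: "w \<in> weyl_group T \<Longrightarrow> i \<in> {1..dynkin_rank T} \<Longrightarrow>
    reflection T (simple_coroot i) \<circ> w \<in> weyl_group T"

definition coroots :: "dynkin_type \<Rightarrow> coroot_vec set"
  where "coroots T = {w (simple_coroot i) | w i. w \<in> weyl_group T \<and> i \<in> {1..dynkin_rank T}}"

text \<open>In the pointwise order, \<open>b \<le> t\<close> says that \<open>t - b\<close> is a nonnegative combination of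
  simple coroots.\<close>

definition highest_coroot :: "dynkin_type \<Rightarrow> coroot_vec"
  where "highest_coroot T = (THE t. t \<in> coroots T \<and> (\<forall>b \<in> coroots T. b \<le> t))"

type_synonym aff = "coroot_vec \<times> (coroot_vec \<Rightarrow> coroot_vec)"

definition affine_weyl :: "dynkin_type \<Rightarrow> aff monoid"
  where "affine_weyl T =
    \<lparr>carrier = coroot_lattice T \<times> weyl_group T,
     monoid.mult = (\<lambda>(x, u) (y, v). (x + u y, u \<circ> v)),
     one = (0, id)\<rparr>"

definition translation :: "coroot_vec \<Rightarrow> aff"
  where "translation x = (x, id)"

definition finite_weyl :: "dynkin_type \<Rightarrow> aff set"
  where "finite_weyl T = {0} \<times> weyl_group T"

definition simple_refl :: "dynkin_type \<Rightarrow> nat \<Rightarrow> aff"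
  where "simple_refl T i =
    (if i = 0
     then translation (highest_coroot T) \<otimes>\<^bsub>affine_weyl T\<^esub> (0, reflection T (highest_coroot T))
     else (0, reflection T (simple_coroot i)))"

definition simple_refls :: "dynkin_type \<Rightarrow> aff set"
  where "simple_refls T = simple_refl T ` {0..dynkin_rank T}"

definition w_coset :: "dynkin_type \<Rightarrow> coroot_vec \<Rightarrow> aff"
  where "w_coset T x =
    (ARG_MIN (cox_length (affine_weyl T) (simple_refls T)) w.
       w \<in> translation x <#\<^bsub>affine_weyl T\<^esub> finite_weyl T)"

text \<open>Adjacency in the affine Dynkin diagram is non-orthogonality of the finite parts of
  the affine simple coroots; \<open>\<alpha>\<^sub>0 = K - \<theta>\<close> has finite part \<open>- \<theta>\<close>.\<close>

definition aff_coroot_fin :: "dynkin_type \<Rightarrow> nat \<Rightarrow> coroot_vec"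
  where "aff_coroot_fin T i = (if i = 0 then - highest_coroot T else simple_coroot i)"

definition aff_adjacent :: "dynkin_type \<Rightarrow> nat \<Rightarrow> nat \<Rightarrow> bool"
  where "aff_adjacent T i j \<longleftrightarrow> i \<noteq> j \<and> form T (aff_coroot_fin T i) (aff_coroot_fin T j) \<noteq> 0"

definition aff_segment :: "dynkin_type \<Rightarrow> nat \<Rightarrow> nat list"
  where "aff_segment T i =
    (THE js. js \<noteq> [] \<and> hd js = 0 \<and> last js = i \<and> set js \<subseteq> {0..dynkin_rank T} \<and>
       distinct js \<and> successively (aff_adjacent T) js)"

definition w_node :: "dynkin_type \<Rightarrow> nat \<Rightarrow> aff"
  where "w_node T i = word_prod (affine_weyl T) (map (simple_refl T) (rev (aff_segment T i)))"

text \<open>The space \<open>\<hh> \<oplus> \<complex>K\<close>: the first component is the coordinate vector of the part in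
  \<open>\<hh>\<close> with respect to the simple coroots, the second is the coefficient of \<open>K\<close>.\<close>

type_synonym hK = "(nat \<Rightarrow> complex) \<times> complex"

definition hK_space :: "dynkin_type \<Rightarrow> hK set"
  where "hK_space T = {(x, c). \<forall>k. k \<notin> {1..dynkin_rank T} \<longrightarrow> x k = 0}"

definition hK_scale :: "complex \<Rightarrow> hK \<Rightarrow> hK"
  where "hK_scale c = (\<lambda>(x, d). (\<lambda>k. c * x k, c * d))"

definition hK_of_coroot :: "coroot_vec \<Rightarrow> hK"
  where "hK_of_coroot x = (\<lambda>k. of_int (x k), 0)"

definition K_elt :: hK
  where "K_elt = (0, 1)"

definition aff_coroot :: "dynkin_type \<Rightarrow> nat \<Rightarrow> hK"
  where "aff_coroot T i =
    (if i = 0 then K_elt - hK_of_coroot (highest_coroot T) else hK_of_coroot (simple_coroot i))"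

definition is_linear_hK :: "dynkin_type \<Rightarrow> (hK \<Rightarrow> complex) \<Rightarrow> bool"
  where "is_linear_hK T f \<longleftrightarrow>
    (\<forall>x \<in> hK_space T. \<forall>y \<in> hK_space T. f (x + y) = f x + f y) \<and>
    (\<forall>c. \<forall>x \<in> hK_space T. f (hK_scale c x) = c * f x)"

definition is_fundamental_weights :: "dynkin_type \<Rightarrow> (nat \<Rightarrow> hK \<Rightarrow> complex) \<Rightarrow> bool"
  where "is_fundamental_weights T L \<longleftrightarrow>
    (\<forall>i \<le> dynkin_rank T. is_linear_hK T (L i) \<and>
       (\<forall>j \<le> dynkin_rank T. L i (aff_coroot T j) = (if i = j then 1 else 0)))"

end

theory Submission
  imports Defs
begin

text \<open>The left regular module of the Hecke algebra has a quotient with basis the images of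
  \<open>C\<^sub>1\<close> and of the \<open>C\<close>-elements of \<open>w\<^sub>0, \<dots>, w\<^sub>r\<close>, a \<open>q\<close>-deformation of the span of
  \<open>\<Lambda>\<^sub>0\<close> and the simple affine roots. It can be written down directly, because the affine
  diagram is a simply laced tree. Let \<open>X\<^sub>w\<close> be the image of \<open>H\<^sub>w\<close>. The coordinates of
  \<open>X\<^sub>w\<close> satisfy the degree bounds of Kazhdan-Lusztig polynomials; together with the invariance
  of \<open>C\<^sub>v\<close> under the bar involution this forces \<open>C\<^sub>v\<close> to map to zero unless \<open>v\<close>
  is \<open>1\<close> or one of the \<open>w\<^sub>i\<close>. Hence the coordinate of \<open>X\<^sub>w\<close> at the node \<open>i\<close> is, up to
  sign, the inverse Kazhdan-Lusztig polynomial of the pair \<open>(w, w\<^sub>i)\<close>. At \<open>q = 1\<close> the module is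
  a sign twist of the reflection representation, where \<open>t\<^sub>\<gamma>\<close> moves \<open>\<Lambda>\<^sub>0\<close> by the
  translation formula.\<close>

section \<open>Words in simply laced reflection groups\<close>

text \<open>The affine Weyl group is given concretely as a semidirect product, so the facts about
  Coxeter groups have to come from geometry: the group acts on affine linear functions, and the
  simple affine coroots lie in a pointed cone. The essential fact is that operators satisfying the
  braid relations can be composed along reduced words; this makes the vectors X_w well defined. The
  obstacle is the degree bound. In X_{su} = -X_u + L(X_u) the coordinate at the node of s contains q
  times the same coordinate of X_u, and the bound for u alone then misses the required one by half a
  power of q. Hence two or three letters have to be inspected at once. The structure constants come
  from C_s C_w = C_{sw} + sum of mu(z,w) q^((l(w)-l(z)+1)/2) C_z, where every C_z outside the list
  1, w_0, ..., w_r is dropped. The element C_1 gets a node of its own, a formal parent e of the root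
  0. At q = 1 its coordinate is constant up to sign, which turns the inhomogeneous term in the
  action on \<Lambda>_0 into a linear one.\<close>

locale coxeter_words = group G for G :: "('g, 'h) monoid_scheme" (structure) +
  fixes I :: "nat set" and s :: "nat \<Rightarrow> 'g"
  assumes finite_I: "finite I"
    and s_closed [simp]: "i \<in> I \<Longrightarrow> s i \<in> carrier G"
    and s_invol: "i \<in> I \<Longrightarrow> s i \<otimes> s i = \<one>"
    and generated: "w \<in> carrier G \<Longrightarrow> \<exists>is. set is \<subseteq> I \<and> w = word_prod G (map s is)"
begin

abbreviation len :: "'g \<Rightarrow> nat" where "len \<equiv> cox_length G (s ` I)"

abbreviation wd :: "nat list \<Rightarrow> 'g" where "wd is \<equiv> word_prod G (map s is)"

lemma word_prod_Nil [simp]: "word_prod G [] = \<one>"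
  by (simp add: word_prod_def)

lemma word_prod_Cons [simp]: "word_prod G (g # gs) = g \<otimes> word_prod G gs"
  by (simp add: word_prod_def)

lemma wd_closed [simp]: "set is \<subseteq> I \<Longrightarrow> wd is \<in> carrier G"
  by (induction "is") auto

lemma s_cancel [simp]: "i \<in> I \<Longrightarrow> w \<in> carrier G \<Longrightarrow> s i \<otimes> (s i \<otimes> w) = w"
  using m_assoc[of "s i" "s i" w] s_invol by simp

lemma inv_s [simp]: "i \<in> I \<Longrightarrow> inv (s i) = s i"
  by (simp add: inv_equality s_invol)

lemma wd_append: "set is \<subseteq> I \<Longrightarrow> set js \<subseteq> I \<Longrightarrow> wd (is @ js) = wd is \<otimes> wd js"
  by (induction "is") (auto simp: m_assoc)

lemma wd_rev: "set is \<subseteq> I \<Longrightarrow> wd (rev is) = inv (wd is)"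
  by (induction "is") (auto simp: wd_append[of _ "[_]", simplified] inv_mult_group)

text \<open>\<open>cox_length\<close> speaks of lists of group elements. Lists of indices are needed
  instead because roots, parents and operators are attached to indices.\<close>

lemma lists_of_words:
  "(\<exists>ss. set ss \<subseteq> s ` I \<and> length ss = k \<and> word_prod G ss = w)
    \<longleftrightarrow> (\<exists>is. set is \<subseteq> I \<and> length is = k \<and> wd is = w)"
proof
  assume "\<exists>ss. set ss \<subseteq> s ` I \<and> length ss = k \<and> word_prod G ss = w"
  then obtain ss where ss: "set ss \<subseteq> s ` I" "length ss = k" "word_prod G ss = w" by blast
  from ss(1) have "ss \<in> map s ` lists I"
    by (metis in_listsI lists_image subsetD)
  then obtain "is" where "set is \<subseteq> I" "ss = map s is" by auto
  with ss show "\<exists>is. set is \<subseteq> I \<and> length is = k \<and> wd is = w" by auto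
next
  assume "\<exists>is. set is \<subseteq> I \<and> length is = k \<and> wd is = w"
  then obtain "is" where "set is \<subseteq> I" "length is = k" "wd is = w" by blast
  then show "\<exists>ss. set ss \<subseteq> s ` I \<and> length ss = k \<and> word_prod G ss = w"
    by (intro exI[of _ "map s is"]) auto
qed

lemma len_eq: "len w = (LEAST k. \<exists>is. set is \<subseteq> I \<and> length is = k \<and> wd is = w)"
  unfolding cox_length_def lists_of_words ..

lemma len_wd_le: "set is \<subseteq> I \<Longrightarrow> len (wd is) \<le> length is"
  unfolding len_eq by (rule Least_le) auto

definition reduced :: "nat list \<Rightarrow> 'g \<Rightarrow> bool"
  where "reduced is w \<longleftrightarrow> set is \<subseteq> I \<and> wd is = w \<and> length is = len w"

lemma reduced_exists: assumes "w \<in> carrier G" shows "\<exists>is. reduced is w"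
proof -
  have "\<exists>is. set is \<subseteq> I \<and> length is = len w \<and> wd is = w"
    unfolding len_eq by (rule LeastI_ex) (use generated[OF assms] in auto)
  then show ?thesis by (auto simp: reduced_def)
qed

lemma len_one [simp]: "len \<one> = 0"
  using len_wd_le[of "[]"] by simp

lemma len_eq_0: "w \<in> carrier G \<Longrightarrow> len w = 0 \<longleftrightarrow> w = \<one>"
  using reduced_exists[of w] by (auto simp: reduced_def)

lemma len_s_le: assumes "i \<in> I" "w \<in> carrier G" shows "len (s i \<otimes> w) \<le> Suc (len w)"
proof -
  obtain "is" where "reduced is w" using reduced_exists assms by blast
  then show ?thesis using len_wd_le[of "i # is"] assms by (auto simp: reduced_def)
qed

lemma len_le_s: assumes "i \<in> I" "w \<in> carrier G" shows "len w \<le> Suc (len (s i \<otimes> w))"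
  using len_s_le[of i "s i \<otimes> w"] assms by simp

lemma left_descent_exists:
  assumes "w \<in> carrier G" "w \<noteq> \<one>"
  shows "\<exists>i\<in>I. len w = Suc (len (s i \<otimes> w))"
proof -
  obtain js where r: "reduced js w" using reduced_exists assms by blast
  with assms obtain i "is" where js: "js = i # is" by (cases js) (auto simp: reduced_def)
  have i: "i \<in> I" "set is \<subseteq> I" and w: "w = s i \<otimes> wd is" and l: "len w = Suc (length is)"
    using r js by (auto simp: reduced_def)
  have "s i \<otimes> w = wd is" using w i by simp
  then have "len (s i \<otimes> w) \<le> length is" using len_wd_le i by simp
  then show ?thesis using l len_le_s[OF i(1) assms(1)] i by (intro bexI[of _ i]) auto
qed

lemma len_inv_le: assumes "w \<in> carrier G" shows "len (inv w) \<le> len w"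
proof -
  obtain "is" where "reduced is w" using reduced_exists assms by blast
  then show ?thesis using len_wd_le[of "rev is"] by (auto simp: reduced_def wd_rev)
qed

lemma len_inv: "w \<in> carrier G \<Longrightarrow> len (inv w) = len w"
  using len_inv_le[of w] len_inv_le[of "inv w"] by auto

lemma len_s: assumes "i \<in> I" "s i \<noteq> \<one>" shows "len (s i) = 1"
  using assms len_wd_le[of "[i]"] len_eq_0[of "s i"] by auto

lemma finite_len_le: "finite {w \<in> carrier G. len w \<le> n}"
proof (rule finite_subset)
  show "{w \<in> carrier G. len w \<le> n} \<subseteq> wd ` {is. set is \<subseteq> I \<and> length is \<le> n}"
    using reduced_exists by (fastforce simp: reduced_def)
  show "finite (wd ` {is. set is \<subseteq> I \<and> length is \<le> n})"
    using finite_lists_length_le[OF finite_I] by blast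
qed

lemma bruhat_le_len:
  assumes "bruhat_le G (s ` I) u v" shows "u = v \<or> len u < len v"
proof -
  have "(bruhat_step G (s ` I))\<^sup>*\<^sup>* u v" using assms by (simp add: bruhat_le_def)
  then show ?thesis by (induction rule: rtranclp_induct) (auto simp: bruhat_step_def)
qed

lemma bruhat_le_carrier:
  "bruhat_le G (s ` I) u v \<Longrightarrow> u \<in> carrier G \<and> v \<in> carrier G"
  by (simp add: bruhat_le_def)

lemma bruhat_le_refl: "v \<in> carrier G \<Longrightarrow> bruhat_le G (s ` I) v v"
  by (simp add: bruhat_le_def)

text \<open>Without finiteness the sums defining \<open>KL_elt\<close> and the inverse polynomials
  would be 0 by convention.\<close>

lemma finite_bruhat_down: "finite {u. bruhat_le G (s ` I) u v}"
  by (rule finite_subset[OF _ finite_len_le[of "len v"]])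
    (use bruhat_le_len bruhat_le_carrier in fastforce)

lemma word_induct [consumes 1, case_names one step]:
  assumes "w \<in> carrier G" "P \<one>"
    and "\<And>i w. i \<in> I \<Longrightarrow> w \<in> carrier G \<Longrightarrow> P w \<Longrightarrow> P (s i \<otimes> w)"
  shows "P w"
proof -
  have "P (wd is)" if "set is \<subseteq> I" for "is" using that assms(2,3) by (induction "is") auto
  then show ?thesis using generated[OF assms(1)] by auto
qed

lemma len_induct [consumes 1, case_names one step]:
  assumes "w \<in> carrier G" "P \<one>"
    and "\<And>i w. i \<in> I \<Longrightarrow> w \<in> carrier G \<Longrightarrow> len (s i \<otimes> w) = Suc (len w) \<Longrightarrow> P w \<Longrightarrow> P (s i \<otimes> w)"
  shows "P w"
  using assms(1)
proof (induction "len w" arbitrary: w)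
  case 0
  then show ?case using assms(2) len_eq_0 by auto
next
  case (Suc n)
  then have "w \<noteq> \<one>" by auto
  then obtain i where i: "i \<in> I" "len w = Suc (len (s i \<otimes> w))"
    using left_descent_exists Suc by blast
  have "P (s i \<otimes> (s i \<otimes> w))" by (rule assms(3)) (use i Suc in auto)
  then show ?case using i Suc by simp
qed

end

text \<open>The pair \<open>(G, s)\<close> is not assumed to be a Coxeter system: the braid relations and a pointed
  cone in a representation by reflections replace the exchange property.\<close>

locale simply_laced_words = coxeter_words G I s
  for G :: "('g, 'h) monoid_scheme" (structure) and I s +
  fixes adj :: "nat \<Rightarrow> nat \<Rightarrow> bool"
    and \<rho> :: "'g \<Rightarrow> 'v :: ab_group_add \<Rightarrow> 'v"
    and root :: "nat \<Rightarrow> 'v"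
    and pos :: "'v \<Rightarrow> bool"
  assumes adj_sym: "adj i j \<Longrightarrow> adj j i"
    and commute: "i \<in> I \<Longrightarrow> j \<in> I \<Longrightarrow> \<not> adj i j \<Longrightarrow> i \<noteq> j \<Longrightarrow> s i \<otimes> s j = s j \<otimes> s i"
    and braid: "i \<in> I \<Longrightarrow> j \<in> I \<Longrightarrow> adj i j \<Longrightarrow> i \<noteq> j \<Longrightarrow>
      s i \<otimes> (s j \<otimes> s i) = s j \<otimes> (s i \<otimes> s j)"
    and \<rho>_one: "\<rho> \<one> x = x"
    and \<rho>_mult: "g \<in> carrier G \<Longrightarrow> h \<in> carrier G \<Longrightarrow> \<rho> (g \<otimes> h) x = \<rho> g (\<rho> h x)"
    and \<rho>_add: "g \<in> carrier G \<Longrightarrow> \<rho> g (x + y) = \<rho> g x + \<rho> g y"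
    and \<rho>_root: "i \<in> I \<Longrightarrow> j \<in> I \<Longrightarrow> \<rho> (s i) (root j) =
      (if i = j then - root i else if adj i j then root j + root i else root j)"
    and pos_root: "i \<in> I \<Longrightarrow> pos (root i)"
    and pos_add: "pos x \<Longrightarrow> pos y \<Longrightarrow> pos (x + y)"
    and pos_uminus: "pos x \<Longrightarrow> \<not> pos (- x)"
begin

lemma commute_left:
  assumes "i \<in> I" "j \<in> I" "\<not> adj i j" "i \<noteq> j" "w \<in> carrier G"
  shows "s i \<otimes> (s j \<otimes> w) = s j \<otimes> (s i \<otimes> w)"
  using assms commute[of i j] m_assoc[of "s i" "s j" w] m_assoc[of "s j" "s i" w] by simp

lemma braid_left:
  assumes "i \<in> I" "j \<in> I" "adj i j" "i \<noteq> j" "w \<in> carrier G"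
  shows "s i \<otimes> (s j \<otimes> (s i \<otimes> w)) = s j \<otimes> (s i \<otimes> (s j \<otimes> w))"
proof -
  have "s i \<otimes> (s j \<otimes> (s i \<otimes> w)) = (s i \<otimes> (s j \<otimes> s i)) \<otimes> w"
    using assms by (simp add: m_assoc)
  also have "\<dots> = s j \<otimes> (s i \<otimes> (s j \<otimes> w))"
    using assms by (simp add: braid[OF assms(1-4)] m_assoc)
  finally show ?thesis .
qed

lemma \<rho>_uminus: assumes "g \<in> carrier G" shows "\<rho> g (- x) = - \<rho> g x"
proof -
  have "\<rho> g 0 = 0" using \<rho>_add[OF assms, of 0 0] by simp
  then show ?thesis using \<rho>_add[OF assms, of x "- x"] by (simp add: minus_unique)
qed

section \<open>Descents and the signs of pulled-back roots\<close>

abbreviation pull :: "'g \<Rightarrow> nat \<Rightarrow> 'v" where "pull w i \<equiv> \<rho> (inv w) (root i)"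

lemma pull_s:
  assumes "i \<in> I" "j \<in> I" "w \<in> carrier G"
  shows "pull (s i \<otimes> w) j =
    (if i = j then - pull w i else if adj i j then pull w j + pull w i else pull w j)"
proof -
  have "pull (s i \<otimes> w) j = \<rho> (inv w) (\<rho> (s i) (root j))"
    using assms by (simp add: inv_mult_group \<rho>_mult)
  then show ?thesis using assms by (simp add: \<rho>_root \<rho>_add \<rho>_uminus)
qed

text \<open>A left descent t of w is split off, and if i is then a descent as well, it is split off
  too: w is an element of the parabolic subgroup of i and t times a shorter element, whose
  pulled-back roots at the relevant nodes are positive by induction. The pulled-back root of w is a
  sum of these. The hypothesis is a weak inequality because equal lengths are not excluded yet; that
  is done next, with the help of this lemma.\<close>

lemma pull_pos:
  assumes "w \<in> carrier G" "i \<in> I" "len w \<le> len (s i \<otimes> w)"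
  shows "pos (pull w i)"
  using assms
proof (induction "len w" arbitrary: w i rule: less_induct)
  case less
  note w = \<open>w \<in> carrier G\<close> and i = \<open>i \<in> I\<close> and le = \<open>len w \<le> len (s i \<otimes> w)\<close>
  show ?case
  proof (cases "w = \<one>")
    case True
    then show ?thesis by (simp add: \<rho>_one pos_root i)
  next
    case False
    then obtain t where t: "t \<in> I" "len w = Suc (len (s t \<otimes> w))"
      using left_descent_exists w by blast
    have it: "i \<noteq> t" using le t(2) by auto
    define w1 where "w1 = s t \<otimes> w"
    have w1: "w1 \<in> carrier G" "len w = Suc (len w1)" "w = s t \<otimes> w1"
      using t w by (auto simp: w1_def)
    have pw: "pull w i = (if adj t i then pull w1 i + pull w1 t else pull w1 i)"
      using pull_s[of t i w1] i t w1 it by auto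
    have pt: "pos (pull w1 t)" using less.hyps[of w1 t] w1 t by simp
    show ?thesis
    proof (cases "len w1 \<le> len (s i \<otimes> w1)")
      case True
      then have "pos (pull w1 i)" using less.hyps[of w1 i] w1 i by simp
      then show ?thesis using pt pw pos_add by auto
    next
      case F: False
      define w2 where "w2 = s i \<otimes> w1"
      have w2: "w2 \<in> carrier G" "Suc (len w2) = len w1" "w1 = s i \<otimes> w2"
        using F len_le_s[OF i w1(1)] w1 i by (auto simp: w2_def)
      \<comment> \<open>If the two letters commuted, \<open>s i\<close> would cancel against the
        letter i of w and give an element shorter than w.\<close>
      have adj: "adj t i"
      proof (rule ccontr)
        assume n: "\<not> adj t i"
        have "s i \<otimes> w = s i \<otimes> (s i \<otimes> (s t \<otimes> w2))"
          using commute_left[OF t(1) i n] it w1 w2 by auto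
        then have "s i \<otimes> w = s t \<otimes> w2" using i t w2 by simp
        then show False using le len_s_le[OF t(1) w2(1)] w2 w1 by simp
      qed
      have pw2: "pull w i = pull w2 t"
        using pull_s[of i t w2] pull_s[of i i w2] w2 t i it pw adj adj_sym by auto
      \<comment> \<open>Otherwise w begins with t, i, t, which can be rewritten as i, t, i, and
        again \<open>s i\<close> would shorten w.\<close>
      have "len w2 \<le> len (s t \<otimes> w2)"
      proof (rule ccontr)
        assume n: "\<not> ?thesis"
        define w3 where "w3 = s t \<otimes> w2"
        have w3: "w3 \<in> carrier G" "Suc (len w3) \<le> len w2" "w2 = s t \<otimes> w3"
          using n w2 t by (auto simp: w3_def)
        have "s i \<otimes> w = s i \<otimes> (s i \<otimes> (s t \<otimes> (s i \<otimes> w3)))"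
          using braid_left[OF t(1) i adj, of w3] it w1 w2 w3 by auto
        then have "s i \<otimes> w = s t \<otimes> (s i \<otimes> w3)" using i t w3 by simp
        then show False
          using le len_s_le[OF t(1), of "s i \<otimes> w3"] len_s_le[OF i, of w3] w3 w2 w1 i by simp
      qed
      then have "pos (pull w2 t)" using less.hyps[of w2 t] w1 w2 t by simp
      then show ?thesis using pw2 by simp
    qed
  qed
qed

text \<open>With equal lengths \<open>pull_pos\<close> would apply both to w and to
  \<open>s i \<otimes> w\<close>, whose pulled-back roots at i are negatives of each other.\<close>

lemma len_s_neq: assumes "i \<in> I" "w \<in> carrier G" shows "len (s i \<otimes> w) \<noteq> len w"
proof
  assume e: "len (s i \<otimes> w) = len w"
  have "pos (pull w i)" using pull_pos[of w i] e assms by simp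
  moreover have "pos (pull (s i \<otimes> w) i)" using pull_pos[of "s i \<otimes> w" i] e assms by simp
  ultimately show False using pull_s[of i i w] assms pos_uminus by auto
qed

lemma len_s_cases:
  assumes "i \<in> I" "w \<in> carrier G"
  obtains "len (s i \<otimes> w) = Suc (len w)" | "len w = Suc (len (s i \<otimes> w))"
  using len_s_neq[OF assms] len_le_s[OF assms] len_s_le[OF assms] by linarith

lemma s_neq_one: "i \<in> I \<Longrightarrow> s i \<noteq> \<one>"
  using len_s_neq[of i \<one>] by auto

definition desc :: "nat \<Rightarrow> 'g \<Rightarrow> bool"
  where "desc i w \<longleftrightarrow> len (s i \<otimes> w) < len w"

lemma desc_len: "i \<in> I \<Longrightarrow> w \<in> carrier G \<Longrightarrow> desc i w \<Longrightarrow> len w = Suc (len (s i \<otimes> w))"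
  by (rule len_s_cases[of i w]) (simp_all add: desc_def)

lemma not_desc_len: "i \<in> I \<Longrightarrow> w \<in> carrier G \<Longrightarrow> \<not> desc i w \<Longrightarrow> len (s i \<otimes> w) = Suc (len w)"
  by (rule len_s_cases[of i w]) (simp_all add: desc_def)

lemma desc_s_iff: "i \<in> I \<Longrightarrow> w \<in> carrier G \<Longrightarrow> desc i (s i \<otimes> w) \<longleftrightarrow> \<not> desc i w"
  using len_s_neq[of i w] by (auto simp: desc_def)

lemma desc_iff_pull: assumes "i \<in> I" "w \<in> carrier G" shows "desc i w \<longleftrightarrow> pos (- pull w i)"
proof
  assume "desc i w"
  then have "pos (pull (s i \<otimes> w) i)"
    using pull_pos[of "s i \<otimes> w" i] assms by (simp add: desc_def)
  then show "pos (- pull w i)" using pull_s[of i i w] assms by simp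
next
  assume "pos (- pull w i)"
  then have "\<not> pos (pull w i)" using pos_uminus by blast
  then show "desc i w" using pull_pos[of w i] assms by (meson desc_def not_le)
qed

lemma two_descents_commute:
  assumes "i \<in> I" "j \<in> I" "i \<noteq> j" "\<not> adj i j" "w \<in> carrier G" "desc i w" "desc j w"
  shows "desc j (s i \<otimes> w)"
  using assms by (simp add: desc_iff_pull pull_s)

text \<open>Substitute for the exchange property: two adjacent descents allow the longest element of
  the rank two subgroup to be split off on the left. The sum of two negative roots is negative,
  which gives the second letter; the third root is the pulled-back root of w at j.\<close>

lemma two_descents_braid:
  assumes "i \<in> I" "j \<in> I" "i \<noteq> j" "adj i j" "w \<in> carrier G" "desc i w" "desc j w"
  shows "desc j (s i \<otimes> w)" "desc i (s j \<otimes> (s i \<otimes> w))"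
proof -
  have p: "pos (- pull w i)" "pos (- pull w j)" using assms by (auto simp: desc_iff_pull)
  from pos_add[OF this] show "desc j (s i \<otimes> w)"
    using assms by (simp add: desc_iff_pull pull_s add.commute)
  have "pull (s j \<otimes> (s i \<otimes> w)) i = pull w j"
    using assms adj_sym by (simp add: pull_s)
  then show "desc i (s j \<otimes> (s i \<otimes> w))" using assms p by (simp add: desc_iff_pull)
qed

section \<open>Reduced words and the braid relations\<close>

lemma reduced_Cons:
  assumes "reduced is w" "i \<in> I" "\<not> desc i w" shows "reduced (i # is) (s i \<otimes> w)"
  using assms not_desc_len[of i w] by (auto simp: reduced_def)

lemma reduced_ConsD:
  assumes "reduced (i # is) w"
  shows "i \<in> I" "w \<in> carrier G" "desc i w" "reduced is (s i \<otimes> w)"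
proof -
  have i: "i \<in> I" "set is \<subseteq> I" and w: "w = s i \<otimes> wd is" and l: "len w = Suc (length is)"
    using assms by (auto simp: reduced_def)
  show "i \<in> I" "w \<in> carrier G" using i w by auto
  have e: "s i \<otimes> w = wd is" using w i by simp
  have "len (wd is) \<le> length is" using len_wd_le i by simp
  then show d: "desc i w" using l e by (simp add: desc_def)
  show "reduced is (s i \<otimes> w)"
    using desc_len[OF i(1) _ d] w i l by (auto simp: reduced_def)
qed

text \<open>Matsumoto's theorem for operators. If two reduced words of w begin with i and j, then
  both are descents of w, so w also has reduced words that begin with the two expressions of the
  longest element of the subgroup of i and j and continue identically. Each given word shares its
  first letter with one of these, so the induction applies to the tails, and one relation for
  \<open>\<tau>\<close> joins the two.\<close>

lemma matsumoto:
  fixes \<tau> :: "nat \<Rightarrow> 'm \<Rightarrow> 'm"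
  assumes \<tau>_commute: "\<And>i j x. i \<in> I \<Longrightarrow> j \<in> I \<Longrightarrow> i \<noteq> j \<Longrightarrow> \<not> adj i j \<Longrightarrow> \<tau> i (\<tau> j x) = \<tau> j (\<tau> i x)"
    and \<tau>_braid: "\<And>i j x. i \<in> I \<Longrightarrow> j \<in> I \<Longrightarrow> i \<noteq> j \<Longrightarrow> adj i j \<Longrightarrow>
      \<tau> i (\<tau> j (\<tau> i x)) = \<tau> j (\<tau> i (\<tau> j x))"
    and "reduced is w" "reduced js w"
  shows "foldr \<tau> is x = foldr \<tau> js x"
  using assms(3,4)
proof (induction "len w" arbitrary: w "is" js rule: less_induct)
  case less
  show ?case
  proof (cases "is = [] \<or> js = []")
    case True
    moreover have "length is = length js" using less.prems unfolding reduced_def by metis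
    ultimately show ?thesis by auto
  next
    case False
    then obtain i is' j js' where e: "is = i # is'" "js = j # js'" by (auto simp: neq_Nil_conv)
    note I = reduced_ConsD[OF less.prems(1)[unfolded e]]
    note J = reduced_ConsD[OF less.prems(2)[unfolded e]]
    have li: "len (s i \<otimes> w) < len w" "len (s j \<otimes> w) < len w" using I J by (auto simp: desc_def)
    show ?thesis
    proof (cases "i = j")
      case True
      then show ?thesis using less.hyps[OF li(1) I(4)] J(4) e by simp
    next
      case ij: False
      show ?thesis
      proof (cases "adj i j")
        case False
        define u where "u = s j \<otimes> (s i \<otimes> w)"
        have u: "u \<in> carrier G" "u = s i \<otimes> (s j \<otimes> w)"
          using I J commute_left[OF I(1) J(1) False ij I(2)] by (simp_all add: u_def)
        have e1: "s j \<otimes> u = s i \<otimes> w" using I J by (simp add: u_def)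
        have e2: "s i \<otimes> u = s j \<otimes> w" using I J by (simp add: u(2))
        have d: "\<not> desc j u"
          using desc_s_iff[OF J(1), of "s i \<otimes> w"] I J
            two_descents_commute[OF I(1) J(1) ij False I(2) I(3) J(3)] by (simp add: u_def)
        have "\<not> adj j i" using False adj_sym by blast
        then have d': "\<not> desc i u"
          using desc_s_iff[OF I(1), of "s j \<otimes> w"] I J
            two_descents_commute[OF J(1) I(1) ij[symmetric] _ I(2) J(3) I(3)] by (simp add: u(2))
        obtain us where us: "reduced us u" using reduced_exists u by blast
        have "foldr \<tau> is' x = foldr \<tau> (j # us) x"
          using less.hyps[OF li(1) I(4)] reduced_Cons[OF us J(1) d] e1 by simp
        moreover have "foldr \<tau> js' x = foldr \<tau> (i # us) x"
          using less.hyps[OF li(2) J(4)] reduced_Cons[OF us I(1) d'] e2 by simp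
        ultimately show ?thesis using e \<tau>_commute[OF I(1) J(1) ij False] by simp
      next
        case True
        \<comment> \<open>What is left of w after the longest element of the rank two subgroup is
          removed; its reduced word \<open>us\<close> is the common ending.\<close>
        define u where "u = s i \<otimes> (s j \<otimes> (s i \<otimes> w))"
        have u: "u \<in> carrier G" "u = s j \<otimes> (s i \<otimes> (s j \<otimes> w))"
          using I J braid_left[OF I(1) J(1) True ij I(2)] by (auto simp: u_def)
        have e1: "s i \<otimes> u = s j \<otimes> (s i \<otimes> w)" using I J by (auto simp: u_def)
        have e2: "s j \<otimes> u = s i \<otimes> (s j \<otimes> w)" using I J unfolding u(2) by auto
        have e3: "s j \<otimes> (s i \<otimes> u) = s i \<otimes> w" "s i \<otimes> (s j \<otimes> u) = s j \<otimes> w"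
          using I J by (simp_all add: e1 e2)
        note b = two_descents_braid[OF I(1) J(1) ij True I(2) I(3) J(3)]
        note b' = two_descents_braid[OF J(1) I(1) ij[symmetric] adj_sym[OF True] I(2) J(3) I(3)]
        have d: "\<not> desc i u" "\<not> desc j (s i \<otimes> u)"
          using desc_s_iff[OF I(1), of "s j \<otimes> (s i \<otimes> w)"] desc_s_iff[OF J(1), of "s i \<otimes> w"] b I J e1
          by (simp_all add: u_def)
        have d': "\<not> desc j u" "\<not> desc i (s j \<otimes> u)"
          using desc_s_iff[OF J(1), of "s i \<otimes> (s j \<otimes> w)"] desc_s_iff[OF I(1), of "s j \<otimes> w"] b' I J e2
          by (simp_all add: u(2))
        obtain us where us: "reduced us u" using reduced_exists u by blast
        have "reduced (j # i # us) (s i \<otimes> w)" "reduced (i # j # us) (s j \<otimes> w)"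
          unfolding e3[symmetric] using us I(1) J(1) d d' by (blast intro: reduced_Cons)+
        then have "foldr \<tau> is' x = foldr \<tau> (j # i # us) x" "foldr \<tau> js' x = foldr \<tau> (i # j # us) x"
          using less.hyps[OF li(1) I(4)] less.hyps[OF li(2) J(4)] by auto
        then show ?thesis using e \<tau>_braid[OF I(1) J(1) ij True] by simp
      qed
    qed
  qed
qed

section \<open>The sign character\<close>

abbreviation sgn_w :: "'g \<Rightarrow> int" where "sgn_w \<equiv> cox_sign G (s ` I)"

lemma sgn_s: "i \<in> I \<Longrightarrow> w \<in> carrier G \<Longrightarrow> sgn_w (s i \<otimes> w) = - sgn_w w"
  by (rule len_s_cases[of i w]) (simp_all add: cox_sign_def)

lemma sgn_one [simp]: "sgn_w \<one> = 1"
  by (simp add: cox_sign_def)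

lemma sgn_mult:
  assumes "u \<in> carrier G" "w \<in> carrier G" shows "sgn_w (u \<otimes> w) = sgn_w u * sgn_w w"
  using assms(1)
proof (induction u rule: word_induct)
  case one
  then show ?case using assms by simp
next
  case (step i u)
  then show ?case using assms by (simp add: m_assoc sgn_s)
qed

lemma sgn_inv: "w \<in> carrier G \<Longrightarrow> sgn_w (inv w) = sgn_w w"
  by (simp add: cox_sign_def len_inv)

end

section \<open>Laurent polynomials\<close>

lemma poly_mapping_add_induct [case_names single add]:
  assumes "\<And>k c. P (Poly_Mapping.single k c)" "\<And>f g. P f \<Longrightarrow> P g \<Longrightarrow> P (f + g)"
  shows "P f"
proof (induction f rule: update_induct)
  case const
  then show ?case using assms(1)[of undefined 0] by simp
next
  case (update f a b)
  have "Poly_Mapping.update a b f = f + Poly_Mapping.single a b"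
    using update(1)
    by (intro poly_mapping_eqI) (auto simp: lookup_update lookup_add lookup_single in_keys_iff when_def)
  then show ?case using update(3) assms by simp
qed

section \<open>The involution inverting q\<close>

lemma laurent_bar_add: "laurent_bar (f + g) = laurent_bar f + laurent_bar g"
  by (simp add: laurent_bar_def map_key_plus)

lemma lookup_laurent_bar: "Poly_Mapping.lookup (laurent_bar f) k = Poly_Mapping.lookup f (- k)"
  by (simp add: laurent_bar_def map_key.rep_eq inj_on_def)

lemma laurent_bar_single:
  "laurent_bar (Poly_Mapping.single k c) = Poly_Mapping.single (- k) c"
  by (intro poly_mapping_eqI) (auto simp: lookup_laurent_bar lookup_single when_def)

lemma laurent_bar_zero [simp]: "laurent_bar 0 = 0"
  by (intro poly_mapping_eqI) (simp add: lookup_laurent_bar)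

lemma laurent_bar_one [simp]: "laurent_bar 1 = 1"
  by (simp flip: single_one add: laurent_bar_single)

lemma laurent_bar_uminus: "laurent_bar (- f) = - laurent_bar f"
  by (intro poly_mapping_eqI) (simp add: lookup_laurent_bar)

lemma laurent_bar_diff: "laurent_bar (f - g) = laurent_bar f - laurent_bar g"
  by (intro poly_mapping_eqI) (simp add: lookup_laurent_bar lookup_minus)

lemma laurent_bar_q_pow [simp]: "laurent_bar (q_pow k) = q_pow (- k)"
  by (simp add: q_pow_def laurent_bar_single)

lemma laurent_bar_sum: "laurent_bar (sum f A) = (\<Sum>a\<in>A. laurent_bar (f a))"
  by (induction A rule: infinite_finite_induct) (auto simp: laurent_bar_add)

lemma laurent_bar_mult: "laurent_bar (f * g) = laurent_bar f * laurent_bar g"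
proof (induction f rule: poly_mapping_add_induct)
  case (single k c)
  show ?case
    by (induction g rule: poly_mapping_add_induct)
      (auto simp: laurent_bar_add laurent_bar_single distrib_left mult_single)
next
  case (add f g)
  then show ?case by (simp add: laurent_bar_add distrib_right)
qed

lemma q_pow_add: "q_pow (k + l) = q_pow k * q_pow l"
  by (simp add: q_pow_def mult_single)

lemma q_pow_0 [simp]: "q_pow 0 = 1"
  by (simp add: q_pow_def)

lemma q_pow_cancel [simp]: "q_pow (- k) * q_pow k = 1" "q_pow k * q_pow (- k) = 1"
  by (simp_all flip: q_pow_add)

lemma q_pow_cancel_left [simp]:
  "q_pow (- k) * (q_pow k * f) = f" "q_pow k * (q_pow (- k) * f) = f"
  by (simp_all flip: mult.assoc)

lemma lookup_q_pow_mult: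
  "Poly_Mapping.lookup (q_pow k * f) n = Poly_Mapping.lookup f (n - k)"
proof (induction f rule: poly_mapping_add_induct)
  case (single l c)
  then show ?case by (auto simp: q_pow_def mult_single lookup_single when_def)
next
  case (add f g)
  then show ?case by (simp add: distrib_left lookup_add)
qed

section \<open>Evaluation at q = 1\<close>

definition at_one :: "laurent \<Rightarrow> int"
  where "at_one f = (\<Sum>k\<in>Poly_Mapping.keys f. Poly_Mapping.lookup f k)"

lemma at_one_superset:
  assumes "finite S" "Poly_Mapping.keys f \<subseteq> S"
  shows "at_one f = (\<Sum>k\<in>S. Poly_Mapping.lookup f k)"
  unfolding at_one_def
  by (rule sum.mono_neutral_left) (use assms in \<open>auto simp: in_keys_iff\<close>)

lemma at_one_add [simp]: "at_one (f + g) = at_one f + at_one g"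
  using keys_add[of f g]
  by (simp add: at_one_superset[of "Poly_Mapping.keys f \<union> Poly_Mapping.keys g"] lookup_add sum.distrib)

lemma at_one_zero [simp]: "at_one 0 = 0"
  by (simp add: at_one_def)

lemma at_one_uminus [simp]: "at_one (- f) = - at_one f"
  using at_one_add[of f "- f"] by simp

lemma at_one_diff [simp]: "at_one (f - g) = at_one f - at_one g"
  using at_one_add[of f "- g"] by simp

lemma at_one_single [simp]: "at_one (Poly_Mapping.single k c) = c"
  by (simp add: at_one_def)

lemma at_one_mult [simp]: "at_one (f * g) = at_one f * at_one g"
proof (induction f rule: poly_mapping_add_induct)
  case (single k c)
  show ?case
    by (induction g rule: poly_mapping_add_induct) (auto simp: distrib_left mult_single)
next
  case (add f g)
  then show ?case by (simp add: distrib_right)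
qed

lemma at_one_of_int [simp]: "at_one (of_int c) = c"
  by (simp flip: single_of_int)

lemma at_one_one [simp]: "at_one 1 = 1"
  using at_one_of_int[of 1] by simp

lemma at_one_q_pow [simp]: "at_one (q_pow k) = 1"
  by (simp add: q_pow_def)

lemma at_one_power [simp]: "at_one (f ^ n) = at_one f ^ n"
  by (induction n) auto

lemma at_one_sum [simp]: "at_one (sum f A) = (\<Sum>a\<in>A. at_one (f a))"
  by (induction A rule: infinite_finite_induct) auto

lemma poly_at_q_pCons: "poly_at_q (pCons a p) = of_int a + q_pow 1 * poly_at_q p"
  by (cases "a = 0 \<and> p = 0") (auto simp: poly_at_q_def map_poly_pCons)

lemma poly_at_q_0 [simp]: "poly_at_q 0 = 0"
  by (simp add: poly_at_q_def)

lemma poly_at_q_1 [simp]: "poly_at_q 1 = 1"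
  using poly_at_q_pCons[of 1 0] by (simp flip: one_pCons)

lemma at_one_poly_at_q [simp]: "at_one (poly_at_q p) = poly p 1"
  by (induction p) (auto simp: poly_at_q_pCons)

text \<open>Exponents are measured in powers of \<open>q\<^bsup>1/2\<^esup>\<close>.\<close>

definition deg_le :: "int \<Rightarrow> laurent set"
  where "deg_le n = {f. \<forall>k\<in>Poly_Mapping.keys f. 2 * k \<le> n}"

lemma deg_le_0 [simp]: "0 \<in> deg_le n"
  by (simp add: deg_le_def)

lemma deg_le_add: "f \<in> deg_le n \<Longrightarrow> g \<in> deg_le n \<Longrightarrow> f + g \<in> deg_le n"
  using keys_add[of f g] by (auto simp: deg_le_def)

lemma deg_le_uminus: "f \<in> deg_le n \<Longrightarrow> - f \<in> deg_le n"
  by (auto simp: deg_le_def in_keys_iff)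

lemma deg_le_diff: "f \<in> deg_le n \<Longrightarrow> g \<in> deg_le n \<Longrightarrow> f - g \<in> deg_le n"
  using deg_le_add[OF _ deg_le_uminus, of f n g] by simp

lemma deg_le_mono: "f \<in> deg_le n \<Longrightarrow> n \<le> m \<Longrightarrow> f \<in> deg_le m"
  by (auto simp: deg_le_def)

lemma deg_le_mult: "f \<in> deg_le n \<Longrightarrow> g \<in> deg_le m \<Longrightarrow> n + m \<le> k \<Longrightarrow> f * g \<in> deg_le k"
  using keys_mult[of f g] by (fastforce simp: deg_le_def)

lemma deg_le_sum: "(\<And>a. a \<in> A \<Longrightarrow> f a \<in> deg_le n) \<Longrightarrow> sum f A \<in> deg_le n"
  by (induction A rule: infinite_finite_induct) (auto intro: deg_le_add)

lemma deg_le_q_pow: "2 * k \<le> n \<Longrightarrow> q_pow k \<in> deg_le n"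
  by (auto simp: deg_le_def q_pow_def)

lemma deg_le_of_int: "0 \<le> n \<Longrightarrow> of_int c \<in> deg_le n"
  by (auto simp: deg_le_def simp flip: single_of_int split: if_splits)

lemma deg_le_one: "0 \<le> n \<Longrightarrow> 1 \<in> deg_le n"
  using deg_le_of_int[of n 1] by simp

lemma deg_le_poly_at_q: "2 * int (degree p) \<le> n \<Longrightarrow> poly_at_q p \<in> deg_le n"
proof (induction p arbitrary: n)
  case 0
  then show ?case by simp
next
  case (pCons a p)
  show ?case
  proof (cases "p = 0")
    case True
    then show ?thesis using pCons by (simp add: poly_at_q_pCons deg_le_of_int)
  next
    case False
    then have "poly_at_q p \<in> deg_le (n - 2)" using pCons by simp
    then have "q_pow 1 * poly_at_q p \<in> deg_le n"
      by (intro deg_le_mult[OF deg_le_q_pow[of 1 2]]) auto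
    then show ?thesis using pCons by (simp add: poly_at_q_pCons deg_le_of_int deg_le_add)
  qed
qed

text \<open>The symmetry moves the exponents about \<open>n/2\<close>, while the bound puts all of them
  strictly below.\<close>

lemma symmetric_deg_le_zero:
  assumes "laurent_bar f = q_pow (- n) * f" "f \<in> deg_le (n - 1)"
  shows "f = 0"
proof (rule ccontr)
  assume "f \<noteq> 0"
  then obtain k where k: "k \<in> Poly_Mapping.keys f" by (metis keys_eq_empty ex_in_conv)
  have "Poly_Mapping.lookup (laurent_bar f) (- k) = Poly_Mapping.lookup f (n - k)"
    unfolding assms(1) lookup_q_pow_mult by (simp add: algebra_simps)
  then have "n - k \<in> Poly_Mapping.keys f" using k by (simp add: lookup_laurent_bar in_keys_iff)
  then have "2 * (n - k) \<le> n - 1" "2 * k \<le> n - 1" using k assms(2) unfolding deg_le_def by blast+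
  then show False by (simp add: algebra_simps)
qed

section \<open>The module of a rooted tree\<close>

text \<open>The node \<open>e\<close> stands for the identity element. As a formal parent of the
  root it lets the recursion for \<open>wn\<close> start without a special case, and depths counted
  from \<open>e\<close> become the lengths of the \<open>wn i\<close>.\<close>

locale tree_words = simply_laced_words G I s adj \<rho> root pos
  for G :: "('g, 'h) monoid_scheme" (structure) and I s adj
    and \<rho> :: "'g \<Rightarrow> 'v :: ab_group_add \<Rightarrow> 'v" and root pos +
  fixes e :: nat and par dep :: "nat \<Rightarrow> nat" and wn :: "nat \<Rightarrow> 'g"
  assumes e_notin: "e \<notin> I"
    and par_in: "i \<in> I \<Longrightarrow> par i \<in> insert e I"
    and dep_e: "dep e = 0"
    and dep_par: "i \<in> I \<Longrightarrow> dep i = Suc (dep (par i))"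
    and adj_iff: "i \<in> I \<Longrightarrow> j \<in> I \<Longrightarrow> adj i j \<longleftrightarrow> par i = j \<or> par j = i"
    and wn_e: "wn e = \<one>"
    and wn_par: "i \<in> I \<Longrightarrow> wn i = s i \<otimes> wn (par i)"
begin

abbreviation J :: "nat set" where "J \<equiv> insert e I"

lemma finite_J: "finite J"
  using finite_I by simp

lemma adj_neq: "i \<in> I \<Longrightarrow> j \<in> I \<Longrightarrow> adj i j \<Longrightarrow> i \<noteq> j"
  using dep_par adj_iff by fastforce

lemma wn_closed [simp]: "i \<in> J \<Longrightarrow> wn i \<in> carrier G"
proof (induction "dep i" arbitrary: i rule: less_induct)
  case less
  then show ?case using par_in[of i] dep_par[of i] wn_par[of i] wn_e by (cases "i = e") auto
qed

lemma s_wn: "i \<in> I \<Longrightarrow> s i \<otimes> wn i = wn (par i)"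
  using wn_par wn_closed[OF par_in] by simp

text \<open>Suppose \<open>wn i\<close> had a second descent j. If i and j commute, j is a descent
  of \<open>wn (par i)\<close>, hence equal to \<open>par i\<close>, which is adjacent to i. If they
  are adjacent, the braid splitting forces \<open>j = par i\<close> and then makes i a descent of
  \<open>wn (par j)\<close>, whose only possible descent has smaller depth than i.\<close>

lemma desc_wn_len_wn:
  "i \<in> J \<Longrightarrow> (\<forall>j\<in>I. desc j (wn i) \<longleftrightarrow> j = i) \<and> len (wn i) = dep i"
proof (induction "dep i" arbitrary: i rule: less_induct)
  case less
  show ?case
  proof (cases "i = e")
    case True
    then show ?thesis using wn_e dep_e e_notin by (auto simp: desc_def)
  next
    case False
    then have i: "i \<in> I" using less by simp
    have pc: "wn (par i) \<in> carrier G" using par_in i by simp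
    have ih: "(\<forall>j\<in>I. desc j (wn (par i)) \<longleftrightarrow> j = par i) \<and> len (wn (par i)) = dep (par i)"
      using less.hyps[of "par i"] dep_par[OF i] par_in[OF i] by simp
    have "i \<noteq> par i" using dep_par[OF i] by auto
    then have nd: "\<not> desc i (wn (par i))" using ih i by blast
    have l: "len (wn i) = dep i"
      using not_desc_len[OF i pc nd] ih dep_par[OF i] wn_par[OF i] by simp
    have di: "desc i (wn i)" using desc_s_iff[OF i pc] nd wn_par[OF i] by simp
    have "j = i" if j: "j \<in> I" and d: "desc j (wn i)" for j
    proof (rule ccontr)
      assume ne: "j \<noteq> i"
      have wc: "wn i \<in> carrier G" using i by simp
      show False
      proof (cases "adj i j")
        case False
        then have "desc j (wn (par i))"
          using two_descents_commute[OF i j _ False wc di d] ne s_wn[OF i] by auto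
        then show False using ih j False adj_iff[OF i j] by simp
      next
        case True
        note b = two_descents_braid[OF i j ne[symmetric] True wc di d]
        have jp: "j = par i" using b(1) s_wn[OF i] ih j by auto
        have "desc i (wn (par j))" using b(2) s_wn[OF i] s_wn[OF j] jp by simp
        moreover have "par j \<in> J" "dep (par j) < dep i"
          using par_in[OF j] dep_par[OF j] dep_par[OF i] jp by auto
        ultimately have "i = par j" using less.hyps[of "par j"] i by blast
        then show False using dep_par[OF j] dep_par[OF i] jp by simp
      qed
    qed
    then show ?thesis using di l by blast
  qed
qed

lemma desc_wn: "i \<in> J \<Longrightarrow> j \<in> I \<Longrightarrow> desc j (wn i) \<longleftrightarrow> j = i"
  using desc_wn_len_wn by blast

lemma len_wn: "i \<in> J \<Longrightarrow> len (wn i) = dep i"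
  using desc_wn_len_wn by blast

lemma wn_inj: assumes "i \<in> J" "j \<in> J" "wn i = wn j" shows "i = j"
  by (metis assms desc_wn insertE)

text \<open>The module spanned by the classes of \<open>C\<^sub>1\<close> (node \<open>e\<close>) and of the \<open>C\<close>-elements of the
  \<open>wn i\<close>: the element \<open>C\<^sub>s\<close> of the node \<open>j\<close> maps \<open>x\<close> to \<open>L j x\<close> times the basis vector
  at \<open>j\<close>.\<close>

definition kap :: "nat \<Rightarrow> nat \<Rightarrow> laurent"
  where "kap j i = (if i = j then 1 + q_pow 1 else if i \<in> I \<and> par i = j then q_pow 1
    else if par j = i then 1 else 0)"

definition L :: "nat \<Rightarrow> (nat \<Rightarrow> laurent) \<Rightarrow> laurent"
  where "L j x = (\<Sum>i\<in>J. kap j i * x i)"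

definition \<tau> :: "nat \<Rightarrow> (nat \<Rightarrow> laurent) \<Rightarrow> nat \<Rightarrow> laurent"
  where "\<tau> j x = (\<lambda>i. - x i + (if i = j then L j x else 0))"

lemma \<tau>_apply: "\<tau> j x i = - x i + (if i = j then L j x else 0)"
  by (simp add: \<tau>_def)

lemma L_\<tau>: assumes "i \<in> I" shows "L j (\<tau> i x) = - L j x + kap j i * L i x"
proof -
  have "L j (\<tau> i x) = (\<Sum>k\<in>J. - (kap j k * x k) + (if k = i then kap j k * L i x else 0))"
    unfolding L_def[of j] by (intro sum.cong refl) (auto simp: \<tau>_apply algebra_simps)
  also have "\<dots> = - L j x + kap j i * L i x"
    using assms finite_J by (simp only: sum.distrib sum_negf L_def[of j x]) simp
  finally show ?thesis .
qed

lemma kap_self [simp]: "kap j j = 1 + q_pow 1"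
  by (simp add: kap_def)

lemma kap_nonadj: "i \<in> I \<Longrightarrow> j \<in> I \<Longrightarrow> i \<noteq> j \<Longrightarrow> \<not> adj i j \<Longrightarrow> kap i j = 0"
  by (auto simp: kap_def adj_iff)

text \<open>Only this product enters the braid relations. The basis is not normalized by powers of
  \<open>q\<close> to the half length: an edge contributes 1 when the new node is farther from the
  root and q when it is nearer. After the normalization both entries would be the square root of
  q.\<close>

lemma kap_adj: 
  assumes "i \<in> I" "j \<in> I" "adj i j" shows "kap i j * kap j i = q_pow 1"
proof -
  have "par i = j \<Longrightarrow> par j \<noteq> i" using dep_par[of i] dep_par[of j] assms by auto
  then show ?thesis using assms adj_neq[OF assms] by (auto simp: kap_def adj_iff)
qed

lemma L_\<tau>_self: "j \<in> I \<Longrightarrow> L j (\<tau> j x) = q_pow 1 * L j x"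
  by (simp add: L_\<tau> algebra_simps)

lemma \<tau>_commute:
  assumes "i \<in> I" "j \<in> I" "i \<noteq> j" "\<not> adj i j" shows "\<tau> i (\<tau> j x) = \<tau> j (\<tau> i x)"
proof -
  have "kap i j = 0" "kap j i = 0" using kap_nonadj adj_sym assms by blast+
  then have "L i (\<tau> j x) = - L i x" "L j (\<tau> i x) = - L j x" using assms by (simp_all add: L_\<tau>)
  then show ?thesis using assms by (intro ext) (simp add: \<tau>_apply)
qed

text \<open>The terms quadratic in \<open>kap\<close> are absorbed because the product of the two
  entries is q. What remains is symmetric in i and j, and this symmetry is the braid
  relation.\<close>

lemma \<tau>_\<tau>_\<tau>:
  assumes "i \<in> I" "j \<in> I" "adj i j"
  shows "\<tau> i (\<tau> j (\<tau> i x)) = (\<lambda>k. - x k + (if k = i then L i x - kap i j * L j x else 0)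
    + (if k = j then L j x - kap j i * L i x else 0))"
proof -
  have ne: "i \<noteq> j" using adj_neq assms by blast
  have k: "kap i j * (kap j i * L i x) = q_pow 1 * L i x"
    using kap_adj[OF assms] by (metis mult.assoc)
  have 1: "L j (\<tau> i x) = - L j x + kap j i * L i x" using assms by (simp add: L_\<tau>)
  have 2: "L i (\<tau> j (\<tau> i x)) = - kap i j * L j x"
    using assms by (simp add: L_\<tau>[of j] 1 L_\<tau>_self right_diff_distrib k)
  show ?thesis
    using ne by (intro ext) (simp add: \<tau>_apply 1 2)
qed

lemma \<tau>_braid:
  assumes "i \<in> I" "j \<in> I" "i \<noteq> j" "adj i j"
  shows "\<tau> i (\<tau> j (\<tau> i x)) = \<tau> j (\<tau> i (\<tau> j x))"
  using assms adj_sym by (auto simp: \<tau>_\<tau>_\<tau>)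

section \<open>The vector attached to a group element\<close>

definition X :: "'g \<Rightarrow> nat \<Rightarrow> laurent"
  where "X w = foldr \<tau> (SOME is. reduced is w) (\<lambda>i. if i = e then 1 else 0)"

lemma X_reduced: assumes "reduced is w" shows "X w = foldr \<tau> is (\<lambda>i. if i = e then 1 else 0)"
  unfolding X_def by (rule matsumoto[of \<tau>, OF \<tau>_commute \<tau>_braid someI[of "\<lambda>is. reduced is w"]]) (use assms in auto)

lemma X_one: "X \<one> = (\<lambda>i. if i = e then 1 else 0)"
  using X_reduced[of "[]" \<one>] by (simp add: reduced_def)

lemma X_s: assumes "i \<in> I" "w \<in> carrier G" "\<not> desc i w" shows "X (s i \<otimes> w) = \<tau> i (X w)"
proof -
  obtain "is" where "reduced is w" using reduced_exists assms by blast
  then show ?thesis using X_reduced[of "is"] X_reduced[OF reduced_Cons[of "is" w i]] assms by simp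
qed

lemma X_desc: assumes "i \<in> I" "w \<in> carrier G" "desc i w" shows "X w = \<tau> i (X (s i \<otimes> w))"
  using X_s[of i "s i \<otimes> w"] assms by (simp add: desc_s_iff)

text \<open>The operator of a letter can make only the coordinate at that letter nonzero, and the
  letters of \<open>wn i\<close> have depth at most \<open>dep i\<close>.\<close>

lemma X_wn_0: "i \<in> J \<Longrightarrow> j \<in> J \<Longrightarrow> dep i < dep j \<Longrightarrow> X (wn i) j = 0"
proof (induction "dep i" arbitrary: i rule: less_induct)
  case less
  show ?case
  proof (cases "i = e")
    case True
    then show ?thesis using less.prems wn_e by (auto simp: X_one)
  next
    case False
    then have i: "i \<in> I" using less by simp
    have p: "par i \<in> J" "dep (par i) < dep i" using par_in[OF i] dep_par[OF i] by auto
    have "X (wn i) = \<tau> i (X (wn (par i)))"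
      using X_desc[OF i] desc_wn i s_wn[OF i] by simp
    then show ?thesis using less.hyps[OF p(2) p(1)] less.prems p by (auto simp: \<tau>_apply)
  qed
qed

lemma kap_deg:
  assumes "i \<in> J" "j \<in> I" "i \<noteq> j" shows "kap j i \<in> deg_le (1 + int (dep i) - int (dep j))"
  using assms dep_par[of i] dep_par[of j] by (auto simp: kap_def intro: deg_le_q_pow deg_le_one)

lemma L_minus_self:
  assumes "j \<in> I" shows "- x j + L j x = q_pow 1 * x j + (\<Sum>i\<in>J-{j}. kap j i * x i)"
proof -
  have "L j x = kap j j * x j + (\<Sum>i\<in>J-{j}. kap j i * x i)"
    unfolding L_def by (rule sum.remove) (use assms finite_J in auto)
  then show ?thesis by (simp add: algebra_simps)
qed

text \<open>The bound of a Kazhdan-Lusztig polynomial for the pair (\<open>wn i\<close>, w), in half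
  powers of q. For \<open>w = wn i\<close> the lengths agree, so that \<open>- 1\<close> is the same
  bound, applied after removal of the leading 1.\<close>

definition X_bound :: "'g \<Rightarrow> nat \<Rightarrow> bool"
  where "X_bound w i \<longleftrightarrow> (if w = wn i then X w i - 1 \<in> deg_le (- 1)
    else X w i \<in> deg_le (int (len w) - int (dep i) - 1))"

lemma X_bound_weak:
  assumes "X_bound w i" "i \<in> J" shows "X w i \<in> deg_le (int (len w) - int (dep i))"
proof (cases "w = wn i")
  case True
  then have "X w i - 1 \<in> deg_le 0" using assms by (auto simp: X_bound_def intro: deg_le_mono)
  then have "X w i - 1 + 1 \<in> deg_le 0" by (intro deg_le_add deg_le_one) auto
  then show ?thesis using True assms by (simp add: len_wn)
next
  case False
  then show ?thesis using assms by (auto simp: X_bound_def intro: deg_le_mono)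
qed

text \<open>Constant terms can only arise along the paths \<open>wn i\<close>; as in the positivity argument for
  roots, one splits off an element of a parabolic subgroup of rank two on the left.\<close>

lemma X_bound_all: "w \<in> carrier G \<Longrightarrow> i \<in> J \<Longrightarrow> X_bound w i"
proof (induction "len w" arbitrary: w i rule: less_induct)
  case less
  note w = \<open>w \<in> carrier G\<close>
  have weak: "X u i \<in> deg_le (int (len u) - int (dep i))"
    if "len u < len w" "u \<in> carrier G" "i \<in> J" for u i
    using less.hyps[of u i] X_bound_weak that by simp
  have strong: "X u i \<in> deg_le (int (len u) - int (dep i) - 1)"
    if "len u < len w" "u \<in> carrier G" "i \<in> J" "u \<noteq> wn i" for u i
    using less.hyps[of u i] that by (simp add: X_bound_def)
  show ?case
  proof (cases "w = \<one>")
    case True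
    have "\<one> = wn i \<longleftrightarrow> i = e" using wn_inj[of e i] less.prems(2) wn_e by auto
    then show ?thesis unfolding True X_bound_def X_one by simp
  next
    case w1: False
    \<comment> \<open>When w is one of the \<open>wn k\<close>, its unique descent is k itself.
      Consequently w can coincide with \<open>wn i\<close> only for the coordinate
      \<open>i = j\<close>.\<close>
    obtain j where j: "j \<in> I" "desc j w" and wj: "\<And>k. k \<in> J \<Longrightarrow> w = wn k \<Longrightarrow> k = j"
    proof (cases "\<exists>k\<in>J. w = wn k")
      case True
      then obtain k where k: "k \<in> J" "w = wn k" by blast
      with w1 wn_e have "k \<in> I" by auto
      then show ?thesis using that[of k] k wn_inj desc_wn by blast
    next
      case False
      then show ?thesis using that left_descent_exists[OF w w1] by (fastforce simp: desc_def)
    qed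
    define u where "u = s j \<otimes> w"
    have u: "u \<in> carrier G" "w = s j \<otimes> u" "len w = Suc (len u)" "\<not> desc j u"
      using j w desc_len desc_s_iff by (auto simp: u_def)
    have Xw: "X w = \<tau> j (X u)" using X_s j u by simp
    show ?thesis
    proof (cases "i = j")
      case False
      \<comment> \<open>Away from j only the sign changes while the length grows by one, so the weak
        bound for u is the strict bound for w.\<close>
      then have "X w i = - X u i" "w \<noteq> wn i" using Xw wj less.prems by (auto simp: \<tau>_apply)
      then show ?thesis using weak[of u i] u less.prems by (simp add: X_bound_def deg_le_uminus)
    next
      case ij: True
      have Xwj: "X w j = - X u j + L j (X u)" using Xw by (simp add: \<tau>_apply)
      have kap_X: "kap j k * x \<in> deg_le n"
        if "k \<in> J - {j}" "x \<in> deg_le m" "1 + int (dep k) - int (dep j) + m \<le> n" for k x n m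
        using deg_le_mult[OF kap_deg[of k j]] that j by auto
      show ?thesis
      proof (cases "w = wn j")
        case True
        have up: "u = wn (par j)" using True j s_wn by (simp add: u_def)
        have p: "par j \<in> J" "par j \<noteq> j" "dep j = Suc (dep (par j))"
          using par_in[OF j(1)] dep_par[OF j(1)] by (auto dest: arg_cong[of _ _ dep])
        have lu: "len u = dep (par j)" using up len_wn p by simp
        \<comment> \<open>The term with q is therefore absent. The leading 1 of \<open>X w j\<close>
          is passed on from the parent, where the entry of \<open>kap\<close> is 1.\<close>
        have "X u j = 0" using X_wn_0[of "par j" j] up p j by simp
        then have "X w j - 1 = (\<Sum>i\<in>J-{j}. kap j i * X u i) - 1"
          using L_minus_self[OF j(1), of "X u"] Xwj by simp
        also have "(\<Sum>i\<in>J-{j}. kap j i * X u i) =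
            kap j (par j) * X u (par j) + (\<Sum>i\<in>J-{j}-{par j}. kap j i * X u i)"
          by (rule sum.remove) (use finite_J p in auto)
        also have "kap j (par j) = 1"
          using p dep_par[of "par j"] by (auto simp: kap_def)
        finally have "X w j - 1 =
            (X u (par j) - 1) + (\<Sum>i\<in>J-{j}-{par j}. kap j i * X u i)" by simp
        moreover have "X u (par j) - 1 \<in> deg_le (- 1)"
          using less.hyps[of u "par j"] u p up by (simp add: X_bound_def)
        moreover have "(\<Sum>i\<in>J-{j}-{par j}. kap j i * X u i) \<in> deg_le (- 1)"
        proof (rule deg_le_sum)
          fix k assume k: "k \<in> J - {j} - {par j}"
          then have "u \<noteq> wn k" using up wn_inj[of "par j" k] p by auto
          then have "X u k \<in> deg_le (int (len u) - int (dep k) - 1)"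
            using strong[of u k] u k by auto
          then show "kap j k * X u k \<in> deg_le (- 1)"
            by (rule kap_X[rotated]) (use k lu p in auto)
        qed
        ultimately have "X w j - 1 \<in> deg_le (- 1)" by (metis deg_le_add)
        then show ?thesis using True ij by (simp add: X_bound_def)
      next
        case wnj: False
        have "X w j \<in> deg_le (int (len w) - int (dep j) - 1)"
        proof (cases "u = \<one>")
          case True
          \<comment> \<open>Here w is the single letter \<open>s j\<close> but not
            \<open>wn j\<close>, so j is not the root and its operator annihilates the coordinate at
            \<open>e\<close>.\<close>
          have "par j \<noteq> e" using True u wnj wn_par[OF j(1)] wn_e by auto
          moreover have "e \<noteq> j" using j e_notin by auto
          ultimately have "kap j k * X \<one> k = 0" for k
            using e_notin by (cases "k = e") (auto simp: X_one kap_def)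
          moreover have "X \<one> j = 0" using \<open>e \<noteq> j\<close> by (simp add: X_one)
          ultimately have "X w j = 0"
            using True Xwj L_minus_self[OF j(1), of "X \<one>"] by (simp del: mult_eq_0_iff)
          then show ?thesis by simp
        next
          case False
          then obtain t where t: "t \<in> I" "desc t u"
            using left_descent_exists[OF u(1)] by (fastforce simp: desc_def)
          have tj: "t \<noteq> j" using t u by auto
          define v where "v = s t \<otimes> u"
          have v: "v \<in> carrier G" "u = s t \<otimes> v" "len u = Suc (len v)" "\<not> desc t v"
            using t u desc_len desc_s_iff by (auto simp: v_def)
          have Xu: "X u = \<tau> t (X v)" using X_s t v by simp
          have Xuk: "X u k = - X v k" if "k \<noteq> t" for k using Xu that by (simp add: \<tau>_apply)
          show ?thesis
          proof (cases "adj t j")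
            case False
            \<comment> \<open>The letters commute and \<open>kap j t\<close> vanishes, so the
              coordinate j of w is, up to sign, that of \<open>s j \<otimes> v\<close>, which is one
              letter shorter than w.\<close>
            have "pull u j = pull v j" using pull_s[OF t(1) j(1) v(1)] v False tj by simp
            then have nd: "\<not> desc j v" using desc_iff_pull j u v by simp
            have "kap j t = 0" using kap_nonadj[of j t] False adj_sym tj t j by blast
            then have "X w j = - X (s j \<otimes> v) j"
              unfolding Xwj X_s[OF j(1) v(1) nd] using Xu L_\<tau>[OF t(1)] tj by (simp add: \<tau>_apply)
            moreover have "len (s j \<otimes> v) < len w" "len (s j \<otimes> v) = len u"
              using not_desc_len[OF j(1) v(1) nd] u v by auto
            ultimately show ?thesis
              using weak[of "s j \<otimes> v" j] u v j by (simp add: deg_le_uminus algebra_simps)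
          next
            case adj: True
            show ?thesis
            proof (cases "desc j v")
              case nd: False
              have "X w j = q_pow 1 * X u j + (\<Sum>i\<in>J-{j}. kap j i * X u i)"
                unfolding Xwj by (rule L_minus_self[OF j(1)])
              also have "(\<Sum>i\<in>J-{j}. kap j i * X u i) =
                  kap j t * X u t + (\<Sum>i\<in>J-{j}-{t}. kap j i * X u i)"
                by (rule sum.remove) (use finite_J tj t in auto)
              finally have eq: "X w j =
                  q_pow 1 * X u j + (kap j t * X u t + (\<Sum>i\<in>J-{j}-{t}. kap j i * X u i))" .
              \<comment> \<open>The term with q costs two half powers. It is affordable because the
                coordinate j of u is that of v up to sign, v is two letters shorter than w, and the
                strict bound holds for v.\<close>
              have "v \<noteq> wn j" using nd desc_wn[of j j] j by auto
              then have "X v j \<in> deg_le (int (len v) - int (dep j) - 1)"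
                using strong[of v j] u v j by auto
              then have "X u j \<in> deg_le (int (len v) - int (dep j) - 1)"
                using Xuk tj deg_le_uminus by auto
              then have 1: "q_pow 1 * X u j \<in> deg_le (int (len w) - int (dep j) - 1)"
                by (intro deg_le_mult[OF deg_le_q_pow[of 1 2]]) (use u v in auto)
              \<comment> \<open>Needed for the strict bound at t: if t is the parent of j, then w
                would be \<open>wn j\<close>, and if j is the parent of t, then v would be
                \<open>wn j\<close>.\<close>
              have "u \<noteq> wn t"
              proof
                assume ut: "u = wn t"
                from adj consider "par j = t" | "par t = j" using adj_iff[OF t(1) j(1)] by blast
                then show False
                proof cases
                  case 1
                  then show False using wnj wn_par[OF j(1)] ut u by simp
                next
                  case 2
                  then have "v = wn j" using s_wn[OF t(1)] ut by (simp add: v_def)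
                  then show False using \<open>v \<noteq> wn j\<close> by simp
                qed
              qed
              then have "X u t \<in> deg_le (int (len u) - int (dep t) - 1)"
                using strong[of u t] u t by auto
              then have 2: "kap j t * X u t \<in> deg_le (int (len w) - int (dep j) - 1)"
                by (rule kap_X[rotated]) (use tj t u in auto)
              have 3: "(\<Sum>i\<in>J-{j}-{t}. kap j i * X u i) \<in> deg_le (int (len w) - int (dep j) - 1)"
              proof (rule deg_le_sum)
                fix k assume k: "k \<in> J - {j} - {t}"
                then have "X u k \<in> deg_le (int (len v) - int (dep k))"
                  using weak[of v k] Xuk[of k] deg_le_uminus u v by auto
                then show "kap j k * X u k \<in> deg_le (int (len w) - int (dep j) - 1)"
                  by (rule kap_X[rotated]) (use k u v in auto)
              qed
              show ?thesis unfolding eq by (intro deg_le_add 1 2 3)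
            next
              case dv: True
              \<comment> \<open>Now w begins with j, t, j. The formula for three operators expresses
                its coordinate j by coordinates of v, of \<open>s t \<otimes> z\<close> and of z,
                all at least two letters shorter than w, so weak bounds suffice.\<close>
              define z where "z = s j \<otimes> v"
              have z: "z \<in> carrier G" "v = s j \<otimes> z" "len v = Suc (len z)" "\<not> desc j z"
                using j v dv desc_len desc_s_iff by (auto simp: z_def)
              have Xv: "X v = \<tau> j (X z)" using X_s j z by simp
              have adj': "adj j t" using adj adj_sym by blast
              have "pull u j = pull z t"
                using pull_s[OF t(1) j(1) v(1)] pull_s[OF j(1) t(1) z(1)] pull_s[OF j(1) j(1) z(1)]
                  v z adj adj' tj by simp
              then have nt: "\<not> desc t z" using desc_iff_pull j t u z by simp
              have "X w j = - X z j + L j (X z) - kap j t * L t (X z)"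
                unfolding Xw Xu Xv \<tau>_\<tau>_\<tau>[OF j(1) t(1) adj'] using tj by simp
              moreover have "- X z j + L j (X z) = X v j" unfolding Xv by (simp add: \<tau>_apply)
              moreover have "L t (X z) = X (s t \<otimes> z) t + X z t"
                unfolding X_s[OF t(1) z(1) nt] by (simp add: \<tau>_apply)
              ultimately have eq: "X w j = X v j - kap j t * (X (s t \<otimes> z) t + X z t)" by simp
              have lt: "len (s t \<otimes> z) = Suc (len z)" using not_desc_len[OF t(1) z(1) nt] .
              have "X (s t \<otimes> z) t \<in> deg_le (int (len z) + 1 - int (dep t))"
                using weak[of "s t \<otimes> z" t] lt t u v z by (simp add: algebra_simps)
              moreover have "X z t \<in> deg_le (int (len z) + 1 - int (dep t))"
                using weak[of z t] t u v z by (auto intro: deg_le_mono)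
              ultimately have "X (s t \<otimes> z) t + X z t \<in> deg_le (int (len z) + 1 - int (dep t))"
                by (rule deg_le_add)
              then have 1: "kap j t * (X (s t \<otimes> z) t + X z t) \<in> deg_le (int (len w) - int (dep j) - 1)"
                by (rule kap_X[rotated]) (use tj t u v z in auto)
              have "X v j \<in> deg_le (int (len v) - int (dep j))" using weak[of v j] u v j by auto
              then have 2: "X v j \<in> deg_le (int (len w) - int (dep j) - 1)"
                by (rule deg_le_mono) (use u v in auto)
              show ?thesis unfolding eq by (intro deg_le_diff 1 2)
            qed
          qed
        qed
        then show ?thesis using wnj ij by (simp add: X_bound_def)
      qed
    qed
  qed
qed

text \<open>The semilinear map that multiplies the basis vector at i by the power of q prescribed
  for the bar of \<open>C\<close> at \<open>wn i\<close>, an element of length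
  \<open>dep i\<close>.\<close>

definition bar_M :: "(nat \<Rightarrow> laurent) \<Rightarrow> nat \<Rightarrow> laurent"
  where "bar_M x = (\<lambda>i. q_pow (- int (dep i)) * laurent_bar (x i))"

text \<open>The entrywise form of the statement that the bar of C_s is C_s divided by q on this
  module.\<close>

lemma kap_bar:
  assumes "j \<in> I" "i \<in> J"
  shows "kap j i * q_pow (- int (dep i)) = q_pow 1 * (q_pow (- int (dep j)) * laurent_bar (kap j i))"
proof -
  consider "i = j" | "i \<noteq> j" "i \<in> I" "par i = j" | "i \<noteq> j" "\<not> (i \<in> I \<and> par i = j)" "par j = i"
    | "i \<noteq> j" "\<not> (i \<in> I \<and> par i = j)" "par j \<noteq> i" by blast
  then show ?thesis
  proof cases
    case 1
    then show ?thesis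
      by (simp add: laurent_bar_add algebra_simps flip: q_pow_add)
  next
    case 2
    then show ?thesis
      using dep_par[of i] by (simp add: kap_def algebra_simps flip: q_pow_add)
  next
    case 3
    then show ?thesis
      using dep_par[of j] assms by (auto simp: kap_def algebra_simps simp flip: q_pow_add)
  next
    case 4
    then show ?thesis by (auto simp: kap_def)
  qed
qed

lemma L_bar_M:
  assumes "j \<in> I"
  shows "L j (bar_M x) = q_pow 1 * (q_pow (- int (dep j)) * laurent_bar (L j x))"
proof -
  have "L j (bar_M x) = (\<Sum>i\<in>J. (kap j i * q_pow (- int (dep i))) * laurent_bar (x i))"
    by (simp add: L_def bar_M_def mult.assoc)
  also have "\<dots> = (\<Sum>i\<in>J. q_pow 1 * (q_pow (- int (dep j)) * laurent_bar (kap j i * x i)))"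
    using assms by (intro sum.cong refl) (simp add: kap_bar laurent_bar_mult mult.assoc)
  finally show ?thesis by (simp add: L_def laurent_bar_sum sum_distrib_left)
qed

text \<open>Multiplication by \<open>H\<^sub>s\<inverse> = q\<inverse> (H\<^sub>s + 1 - q)\<close> on the right hand side.\<close>

lemma bar_M_\<tau>:
  assumes "j \<in> I"
  shows "bar_M (\<tau> j x) i = q_pow (- 1) * (\<tau> j (bar_M x) i + (1 - q_pow 1) * bar_M x i)"
proof -
  have "\<tau> j (bar_M x) i + (1 - q_pow 1) * bar_M x i =
      q_pow 1 * (- bar_M x i + (if i = j then q_pow (- int (dep j)) * laurent_bar (L j x) else 0))"
    by (simp add: \<tau>_apply L_bar_M[OF assms] algebra_simps)
  moreover have "- bar_M x i + (if i = j then q_pow (- int (dep j)) * laurent_bar (L j x) else 0)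
      = bar_M (\<tau> j x) i"
    by (simp add: bar_M_def \<tau>_apply laurent_bar_diff laurent_bar_uminus right_diff_distrib)
  ultimately show ?thesis by simp
qed

section \<open>Specialization of the module at q = 1\<close>

lemma at_one_L:
  assumes "j \<in> I"
  shows "at_one (L j x) = 2 * at_one (x j) + (\<Sum>i | i \<in> I \<and> adj i j. at_one (x i))
    + (if par j = e then at_one (x e) else 0)"
proof -
  have "at_one (L j x) = (\<Sum>i\<in>I. at_one (kap j i) * at_one (x i)) + at_one (kap j e) * at_one (x e)"
    using finite_I e_notin by (simp add: L_def)
  also have "(\<Sum>i\<in>I. at_one (kap j i) * at_one (x i)) =
      (\<Sum>i\<in>I. (if i = j then 2 * at_one (x i) else 0) + (if adj i j then at_one (x i) else 0))"
    using assms adj_neq by (intro sum.cong refl) (auto simp: kap_def adj_iff)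
  also have "\<dots> = 2 * at_one (x j) + (\<Sum>i | i \<in> I \<and> adj i j. at_one (x i))"
    using finite_I assms by (simp add: sum.distrib sum.If_cases Int_def)
  also have "at_one (kap j e) * at_one (x e) = (if par j = e then at_one (x e) else 0)"
    using assms e_notin by (auto simp: kap_def)
  finally show ?thesis .
qed

text \<open>\<open>X\<close> follows reduced words only. At q = 1, however, the operator of a letter
  is an involution, so the recursion also holds when the letter shortens the element.\<close>

lemma at_one_X_s:
  assumes "j \<in> I" "w \<in> carrier G"
  shows "at_one (X (s j \<otimes> w) i) = - at_one (X w i) + (if i = j then at_one (L j (X w)) else 0)"
proof (cases "desc j w")
  case False
  then show ?thesis using assms by (auto simp: X_s \<tau>_apply)
next
  case True
  have "X w = \<tau> j (X (s j \<otimes> w))" using X_desc assms True by blast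
  then have "at_one (X w i) = - at_one (X (s j \<otimes> w) i) + (if i = j then at_one (L j (X (s j \<otimes> w))) else 0)"
    "at_one (L j (X w)) = at_one (L j (X (s j \<otimes> w)))"
    using L_\<tau>_self[OF assms(1), of "X (s j \<otimes> w)"] by (simp_all add: \<tau>_apply)
  then show ?thesis by simp
qed

text \<open>At \<open>q = 1\<close> the module is the reflection representation, twisted by the sign character
  and with basis vectors rescaled by the signs of the \<open>wn i\<close>.\<close>

lemma at_one_X_eq:
  fixes F :: "'g \<Rightarrow> nat \<Rightarrow> 'c :: comm_ring_1"
  assumes F_one: "\<And>i. i \<in> J \<Longrightarrow> F \<one> i = (if i = e then 1 else 0)"
    and F_other: "\<And>i j w. i \<in> J \<Longrightarrow> j \<in> I \<Longrightarrow> w \<in> carrier G \<Longrightarrow> i \<noteq> j \<Longrightarrow> F (s j \<otimes> w) i = F w i"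
    and F_self: "\<And>j w. j \<in> I \<Longrightarrow> w \<in> carrier G \<Longrightarrow> F (s j \<otimes> w) j =
      - F w j + (\<Sum>i | i \<in> I \<and> adj i j. F w i) + (if par j = e then F w e else 0)"
    and "w \<in> carrier G" "i \<in> J"
  shows "of_int (at_one (X w i)) = of_int (sgn_w w) * (- 1) ^ dep i * F w i"
  using assms(4,5)
proof (induction arbitrary: i rule: word_induct)
  case one
  then show ?case using dep_e by (simp add: X_one F_one)
next
  case (step j w)
  show ?case
  proof (cases "i = j")
    case False
    then show ?thesis
      using step by (simp add: at_one_X_s sgn_s F_other)
  next
    case True
    \<comment> \<open>Adjacent nodes have depths of opposite parity. The rescaling by these signs
      turns the coefficient 1 of a neighbour into the -1 required by the sign twist.\<close>
    have sg: "(- 1 :: 'c) ^ dep k = - ((- 1) ^ dep j)" if "k \<in> I" "adj k j" for k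
      using that step(1) dep_par[of k] dep_par[of j] by (auto simp: adj_iff)
    have se: "par j = e \<Longrightarrow> (- 1 :: 'c) ^ dep j = - 1" using dep_par[OF step(1)] dep_e by simp
    have "of_int (\<Sum>i | i \<in> I \<and> adj i j. at_one (X w i)) =
        (\<Sum>i | i \<in> I \<and> adj i j. of_int (sgn_w w) * (- ((- 1) ^ dep j)) * F w i)"
      using step.IH sg by (auto intro!: sum.cong)
    also have "\<dots> = - (of_int (sgn_w w) * (- 1) ^ dep j * (\<Sum>i | i \<in> I \<and> adj i j. F w i))"
      by (simp add: sum_distrib_left sum_negf)
    finally have 1: "of_int (\<Sum>i | i \<in> I \<and> adj i j. at_one (X w i)) = \<dots>" .
    have 2: "of_int (at_one (X w j)) = of_int (sgn_w w) * (- 1) ^ dep j * F w j"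
      using step.IH[of j] step(1) by simp
    have 3: "of_int (at_one (X w e)) = of_int (sgn_w w) * F w e"
      using step.IH[of e] dep_e by simp
    have "of_int (at_one (X (s j \<otimes> w) j)) =
        of_int (at_one (X w j)) + of_int (\<Sum>i | i \<in> I \<and> adj i j. at_one (X w i))
        + (if par j = e then of_int (at_one (X w e)) else 0 :: 'c)"
      using step(1,2) by (simp add: at_one_X_s at_one_L)
    also have "\<dots> = of_int (sgn_w (s j \<otimes> w)) * (- 1) ^ dep j * F (s j \<otimes> w) j"
      unfolding 1 2 3 F_self[OF step(1,2)] sgn_s[OF step(1,2)]
      using se by (auto simp: algebra_simps)
    finally show ?thesis using True by simp
  qed
qed

end

section \<open>Hecke algebras\<close>

lemma lookup_hscale: "Poly_Mapping.lookup (hscale c x) w = c * Poly_Mapping.lookup x w"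
  by (simp add: hscale_def Poly_Mapping.map.rep_eq when_def)

lemma hscale_single: "hscale c (Poly_Mapping.single w d) = Poly_Mapping.single w (c * d)"
  by (intro poly_mapping_eqI) (auto simp: lookup_hscale lookup_single when_def)

lemma hscale_add: "hscale c (x + y) = hscale c x + hscale c y"
  by (intro poly_mapping_eqI) (simp add: lookup_hscale lookup_add distrib_left)

lemma hscale_hscale: "hscale c (hscale d x) = hscale (c * d) x"
  by (intro poly_mapping_eqI) (simp add: lookup_hscale mult.assoc)

lemma hscale_1 [simp]: "hscale 1 x = x"
  by (intro poly_mapping_eqI) (simp add: lookup_hscale)

lemma keys_hscale: "Poly_Mapping.keys (hscale c x) \<subseteq> Poly_Mapping.keys x"
  by (auto simp: in_keys_iff lookup_hscale)

lemma single_eq_hscale_Hb: "Poly_Mapping.single w c = hscale c (Hb w)"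
  by (simp add: Hb_def hscale_single)

definition linear_ext :: "('a \<Rightarrow> 'n \<Rightarrow> laurent) \<Rightarrow> ('a \<Rightarrow>\<^sub>0 laurent) \<Rightarrow> 'n \<Rightarrow> laurent"
  where "linear_ext f x i = (\<Sum>w\<in>Poly_Mapping.keys x. Poly_Mapping.lookup x w * f w i)"

lemma linear_ext_superset:
  assumes "finite S" "Poly_Mapping.keys x \<subseteq> S"
  shows "linear_ext f x i = (\<Sum>w\<in>S. Poly_Mapping.lookup x w * f w i)"
  unfolding linear_ext_def
  by (rule sum.mono_neutral_left) (use assms in \<open>auto simp: in_keys_iff\<close>)

lemma linear_ext_add: "linear_ext f (x + y) i = linear_ext f x i + linear_ext f y i"
  using keys_add[of x y]
  by (simp add: linear_ext_superset[of "Poly_Mapping.keys x \<union> Poly_Mapping.keys y"] lookup_add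
      distrib_right sum.distrib)

lemma linear_ext_hscale: "linear_ext f (hscale c x) i = c * linear_ext f x i"
  using keys_hscale[of c x]
  by (simp add: linear_ext_superset[of "Poly_Mapping.keys x"] lookup_hscale sum_distrib_left mult.assoc)

lemma linear_ext_Hb [simp]: "linear_ext f (Hb w) i = f w i"
  by (simp add: linear_ext_def Hb_def)

lemma linear_ext_sum: "linear_ext f (sum g S) i = (\<Sum>a\<in>S. linear_ext f (g a) i)"
proof (induction S rule: infinite_finite_induct)
  case (insert a S)
  then show ?case by (simp add: linear_ext_add)
qed (simp_all add: linear_ext_def)

lemma keys_sum_subset:
  "(\<And>a. a \<in> S \<Longrightarrow> Poly_Mapping.keys (g a) \<subseteq> C) \<Longrightarrow> Poly_Mapping.keys (sum g S) \<subseteq> C"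
proof (induction S rule: infinite_finite_induct)
  case (insert a S)
  then show ?case using keys_add[of "g a" "sum g S"] by fastforce
qed auto

locale hecke_tree = tree_words G I s adj \<rho> root pos e par dep wn
  for G :: "('g, 'h) monoid_scheme" (structure) and I s adj
    and \<rho> :: "'g \<Rightarrow> 'v :: ab_group_add \<Rightarrow> 'v" and root pos e par dep wn +
  fixes A :: "('g \<Rightarrow>\<^sub>0 laurent) ring"
  assumes hecke: "is_hecke_algebra G (s ` I) A"
begin

sublocale A: ring A
  using hecke by (simp add: is_hecke_algebra_def)

lemma carrier_A: "carrier A = {x. Poly_Mapping.keys x \<subseteq> carrier G}"
  using hecke by (simp add: is_hecke_algebra_def)

lemma add_A: "x \<in> carrier A \<Longrightarrow> y \<in> carrier A \<Longrightarrow> x \<oplus>\<^bsub>A\<^esub> y = x + y"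
  using hecke by (simp add: is_hecke_algebra_def)

lemma hscale_mult_left:
  "x \<in> carrier A \<Longrightarrow> y \<in> carrier A \<Longrightarrow> hscale c x \<otimes>\<^bsub>A\<^esub> y = hscale c (x \<otimes>\<^bsub>A\<^esub> y)"
  using hecke unfolding is_hecke_algebra_def by blast

lemma hscale_mult_right:
  "x \<in> carrier A \<Longrightarrow> y \<in> carrier A \<Longrightarrow> x \<otimes>\<^bsub>A\<^esub> hscale c y = hscale c (x \<otimes>\<^bsub>A\<^esub> y)"
  using hecke unfolding is_hecke_algebra_def by blast

lemma Hb_mult:
  "w \<in> carrier G \<Longrightarrow> v \<in> carrier G \<Longrightarrow> len (w \<otimes> v) = len w + len v \<Longrightarrow>
    Hb w \<otimes>\<^bsub>A\<^esub> Hb v = Hb (w \<otimes> v)"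
  using hecke unfolding is_hecke_algebra_def by blast

lemma Hb_closed [simp]: "w \<in> carrier G \<Longrightarrow> Hb w \<in> carrier A"
  by (simp add: carrier_A Hb_def)

lemma hscale_closed [simp]: "x \<in> carrier A \<Longrightarrow> hscale c x \<in> carrier A"
  using keys_hscale[of c x] by (auto simp: carrier_A)

lemma add_closed [simp]: "x \<in> carrier A \<Longrightarrow> y \<in> carrier A \<Longrightarrow> x + y \<in> carrier A"
  using keys_add[of x y] by (auto simp: carrier_A)

lemma uminus_closed [simp]: "x \<in> carrier A \<Longrightarrow> - x \<in> carrier A"
  by (simp add: carrier_A)

lemma zero_A: "\<zero>\<^bsub>A\<^esub> = 0"
  using add_A[of "\<zero>\<^bsub>A\<^esub>" "\<zero>\<^bsub>A\<^esub>"] by simp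

lemma minus_A: assumes "x \<in> carrier A" "y \<in> carrier A" shows "x \<ominus>\<^bsub>A\<^esub> y = x - y"
proof -
  have "\<ominus>\<^bsub>A\<^esub> y = - y"
    by (rule A.minus_equality) (use assms in \<open>simp_all add: add_A zero_A\<close>)
  then show ?thesis using assms by (simp add: a_minus_def add_A)
qed

lemma mult_add_right:
  "x \<in> carrier A \<Longrightarrow> y \<in> carrier A \<Longrightarrow> z \<in> carrier A \<Longrightarrow>
    x \<otimes>\<^bsub>A\<^esub> (y + z) = x \<otimes>\<^bsub>A\<^esub> y + x \<otimes>\<^bsub>A\<^esub> z"
  using A.r_distr[of y z x] by (simp add: add_A)

lemma mult_add_left:
  "x \<in> carrier A \<Longrightarrow> y \<in> carrier A \<Longrightarrow> z \<in> carrier A \<Longrightarrow>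
    (y + z) \<otimes>\<^bsub>A\<^esub> x = y \<otimes>\<^bsub>A\<^esub> x + z \<otimes>\<^bsub>A\<^esub> x"
  using A.l_distr[of y z x] by (simp add: add_A)

lemma Hecke_induct [consumes 1, case_names Hb hscale add]:
  assumes "x \<in> carrier A" "\<And>w. w \<in> carrier G \<Longrightarrow> P (Hb w)"
    and "\<And>c x. x \<in> carrier A \<Longrightarrow> P x \<Longrightarrow> P (hscale c x)"
    and "\<And>x y. x \<in> carrier A \<Longrightarrow> y \<in> carrier A \<Longrightarrow> P x \<Longrightarrow> P y \<Longrightarrow> P (x + y)"
  shows "P x"
  using assms(1)
proof (induction x rule: update_induct)
  case const
  have "P (hscale 0 (Hb \<one>))" using assms(2,3) by simp
  moreover have "hscale 0 (Hb \<one>) = 0" by (intro poly_mapping_eqI) (simp add: lookup_hscale)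
  ultimately show ?case by simp
next
  case (update x w c)
  have eq: "Poly_Mapping.update w c x = x + hscale c (Hb w)"
    using update(1) unfolding single_eq_hscale_Hb[symmetric]
    by (intro poly_mapping_eqI) (auto simp: lookup_update lookup_add lookup_single in_keys_iff when_def)
  have "w \<in> Poly_Mapping.keys (Poly_Mapping.update w c x)"
    using update(2) by (simp add: in_keys_iff lookup_update)
  moreover have "Poly_Mapping.keys x \<subseteq> Poly_Mapping.keys (Poly_Mapping.update w c x)"
    using update(1) by (auto simp: in_keys_iff lookup_update)
  ultimately have "w \<in> carrier G" "x \<in> carrier A" using update.prems by (auto simp: carrier_A)
  then show ?case unfolding eq using update(3) assms(2-4) by simp
qed

lemma Hb_one: "Hb \<one> = \<one>\<^bsub>A\<^esub>"
proof -
  have "Hb \<one> \<otimes>\<^bsub>A\<^esub> x = x" if "x \<in> carrier A" for x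
    using that
    by (induction x rule: Hecke_induct) (auto simp: Hb_mult hscale_mult_right mult_add_right)
  from this[of "\<one>\<^bsub>A\<^esub>"] show ?thesis by simp
qed

lemma Hb_quadratic:
  assumes "i \<in> I"
  shows "Hb (s i) \<otimes>\<^bsub>A\<^esub> Hb (s i) = hscale (q_pow 1 - 1) (Hb (s i)) + hscale (q_pow 1) \<one>\<^bsub>A\<^esub>"
proof -
  let ?T = "Hb (s i)" and ?q = "q_pow 1"
  have T: "?T \<in> carrier A" using assms by simp
  have "(?T \<oplus>\<^bsub>A\<^esub> \<one>\<^bsub>A\<^esub>) \<otimes>\<^bsub>A\<^esub> (?T \<ominus>\<^bsub>A\<^esub> hscale ?q \<one>\<^bsub>A\<^esub>) = \<zero>\<^bsub>A\<^esub>"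
    using hecke assms unfolding is_hecke_algebra_def by blast
  moreover have "?T \<ominus>\<^bsub>A\<^esub> hscale ?q \<one>\<^bsub>A\<^esub> = ?T + hscale (- ?q) \<one>\<^bsub>A\<^esub>"
  proof -
    have "hscale (- ?q) \<one>\<^bsub>A\<^esub> = - hscale ?q \<one>\<^bsub>A\<^esub>"
      by (intro poly_mapping_eqI) (simp add: lookup_hscale)
    then show ?thesis using T by (simp add: minus_A)
  qed
  ultimately have "(?T + \<one>\<^bsub>A\<^esub>) \<otimes>\<^bsub>A\<^esub> (?T + hscale (- ?q) \<one>\<^bsub>A\<^esub>) = 0"
    using T by (simp add: zero_A add_A)
  then have "?T \<otimes>\<^bsub>A\<^esub> ?T + ?T + (hscale (- ?q) ?T + hscale (- ?q) \<one>\<^bsub>A\<^esub>) = 0"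
    using T by (simp add: mult_add_left mult_add_right hscale_mult_right hscale_add add.assoc add.left_commute)
  then have *: "?T \<otimes>\<^bsub>A\<^esub> ?T = - ?T - (hscale (- ?q) ?T + hscale (- ?q) \<one>\<^bsub>A\<^esub>)"
    by (simp add: eq_neg_iff_add_eq_0 algebra_simps)
  show ?thesis unfolding *
    by (intro poly_mapping_eqI) (simp add: lookup_hscale lookup_add lookup_minus algebra_simps)
qed

section \<open>The map from the Hecke algebra to the tree module\<close>

abbreviation hmap :: "('g \<Rightarrow>\<^sub>0 laurent) \<Rightarrow> nat \<Rightarrow> laurent"
  where "hmap \<equiv> linear_ext X"

lemma Hb_s_mult:
  "i \<in> I \<Longrightarrow> w \<in> carrier G \<Longrightarrow> \<not> desc i w \<Longrightarrow> Hb (s i) \<otimes>\<^bsub>A\<^esub> Hb w = Hb (s i \<otimes> w)"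
  by (rule Hb_mult) (simp_all add: not_desc_len len_s s_neq_one)

lemma \<tau>_quadratic: "i \<in> I \<Longrightarrow> \<tau> i (\<tau> i x) k = (q_pow 1 - 1) * \<tau> i x k + q_pow 1 * x k"
  by (simp add: \<tau>_apply L_\<tau>_self algebra_simps)

lemma \<tau>_add: "\<tau> i (\<lambda>k. x k + y k) k = \<tau> i x k + \<tau> i y k"
  by (simp add: \<tau>_apply L_def distrib_left sum.distrib)

lemma \<tau>_scale: "\<tau> i (\<lambda>k. c * x k) k = c * \<tau> i x k"
  by (simp add: \<tau>_apply L_def right_diff_distrib sum_distrib_left mult.left_commute)

text \<open>This makes \<open>hmap\<close> a homomorphism of left modules. On \<open>Hb w\<close> it
  is the recursion for \<open>X\<close> if i is not a descent; otherwise one factor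
  \<open>Hb (s i)\<close> is split off and the quadratic relation is matched with that of
  \<open>\<tau> i\<close>.\<close>

lemma hmap_Hb_mult:
  assumes "i \<in> I" "x \<in> carrier A" shows "hmap (Hb (s i) \<otimes>\<^bsub>A\<^esub> x) = \<tau> i (hmap x)"
  using assms(2)
proof (induction x rule: Hecke_induct)
  case (Hb w)
  have eq: "hmap (Hb w) = X w" for w by (intro ext) simp
  show ?case
  proof (cases "desc i w")
    case False
    then show ?thesis using assms Hb by (simp add: Hb_s_mult X_s eq)
  next
    case True
    define u where "u = s i \<otimes> w"
    have u: "u \<in> carrier G" "w = s i \<otimes> u" "\<not> desc i u" using assms Hb True desc_s_iff by (auto simp: u_def)
    have "Hb (s i) \<otimes>\<^bsub>A\<^esub> Hb w = (Hb (s i) \<otimes>\<^bsub>A\<^esub> Hb (s i)) \<otimes>\<^bsub>A\<^esub> Hb u"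
      using Hb_s_mult[OF assms(1) u(1,3)] u assms by (simp add: A.m_assoc)
    also have "\<dots> = hscale (q_pow 1 - 1) (Hb w) + hscale (q_pow 1) (Hb u)"
      using u assms by (simp add: Hb_quadratic mult_add_left hscale_mult_left Hb_s_mult)
    finally have "hmap (Hb (s i) \<otimes>\<^bsub>A\<^esub> Hb w) k = \<tau> i (X w) k" for k
      using u assms by (simp add: linear_ext_add linear_ext_hscale X_s \<tau>_quadratic)
    then show ?thesis by (auto simp: eq)
  qed
next
  case (hscale c x)
  have "\<tau> i (hmap (hscale c x)) k = c * \<tau> i (hmap x) k" for k
    using \<tau>_scale[of i c "hmap x" k] by (simp add: linear_ext_hscale[abs_def])
  moreover have "hmap (Hb (s i) \<otimes>\<^bsub>A\<^esub> hscale c x) k = c * \<tau> i (hmap x) k" for k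
    using hscale assms by (simp add: hscale_mult_right linear_ext_hscale)
  ultimately show ?case by (simp add: fun_eq_iff)
next
  case (add x y)
  have "\<tau> i (hmap (x + y)) k = \<tau> i (hmap x) k + \<tau> i (hmap y) k" for k
    using \<tau>_add[of i "hmap x" "hmap y" k] by (simp add: linear_ext_add[abs_def])
  moreover have "hmap (Hb (s i) \<otimes>\<^bsub>A\<^esub> (x + y)) k = \<tau> i (hmap x) k + \<tau> i (hmap y) k" for k
    using add assms by (simp add: mult_add_right linear_ext_add)
  ultimately show ?case by (simp add: fun_eq_iff)
qed

section \<open>Inverses of basis elements and the bar involution\<close>

definition s_inv :: "nat \<Rightarrow> 'g \<Rightarrow>\<^sub>0 laurent"
  where "s_inv i = hscale (q_pow (- 1)) (Hb (s i) + hscale (1 - q_pow 1) \<one>\<^bsub>A\<^esub>)"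

lemma s_inv_closed [simp]: "i \<in> I \<Longrightarrow> s_inv i \<in> carrier A"
  by (simp add: s_inv_def)

lemma s_inv_cancel:
  assumes "i \<in> I"
  shows "Hb (s i) \<otimes>\<^bsub>A\<^esub> s_inv i = \<one>\<^bsub>A\<^esub>" "s_inv i \<otimes>\<^bsub>A\<^esub> Hb (s i) = \<one>\<^bsub>A\<^esub>"
proof -
  let ?T = "Hb (s i)"
  have *: "hscale (q_pow (- 1)) (hscale (q_pow 1 - 1) ?T + hscale (q_pow 1) \<one>\<^bsub>A\<^esub>
      + hscale (1 - q_pow 1) ?T) = \<one>\<^bsub>A\<^esub>"
  proof -
    have "hscale (q_pow 1 - 1) ?T + hscale (q_pow 1) \<one>\<^bsub>A\<^esub> + hscale (1 - q_pow 1) ?T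
        = hscale (q_pow 1) \<one>\<^bsub>A\<^esub>"
      by (intro poly_mapping_eqI) (simp add: lookup_hscale lookup_add algebra_simps)
    then show ?thesis by (simp only: hscale_hscale q_pow_cancel(1) hscale_1)
  qed
  show "?T \<otimes>\<^bsub>A\<^esub> s_inv i = \<one>\<^bsub>A\<^esub>" "s_inv i \<otimes>\<^bsub>A\<^esub> ?T = \<one>\<^bsub>A\<^esub>"
    using assms * by (simp_all add: s_inv_def hscale_mult_right hscale_mult_left mult_add_right
        mult_add_left Hb_quadratic)
qed

text \<open>The inverse and its image are built together, because \<open>hecke_bar\<close> is
  defined through inverses. Passing from w to \<open>s i \<otimes> w\<close> puts the factor
  \<open>Hb (s i)\<close> on the right of \<open>Hb (inv w)\<close>, so its inverse acts from the
  left, where \<open>hmap\<close> is understood. Semilinearity then handles all elements, without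
  multiplicativity of the bar involution.\<close>

lemma inverse_Hb_inv:
  assumes "w \<in> carrier G"
  shows "\<exists>y\<in>carrier A. y \<otimes>\<^bsub>A\<^esub> Hb (inv w) = \<one>\<^bsub>A\<^esub> \<and> Hb (inv w) \<otimes>\<^bsub>A\<^esub> y = \<one>\<^bsub>A\<^esub> \<and> hmap y = bar_M (X w)"
  using assms
proof (induction w rule: len_induct)
  case one
  have "hmap (Hb \<one>) = bar_M (X \<one>)"
    by (intro ext) (simp add: bar_M_def X_one dep_e)
  then show ?case by (intro bexI[of _ "Hb \<one>"]) (simp_all add: Hb_one)
next
  case (step i w)
  then obtain y where y: "y \<in> carrier A" "y \<otimes>\<^bsub>A\<^esub> Hb (inv w) = \<one>\<^bsub>A\<^esub>" "Hb (inv w) \<otimes>\<^bsub>A\<^esub> y = \<one>\<^bsub>A\<^esub>"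
    "hmap y = bar_M (X w)" by blast
  let ?T = "Hb (s i)" and ?W = "Hb (inv w)"
  have nd: "\<not> desc i w" using step by (simp add: desc_def)
  have iw: "inv (s i \<otimes> w) = inv w \<otimes> s i" using step by (simp add: inv_mult_group)
  have "len (inv w \<otimes> s i) = len (inv w) + len (s i)"
    using step len_inv[of "s i \<otimes> w"] by (simp add: iw len_inv len_s s_neq_one)
  then have W: "Hb (inv (s i \<otimes> w)) = ?W \<otimes>\<^bsub>A\<^esub> ?T"
    unfolding iw using step by (simp add: Hb_mult)
  have c: "?T \<in> carrier A" "?W \<in> carrier A" "s_inv i \<in> carrier A" using step by auto
  have "(s_inv i \<otimes>\<^bsub>A\<^esub> y) \<otimes>\<^bsub>A\<^esub> (?W \<otimes>\<^bsub>A\<^esub> ?T) = s_inv i \<otimes>\<^bsub>A\<^esub> ((y \<otimes>\<^bsub>A\<^esub> ?W) \<otimes>\<^bsub>A\<^esub> ?T)"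
    using c y(1) by (simp add: A.m_assoc)
  also have "\<dots> = \<one>\<^bsub>A\<^esub>" using c y step by (simp add: s_inv_cancel)
  finally have 1: "(s_inv i \<otimes>\<^bsub>A\<^esub> y) \<otimes>\<^bsub>A\<^esub> (?W \<otimes>\<^bsub>A\<^esub> ?T) = \<one>\<^bsub>A\<^esub>" .
  have "(?W \<otimes>\<^bsub>A\<^esub> ?T) \<otimes>\<^bsub>A\<^esub> (s_inv i \<otimes>\<^bsub>A\<^esub> y) = ?W \<otimes>\<^bsub>A\<^esub> ((?T \<otimes>\<^bsub>A\<^esub> s_inv i) \<otimes>\<^bsub>A\<^esub> y)"
    using c y(1) by (simp add: A.m_assoc)
  also have "\<dots> = \<one>\<^bsub>A\<^esub>" using c y step by (simp add: s_inv_cancel)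
  finally have 2: "(?W \<otimes>\<^bsub>A\<^esub> ?T) \<otimes>\<^bsub>A\<^esub> (s_inv i \<otimes>\<^bsub>A\<^esub> y) = \<one>\<^bsub>A\<^esub>" .
  have "s_inv i \<otimes>\<^bsub>A\<^esub> y = hscale (q_pow (- 1)) (?T \<otimes>\<^bsub>A\<^esub> y + hscale (1 - q_pow 1) y)"
    using c y by (simp add: s_inv_def hscale_mult_left mult_add_left)
  then have "hmap (s_inv i \<otimes>\<^bsub>A\<^esub> y) k = bar_M (\<tau> i (X w)) k" for k
    using step y by (simp add: linear_ext_hscale linear_ext_add hmap_Hb_mult bar_M_\<tau>)
  then have 3: "hmap (s_inv i \<otimes>\<^bsub>A\<^esub> y) = bar_M (X (s i \<otimes> w))"
    using step nd by (auto simp: X_s)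
  show ?case unfolding W using 1 2 3 c y by (intro bexI[of _ "s_inv i \<otimes>\<^bsub>A\<^esub> y"]) auto
qed

lemma hmap_inv_Hb_inv: assumes "w \<in> carrier G" shows "hmap (inv\<^bsub>A\<^esub> (Hb (inv w))) = bar_M (X w)"
proof -
  obtain y where y: "y \<in> carrier A" "y \<otimes>\<^bsub>A\<^esub> Hb (inv w) = \<one>\<^bsub>A\<^esub>" "Hb (inv w) \<otimes>\<^bsub>A\<^esub> y = \<one>\<^bsub>A\<^esub>"
    "hmap y = bar_M (X w)" using inverse_Hb_inv[OF assms] by blast
  then have "inv\<^bsub>A\<^esub> (Hb (inv w)) = y" using assms by (intro A.inv_char) auto
  then show ?thesis using y by simp
qed

lemma hmap_bar: assumes "x \<in> carrier A" shows "hmap (hecke_bar G A x) i = bar_M (hmap x) i"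
proof -
  have "hmap (hecke_bar G A x) i =
      (\<Sum>w\<in>Poly_Mapping.keys x. laurent_bar (Poly_Mapping.lookup x w) * bar_M (X w) i)"
    unfolding hecke_bar_def linear_ext_sum linear_ext_hscale
    by (intro sum.cong refl) (use assms in \<open>auto simp: hmap_inv_Hb_inv carrier_A\<close>)
  also have "\<dots> = bar_M (hmap x) i"
    by (simp add: bar_M_def linear_ext_def laurent_bar_sum laurent_bar_mult sum_distrib_left mult.left_commute)
  finally show ?thesis .
qed

section \<open>Images of the Kazhdan-Lusztig elements\<close>

lemma KL_elt_closed: "KL_elt G (s ` I) P v \<in> carrier A"
  unfolding carrier_A KL_elt_def
  using keys_hscale by (fastforce simp: Hb_def bruhat_le_carrier intro!: keys_sum_subset)

text \<open>Put n = \<open>len v - dep i\<close>. Invariance under the bar involution makes the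
  coordinate symmetric about n/2. Every term with \<open>w \<noteq> v\<close> lies strictly below
  n/2, by the degree bound for \<open>P w v\<close> and the weak bound for \<open>X w i\<close>. The
  term \<open>X v i\<close> does so as well, except for the leading 1 when \<open>v = wn i\<close>;
  there n = 0, and 1 is itself symmetric and can be subtracted.\<close>

lemma hmap_KL_elt:
  assumes P: "is_KL_polynomials G (s ` I) A P" and v: "v \<in> carrier G" and i: "i \<in> J"
  shows "hmap (KL_elt G (s ` I) P v) i = (if v = wn i then 1 else 0)"
proof -
  let ?y = "hmap (KL_elt G (s ` I) P v) i" and ?n = "int (len v) - int (dep i)"
  have Pv: "P v v = 1" "\<And>w. bruhat_le G (s ` I) w v \<Longrightarrow> w \<noteq> v \<Longrightarrow>
      2 * degree (P w v) + len w + 1 \<le> len v"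
    "hecke_bar G A (KL_elt G (s ` I) P v) = hscale (q_pow (- int (len v))) (KL_elt G (s ` I) P v)"
    using P v unfolding is_KL_polynomials_def by blast+
  have "q_pow (- int (dep i)) * laurent_bar ?y = q_pow (- int (len v)) * ?y"
    using hmap_bar[OF KL_elt_closed, of P v i] by (simp add: Pv(3) linear_ext_hscale bar_M_def)
  then have "q_pow (int (dep i)) * (q_pow (- int (dep i)) * laurent_bar ?y) =
      q_pow (int (dep i)) * (q_pow (- int (len v)) * ?y)" by simp
  then have "laurent_bar ?y = q_pow (int (dep i)) * (q_pow (- int (len v)) * ?y)" by simp
  then have bar: "laurent_bar ?y = q_pow (- ?n) * ?y" by (simp flip: q_pow_add mult.assoc)
  have "?y = (\<Sum>w | bruhat_le G (s ` I) w v. poly_at_q (P w v) * X w i)"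
    by (simp add: KL_elt_def linear_ext_sum linear_ext_hscale)
  also have "\<dots> = poly_at_q (P v v) * X v i +
      (\<Sum>w \<in> {w. bruhat_le G (s ` I) w v} - {v}. poly_at_q (P w v) * X w i)"
    by (rule sum.remove) (use v bruhat_le_refl finite_bruhat_down in auto)
  finally have y: "?y = X v i +
      (\<Sum>w \<in> {w. bruhat_le G (s ` I) w v} - {v}. poly_at_q (P w v) * X w i)"
    by (simp add: Pv(1))
  have rest: "(\<Sum>w \<in> {w. bruhat_le G (s ` I) w v} - {v}. poly_at_q (P w v) * X w i) \<in> deg_le (?n - 1)"
  proof (rule deg_le_sum)
    fix w assume w: "w \<in> {w. bruhat_le G (s ` I) w v} - {v}"
    then have "poly_at_q (P w v) \<in> deg_le (int (len v) - int (len w) - 1)"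
      using Pv(2)[of w] by (intro deg_le_poly_at_q) auto
    moreover have "X w i \<in> deg_le (int (len w) - int (dep i))"
      using X_bound_weak X_bound_all w i bruhat_le_carrier by blast
    ultimately show "poly_at_q (P w v) * X w i \<in> deg_le (?n - 1)"
      by (rule deg_le_mult) simp
  qed
  have Xv: "X_bound v i" using X_bound_all v i by blast
  show ?thesis
  proof (cases "v = wn i")
    case False
    then have "X v i \<in> deg_le (?n - 1)" using Xv by (simp add: X_bound_def)
    then have "?y \<in> deg_le (?n - 1)" unfolding y using rest by (rule deg_le_add)
    then show ?thesis using symmetric_deg_le_zero[OF bar] False by simp
  next
    case True
    then have n: "?n = 0" using len_wn i by simp
    have "X v i - 1 \<in> deg_le (?n - 1)" using Xv True n by (simp add: X_bound_def)
    from deg_le_add[OF this rest] have "?y - 1 \<in> deg_le (?n - 1)"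
      unfolding y by (simp only: diff_add_eq)
    moreover have "laurent_bar (?y - 1) = q_pow (- ?n) * (?y - 1)"
      using bar n by (simp add: laurent_bar_diff)
    ultimately have "?y - 1 = 0" using symmetric_deg_le_zero by blast
    then show ?thesis using True by simp
  qed
qed

lemma X_eq_inverse_KL:
  assumes P: "is_KL_polynomials G (s ` I) A P"
    and m: "is_inverse_KL_polynomials G (s ` I) P m"
    and w: "w \<in> carrier G" and i: "i \<in> J"
  shows "X w i = of_int (sgn_w (w \<otimes> inv (wn i))) * poly_at_q (m w (wn i))"
proof -
  let ?c = "\<lambda>v. of_int (sgn_w (w \<otimes> inv v)) * poly_at_q (m w v)"
  have Hw: "Hb w = (\<Sum>v | bruhat_le G (s ` I) v w. hscale (?c v) (KL_elt G (s ` I) P v))"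
    and m0: "\<And>v. v \<in> carrier G \<Longrightarrow> \<not> bruhat_le G (s ` I) v w \<Longrightarrow> m w v = 0"
    using m w unfolding is_inverse_KL_polynomials_def by blast+
  have "X w i = hmap (Hb w) i" by simp
  also have "\<dots> = (\<Sum>v | bruhat_le G (s ` I) v w. ?c v * hmap (KL_elt G (s ` I) P v) i)"
    by (subst Hw) (simp add: linear_ext_sum linear_ext_hscale)
  also have "\<dots> = (\<Sum>v | bruhat_le G (s ` I) v w. if v = wn i then ?c v else 0)"
    by (intro sum.cong refl) (use hmap_KL_elt[OF P _ i] bruhat_le_carrier in auto)
  \<comment> \<open>If \<open>wn i\<close> is not below w, its term is missing from the sum, in
    accordance with the convention that \<open>m\<close> is 0 there.\<close>
  also have "\<dots> = ?c (wn i)"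
    using finite_bruhat_down m0[of "wn i"] i by (simp add: sum.delta)
  finally show ?thesis .
qed

text \<open>The sign in the definition of the inverse polynomials and the sign twist of the module
  are both \<open>sgn_w w * (- 1) ^ dep i\<close>, so they cancel and leave the untwisted
  coordinates \<open>F\<close>.\<close>

theorem inverse_KL_at_one:
  fixes F :: "'g \<Rightarrow> nat \<Rightarrow> 'c :: comm_ring_1"
  assumes P: "is_KL_polynomials G (s ` I) A P"
    and m: "is_inverse_KL_polynomials G (s ` I) P m"
    and F: "\<And>i. i \<in> J \<Longrightarrow> F \<one> i = (if i = e then 1 else 0)"
      "\<And>i j w. i \<in> J \<Longrightarrow> j \<in> I \<Longrightarrow> w \<in> carrier G \<Longrightarrow> i \<noteq> j \<Longrightarrow> F (s j \<otimes> w) i = F w i"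
      "\<And>j w. j \<in> I \<Longrightarrow> w \<in> carrier G \<Longrightarrow> F (s j \<otimes> w) j =
        - F w j + (\<Sum>i | i \<in> I \<and> adj i j. F w i) + (if par j = e then F w e else 0)"
    and w: "w \<in> carrier G" and i: "i \<in> J"
  shows "of_int (poly (m w (wn i)) 1) = F w i"
proof -
  have wi: "wn i \<in> carrier G" using i by simp
  have sw: "sgn_w w * sgn_w w = 1" for w by (simp add: cox_sign_def flip: power_add)
  have "at_one (X w i) = sgn_w w * (- 1) ^ dep i * poly (m w (wn i)) 1"
    using X_eq_inverse_KL[OF P m w i] w wi
    by (simp add: sgn_mult sgn_inv cox_sign_def[of _ _ "wn i"] len_wn[OF i])
  then have "poly (m w (wn i)) 1 = sgn_w w * (- 1) ^ dep i * at_one (X w i)"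
    using sw[of w] by (simp add: mult.assoc mult.left_commute flip: power_add)
  then have "of_int (poly (m w (wn i)) 1) = of_int (sgn_w w) * (- 1) ^ dep i *
      (of_int (sgn_w w) * (- 1) ^ dep i * F w i)"
    using at_one_X_eq[of F, OF F w i] by simp
  also have "\<dots> = of_int (sgn_w w * sgn_w w) * ((- 1) ^ dep i * (- 1) ^ dep i) * F w i"
    by (simp add: algebra_simps)
  also have "\<dots> = F w i" by (simp add: sw flip: power_add)
  finally show ?thesis .
qed

end

section \<open>Root data and affine reflections\<close>

lemma cartan_sym: "cartan T i j = cartan T j i"
  by (auto simp: cartan_def)

lemma form_sym: "form T x y = form T y x"
  unfolding form_def by (subst sum.swap) (simp add: cartan_sym mult.commute mult.left_commute)

lemma form_diff_scale:
  "form T (\<lambda>k. x k - c * b k) y = form T x y - c * form T b y"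
  by (simp add: form_def sum_subtractf sum_distrib_left algebra_simps)

lemma form_diff_scale_right:
  "form T y (\<lambda>k. x k - c * b k) = form T y x - c * form T y b"
  by (simp add: form_sym[of T y] form_diff_scale)

lemma form_uminus: "form T (- x) y = - form T x y" "form T y (- x) = - form T y x"
  by (simp_all add: form_def sum_negf)

lemma form_add: "form T (x + z) y = form T x y + form T z y" "form T y (x + z) = form T y x + form T y z"
  by (simp_all add: form_def sum.distrib algebra_simps)

lemma form_zero [simp]: "form T 0 y = 0" "form T y 0 = 0"
  by (simp_all add: form_def)

lemma form_scale: "form T (\<lambda>k. c * x k) y = c * form T x y" "form T y (\<lambda>k. c * x k) = c * form T y x"
  by (simp_all add: form_def sum_distrib_left algebra_simps)

lemma form_simple_right:
  assumes "i \<in> {1..dynkin_rank T}"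
  shows "form T x (simple_coroot i) = (\<Sum>j = 1..dynkin_rank T. x j * cartan T j i)"
proof -
  have "(\<Sum>k = 1..dynkin_rank T. x j * cartan T j k * simple_coroot i k) = x j * cartan T j i" for j
  proof -
    have "(\<Sum>k = 1..dynkin_rank T. x j * cartan T j k * simple_coroot i k) =
        (\<Sum>k = 1..dynkin_rank T. if k = i then x j * cartan T j k else 0)"
      by (intro sum.cong refl) (simp add: simple_coroot_def)
    then show ?thesis using assms by simp
  qed
  then show ?thesis by (simp add: form_def)
qed

lemma form_simple_simple:
  assumes "i \<in> {1..dynkin_rank T}" "j \<in> {1..dynkin_rank T}"
  shows "form T (simple_coroot i) (simple_coroot j) = cartan T i j"
proof -
  have "form T (simple_coroot i) (simple_coroot j) =
      (\<Sum>k = 1..dynkin_rank T. if k = i then cartan T k j else 0)"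
    unfolding form_simple_right[OF assms(2)]
    by (intro sum.cong refl) (simp add: simple_coroot_def)
  then show ?thesis using assms by simp
qed

lemma form_expand:
  "form T x y = (\<Sum>i = 1..dynkin_rank T. x i * form T (simple_coroot i) y)"
proof -
  have "form T (simple_coroot i) y = (\<Sum>j = 1..dynkin_rank T. cartan T i j * y j)"
    if "i \<in> {1..dynkin_rank T}" for i
    using form_simple_right[OF that, of y] by (simp add: form_sym[of T _ y] cartan_sym mult.commute)
  then show ?thesis
    by (simp add: form_def sum_distrib_left mult.assoc)
qed

lemma reflection_apply: "reflection T b x k = x k - form T x b * b k"
  by (simp add: reflection_def)

lemma reflection_linear:
  "reflection T b (\<lambda>k. x k - c * y k) = (\<lambda>k. reflection T b x k - c * reflection T b y k)"
  by (simp add: reflection_def form_diff_scale algebra_simps)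

lemma reflection_add: "reflection T b (x + y) = reflection T b x + reflection T b y"
  by (simp add: reflection_def form_add algebra_simps fun_eq_iff)

lemma reflection_uminus_root: "reflection T (- b) = reflection T b"
  by (simp add: reflection_def form_uminus fun_eq_iff)

lemma form_reflection_left:
  "form T (reflection T c x) y = form T x y - form T x c * form T c y"
  by (simp only: reflection_def form_diff_scale)

lemma form_reflection:
  assumes "form T b b = 2"
  shows "form T (reflection T b x) (reflection T b y) = form T x y"
  using assms form_sym[of T b y] form_sym[of T b x]
  by (simp add: form_reflection_left form_sym[of T _ "reflection T b y"] form_sym[of T y x] algebra_simps)

lemma form_reflection_root:
  assumes "form T b b = 2" shows "form T (reflection T b x) b = - form T x b"
  using assms by (simp add: form_reflection_left)

lemma reflection_invol:
  assumes "form T b b = 2" shows "reflection T b (reflection T b x) = x"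
proof
  fix k
  show "reflection T b (reflection T b x) k = x k"
    by (simp add: reflection_apply[of T b "reflection T b x"] form_reflection_root[OF assms] reflection_apply[of T b x])
qed

lemma form_simple_self [simp]:
  "i \<in> {1..dynkin_rank T} \<Longrightarrow> form T (simple_coroot i) (simple_coroot i) = 2"
  by (simp add: form_simple_simple cartan_def)

section \<open>The finite Weyl group and its coroots\<close>

lemma weyl_simple:
  "i \<in> {1..dynkin_rank T} \<Longrightarrow> reflection T (simple_coroot i) \<in> weyl_group T"
  using weyl_step[OF weyl_id] by simp

lemma weyl_comp: "u \<in> weyl_group T \<Longrightarrow> v \<in> weyl_group T \<Longrightarrow> u \<circ> v \<in> weyl_group T"
  by (induction u rule: weyl_group.induct) (auto simp: comp_assoc intro: weyl_step)

lemma weyl_linear: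
  "w \<in> weyl_group T \<Longrightarrow> w (\<lambda>k. x k - c * y k) = (\<lambda>k. w x k - c * w y k)"
  by (induction w rule: weyl_group.induct) (auto simp: reflection_linear)

lemma weyl_add: "w \<in> weyl_group T \<Longrightarrow> w (x + y) = w x + w y"
  by (induction w rule: weyl_group.induct) (simp_all only: comp_apply reflection_add id_apply)

lemma weyl_zero: "w \<in> weyl_group T \<Longrightarrow> w 0 = 0"
  using weyl_add[of w T 0 0] by simp

lemma weyl_form: "w \<in> weyl_group T \<Longrightarrow> form T (w x) (w y) = form T x y"
  by (induction w rule: weyl_group.induct) (auto simp: form_reflection)

lemma weyl_inverse:
  assumes "w \<in> weyl_group T"
  obtains v where "v \<in> weyl_group T" "v \<circ> w = id" "w \<circ> v = id"
proof -
  have "\<exists>v\<in>weyl_group T. v \<circ> w = id \<and> w \<circ> v = id"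
    using assms
  proof (induction w rule: weyl_group.induct)
    case weyl_id
    then show ?case by (intro bexI[of _ id] weyl_group.weyl_id) simp
  next
    case (weyl_step w i)
    then obtain v where v: "v \<in> weyl_group T" "v \<circ> w = id" "w \<circ> v = id" by blast
    let ?s = "reflection T (simple_coroot i)"
    have s: "?s (?s x) = x" for x using reflection_invol weyl_step by simp
    have "v \<circ> ?s \<in> weyl_group T" using weyl_comp v(1) weyl_simple weyl_step by blast
    moreover have "(v \<circ> ?s) \<circ> (?s \<circ> w) = id" "(?s \<circ> w) \<circ> (v \<circ> ?s) = id"
      using s pointfree_idE[OF v(2)] pointfree_idE[OF v(3)] by (simp_all only: comp_def id_def)
    ultimately show ?case by blast
  qed
  then show ?thesis using that by blast
qed

lemma weyl_lattice:
  "w \<in> weyl_group T \<Longrightarrow> x \<in> coroot_lattice T \<Longrightarrow> w x \<in> coroot_lattice T"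
proof (induction w rule: weyl_group.induct)
  case (weyl_step w i)
  then show ?case
    by (auto simp: coroot_lattice_def reflection_apply simple_coroot_def)
qed simp

lemma simple_in_lattice: "i \<in> {1..dynkin_rank T} \<Longrightarrow> simple_coroot i \<in> coroot_lattice T"
  by (auto simp: coroot_lattice_def simple_coroot_def)

lemma lattice_add: "x \<in> coroot_lattice T \<Longrightarrow> y \<in> coroot_lattice T \<Longrightarrow> x + y \<in> coroot_lattice T"
  by (simp add: coroot_lattice_def)

lemma lattice_uminus: "x \<in> coroot_lattice T \<Longrightarrow> - x \<in> coroot_lattice T"
  by (simp add: coroot_lattice_def)

lemma reflection_conj:
  assumes "w \<in> weyl_group T" shows "reflection T (w b) (w x) = w (reflection T b x)"
  using weyl_linear[OF assms, of x "form T x b" b] weyl_form[OF assms, of x b]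
  by (simp add: reflection_def)

lemma coroot_norm: assumes "b \<in> coroots T" shows "form T b b = 2"
  using assms by (auto simp: coroots_def weyl_form)

lemma coroot_reflection: assumes "b \<in> coroots T" shows "reflection T b \<in> weyl_group T"
proof -
  obtain w i where w: "w \<in> weyl_group T" "i \<in> {1..dynkin_rank T}" "b = w (simple_coroot i)"
    using assms by (auto simp: coroots_def)
  obtain v where v: "v \<in> weyl_group T" "v \<circ> w = id" "w \<circ> v = id" using weyl_inverse[OF w(1)] by blast
  have "reflection T b x = w (reflection T (simple_coroot i) (v x))" for x
    using reflection_conj[OF w(1), of "simple_coroot i" "v x"] by (simp only: w(3) pointfree_idE[OF v(3)])
  then have "reflection T b = w \<circ> (reflection T (simple_coroot i) \<circ> v)" by (simp add: fun_eq_iff)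
  then show ?thesis using weyl_comp weyl_simple w v by metis
qed

lemma weyl_coroot: "w \<in> weyl_group T \<Longrightarrow> b \<in> coroots T \<Longrightarrow> w b \<in> coroots T"
  unfolding coroots_def using weyl_comp comp_apply by (smt (verit) mem_Collect_eq)

lemma simple_coroot_coroots: "i \<in> {1..dynkin_rank T} \<Longrightarrow> simple_coroot i \<in> coroots T"
  unfolding coroots_def by (rule CollectI, rule exI[of _ id], rule exI[of _ i]) (simp add: weyl_id)

lemma coroot_in_lattice: "b \<in> coroots T \<Longrightarrow> b \<in> coroot_lattice T"
  by (auto simp: coroots_def weyl_lattice simple_in_lattice)

lemma coroot_add_simple:
  assumes "b \<in> coroots T" "i \<in> {1..dynkin_rank T}" "form T b (simple_coroot i) = - 1"
  shows "b + simple_coroot i \<in> coroots T"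
proof -
  have "reflection T (simple_coroot i) b = b + simple_coroot i"
    using assms(3) by (simp add: reflection_apply fun_eq_iff)
  then show ?thesis using weyl_coroot[OF weyl_simple] assms by metis
qed

section \<open>Multiplication and reflections in the affine Weyl group\<close>

abbreviation aff_mult :: "dynkin_type \<Rightarrow> aff \<Rightarrow> aff \<Rightarrow> aff"
  where "aff_mult T \<equiv> monoid.mult (affine_weyl T)"

lemma aff_mult_simp [simp]: "aff_mult T (x, u) (y, v) = (x + u y, u \<circ> v)"
  by (simp add: affine_weyl_def)

lemma aff_one [simp]: "\<one>\<^bsub>affine_weyl T\<^esub> = (0, id)"
  by (simp add: affine_weyl_def)

lemma aff_carrier: "carrier (affine_weyl T) = coroot_lattice T \<times> weyl_group T"
  by (simp add: affine_weyl_def)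

lemma group_affine_weyl: "group (affine_weyl T)"
proof (rule groupI)
  fix g h assume "g \<in> carrier (affine_weyl T)" "h \<in> carrier (affine_weyl T)"
  then show "aff_mult T g h \<in> carrier (affine_weyl T)"
    by (cases g; cases h) (auto simp: aff_carrier lattice_add weyl_lattice weyl_comp)
next
  show "\<one>\<^bsub>affine_weyl T\<^esub> \<in> carrier (affine_weyl T)"
    by (simp add: aff_carrier weyl_id coroot_lattice_def)
next
  fix g h k assume "g \<in> carrier (affine_weyl T)" "h \<in> carrier (affine_weyl T)" "k \<in> carrier (affine_weyl T)"
  then show "aff_mult T (aff_mult T g h) k = aff_mult T g (aff_mult T h k)"
    by (cases g; cases h; cases k) (auto simp: aff_carrier weyl_add add.assoc comp_assoc)
next
  fix g assume "g \<in> carrier (affine_weyl T)"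
  then show "aff_mult T \<one>\<^bsub>affine_weyl T\<^esub> g = g" by (cases g) simp
next
  fix g assume "g \<in> carrier (affine_weyl T)"
  then obtain x w where g: "g = (x, w)" "x \<in> coroot_lattice T" "w \<in> weyl_group T"
    by (auto simp: aff_carrier)
  obtain v where v: "v \<in> weyl_group T" "v \<circ> w = id" "w \<circ> v = id" using weyl_inverse[OF g(3)] by blast
  have "(- v x, v) \<in> carrier (affine_weyl T)" "aff_mult T (- v x, v) g = \<one>\<^bsub>affine_weyl T\<^esub>"
    using v g by (simp_all add: aff_carrier weyl_lattice lattice_uminus)
  then show "\<exists>h\<in>carrier (affine_weyl T). aff_mult T h g = \<one>\<^bsub>affine_weyl T\<^esub>" by blast
qed

lemma group_finite_weyl: "group ((affine_weyl T)\<lparr>carrier := finite_weyl T\<rparr>)"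
proof (rule groupI)
  fix g assume "g \<in> carrier ((affine_weyl T)\<lparr>carrier := finite_weyl T\<rparr>)"
  then obtain w where g: "g = (0, w)" "w \<in> weyl_group T" by (auto simp: finite_weyl_def)
  obtain v where v: "v \<in> weyl_group T" "v \<circ> w = id" "w \<circ> v = id" using weyl_inverse[OF g(2)] by blast
  have "(0, v) \<in> finite_weyl T" "aff_mult T (0, v) g = \<one>\<^bsub>affine_weyl T\<^esub>"
    using v g weyl_zero[OF v(1)] by (simp_all add: finite_weyl_def)
  then show "\<exists>h\<in>carrier ((affine_weyl T)\<lparr>carrier := finite_weyl T\<rparr>).
      h \<otimes>\<^bsub>(affine_weyl T)\<lparr>carrier := finite_weyl T\<rparr>\<^esub> g = \<one>\<^bsub>(affine_weyl T)\<lparr>carrier := finite_weyl T\<rparr>\<^esub>"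
    by auto
qed (auto simp: finite_weyl_def weyl_zero weyl_comp weyl_id weyl_add comp_assoc simp flip: zero_fun_def)

text \<open>The affine reflection x |-> x - ((x, b) + k) b, which fixes the zeros of the affine
  linear function (b, k). The generator s_0 is the case b = -\<theta>, k = 1.\<close>

definition arefl :: "dynkin_type \<Rightarrow> coroot_vec \<Rightarrow> int \<Rightarrow> aff"
  where "arefl T b k = ((\<lambda>l. - k * b l), reflection T b)"

lemma arefl_mult:
  assumes "form T b b = 2"
  shows "aff_mult T (arefl T b k) (x, w) = ((\<lambda>l. x l - (form T x b + k) * b l), reflection T b \<circ> w)"
  by (auto simp: arefl_def reflection_apply fun_eq_iff algebra_simps)

lemma arefl_invol:
  assumes "form T b b = 2" shows "aff_mult T (arefl T b k) (arefl T b k) = (0, id)"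
  using assms form_scale(1)[of T "- k" b b]
  unfolding arefl_def[of T b k, THEN arg_cong, of "aff_mult T (arefl T b k)"] arefl_mult[OF assms]
  by (auto simp: fun_eq_iff reflection_invol algebra_simps)

lemma arefl_arefl:
  assumes "form T b b = 2"
  shows "aff_mult T (arefl T b k) (arefl T c l) =
    ((\<lambda>m. - l * c m - (k - l * form T c b) * b m), reflection T b \<circ> reflection T c)"
  unfolding arefl_def[of T c l] arefl_mult[OF assms] form_scale by (simp add: add.commute)

lemma arefl_commute:
  assumes "form T b b = 2" "form T c c = 2" "form T b c = 0"
  shows "aff_mult T (arefl T b k) (arefl T c l) = aff_mult T (arefl T c l) (arefl T b k)"
proof -
  have cb: "form T c b = 0" using assms form_sym[of T c b] by simp
  have "reflection T b (reflection T c x) = reflection T c (reflection T b x)" for x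
    by (rule ext) (simp add: reflection_apply form_reflection_left assms cb)
  then show ?thesis
    unfolding arefl_arefl[OF assms(1)] arefl_arefl[OF assms(2)]
    by (simp add: assms cb fun_eq_iff)
qed

lemma arefl_braid:
  assumes "form T b b = 2" "form T c c = 2" "form T b c = - 1"
  shows "aff_mult T (arefl T b k) (aff_mult T (arefl T c l) (arefl T b k)) =
    aff_mult T (arefl T c l) (aff_mult T (arefl T b k) (arefl T c l))"
proof -
  have cb: "form T c b = - 1" using assms form_sym[of T c b] by simp
  have "reflection T b (reflection T c (reflection T b x)) = reflection T c (reflection T b (reflection T c x))" for x
    by (rule ext) (simp add: reflection_apply form_reflection_left assms cb algebra_simps)
  then show ?thesis
    unfolding arefl_arefl[OF assms(1)] arefl_arefl[OF assms(2)] arefl_mult[OF assms(1)] arefl_mult[OF assms(2)]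
      form_diff_scale form_scale
    by (simp add: assms cb fun_eq_iff algebra_simps)
qed

text \<open>\<open>(y, k)\<close> stands for the affine linear function \<open>x \<mapsto> (x, y) + k\<close> on the coroot lattice.\<close>

definition aff_act :: "dynkin_type \<Rightarrow> aff \<Rightarrow> coroot_vec \<times> int \<Rightarrow> coroot_vec \<times> int"
  where "aff_act T g = (\<lambda>(y, k). (snd g y, k - form T (fst g) (snd g y)))"

lemma aff_act_mult:
  assumes "u \<in> weyl_group T"
  shows "aff_act T (aff_mult T (x, u) (y, v)) p = aff_act T (x, u) (aff_act T (y, v) p)"
  using assms by (cases p) (simp add: aff_act_def form_add weyl_form)

lemma aff_act_add:
  assumes "u \<in> weyl_group T"
  shows "aff_act T (x, u) (p + p') = aff_act T (x, u) p + aff_act T (x, u) p'"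
  by (cases p; cases p') (simp add: aff_act_def weyl_add[OF assms] form_add)

lemma aff_act_arefl:
  assumes "form T b b = 2"
  shows "aff_act T (arefl T b k) (c, l) =
    ((\<lambda>m. c m - form T c b * b m), l - form T c b * k)"
proof -
  have "form T (\<lambda>m. - k * b m) (reflection T b c) = - k * (- form T c b)"
    unfolding form_scale using form_reflection_root[OF assms, of c] form_sym by metis
  then show ?thesis by (simp add: aff_act_def arefl_def reflection_def)
qed

text \<open>Since \<alpha>_0 = (-\<theta>, 1), the pair (y, k) has the coordinate k at node 0 and
  the coordinate y_i + k \<theta>_i at node i. With t = \<theta> the cone thus consists of the
  nonzero nonnegative combinations of simple affine coroots; t = 0 serves the finite group, where k
  stays 0.\<close>

definition cone :: "dynkin_type \<Rightarrow> coroot_vec \<Rightarrow> coroot_vec \<times> int \<Rightarrow> bool"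
  where "cone T t = (\<lambda>(y, k). 0 \<le> k \<and> (\<forall>i\<in>{1..dynkin_rank T}. 0 \<le> y i + k * t i) \<and>
    (k \<noteq> 0 \<or> (\<exists>i\<in>{1..dynkin_rank T}. y i + k * t i \<noteq> 0)))"

lemma cone_add:
  assumes "cone T t p" "cone T t p'" shows "cone T t (p + p')"
proof -
  obtain y k y' k' where p: "p = (y, k)" "p' = (y', k')" by fastforce
  have c: "0 \<le> k" "\<And>i. i\<in>{1..dynkin_rank T} \<Longrightarrow> 0 \<le> y i + k * t i"
      "0 \<le> k'" "\<And>i. i\<in>{1..dynkin_rank T} \<Longrightarrow> 0 \<le> y' i + k' * t i"
    and n: "k \<noteq> 0 \<or> (\<exists>i\<in>{1..dynkin_rank T}. y i + k * t i \<noteq> 0)"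
    using assms by (auto simp: p cone_def)
  have s: "(y + y') i + (k + k') * t i = (y i + k * t i) + (y' i + k' * t i)" for i
    by (simp add: algebra_simps)
  have "k + k' \<noteq> 0 \<or> (\<exists>i\<in>{1..dynkin_rank T}. (y + y') i + (k + k') * t i \<noteq> 0)"
  proof (cases "k = 0")
    case False
    then show ?thesis using c by auto
  next
    case True
    then obtain i where "i\<in>{1..dynkin_rank T}" "y i + k * t i \<noteq> 0" using n by auto
    then have "(y + y') i + (k + k') * t i \<noteq> 0" unfolding s using c(2)[of i] c(4)[of i] by linarith
    then show ?thesis using \<open>i\<in>{1..dynkin_rank T}\<close> by blast
  qed
  moreover have "\<forall>i\<in>{1..dynkin_rank T}. 0 \<le> (y + y') i + (k + k') * t i"
    unfolding s using c by simp
  ultimately show ?thesis using c by (simp add: p cone_def)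
qed

lemma cone_uminus: "cone T t p \<Longrightarrow> \<not> cone T t (- p)"
  by (cases p) (fastforce simp: cone_def)

section \<open>Types D and E\<close>

text \<open>The affine Dynkin diagram is a tree. It is rooted at the node \<open>0\<close>, and \<open>r + 1\<close>
  serves as a formal parent of the root.\<close>

fun par_node :: "dynkin_type \<Rightarrow> nat \<Rightarrow> nat" where
  "par_node (TypeD n) k = (if k = 0 then Suc n else if k = 1 then 2 else if k = 2 then 0
     else if k = n then n - 2 else k - 1)"
| "par_node TypeE6 k = [7, 3, 0, 4, 2, 4, 5, 0] ! k"
| "par_node TypeE7 k = [8, 0, 4, 1, 3, 4, 5, 6, 0] ! k"
| "par_node TypeE8 k = [9, 3, 4, 4, 5, 6, 7, 8, 0, 0] ! k"

text \<open>Counted from the formal node r + 1, so that node 0 has depth 1 and the depth of i is the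
  length of w_i. In the tables the last entry belongs to the formal node.\<close>

fun dep_node :: "dynkin_type \<Rightarrow> nat \<Rightarrow> nat" where
  "dep_node (TypeD n) k = (if k = Suc n then 0 else if k = 0 then 1 else if k = 1 then 3
     else if k = n then n - 1 else k)"
| "dep_node TypeE6 k = [1, 5, 2, 4, 3, 4, 5, 0] ! k"
| "dep_node TypeE7 k = [1, 2, 5, 3, 4, 5, 6, 7, 0] ! k"
| "dep_node TypeE8 k = [1, 8, 7, 7, 6, 5, 4, 3, 2, 0] ! k"

text \<open>The neighbour of node 0 in the affine diagram, equivalently the only simple coroot not
  orthogonal to \<theta>.\<close>

fun hook :: "dynkin_type \<Rightarrow> nat" where
  "hook (TypeD n) = 2"
| "hook TypeE6 = 2"
| "hook TypeE7 = 1"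
| "hook TypeE8 = 8"

definition vec :: "int list \<Rightarrow> coroot_vec"
  where "vec xs = (\<lambda>k. if 1 \<le> k \<and> k \<le> length xs then xs ! (k - 1) else 0)"

fun theta :: "dynkin_type \<Rightarrow> coroot_vec" where
  "theta (TypeD n) = (\<lambda>k. if k = 0 \<or> n < k then 0 else if k = 1 \<or> k = n - 1 \<or> k = n then 1 else 2)"
| "theta TypeE6 = vec [1, 2, 2, 3, 2, 1]"
| "theta TypeE7 = vec [2, 2, 3, 4, 3, 2, 1]"
| "theta TypeE8 = vec [2, 3, 4, 6, 5, 4, 3, 2]"

lemma par_node_zero [simp]: "par_node T 0 = Suc (dynkin_rank T)"
  by (cases T) auto

lemma dep_node_top [simp]: "dep_node T (Suc (dynkin_rank T)) = 0"
  by (cases T) auto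

lemma dep_node_zero [simp]: "dep_node T 0 = 1"
  by (cases T) auto

lemma par_node_props_E:
  "\<forall>i\<in>set [1..<7]. par_node TypeE6 i \<le> 6 \<and> dep_node TypeE6 i = Suc (dep_node TypeE6 (par_node TypeE6 i)) \<and>
    (par_node TypeE6 i = 0 \<longleftrightarrow> i = 2)"
  "\<forall>i\<in>set [1..<8]. par_node TypeE7 i \<le> 7 \<and> dep_node TypeE7 i = Suc (dep_node TypeE7 (par_node TypeE7 i)) \<and>
    (par_node TypeE7 i = 0 \<longleftrightarrow> i = 1)"
  "\<forall>i\<in>set [1..<9]. par_node TypeE8 i \<le> 8 \<and> dep_node TypeE8 i = Suc (dep_node TypeE8 (par_node TypeE8 i)) \<and>
    (par_node TypeE8 i = 0 \<longleftrightarrow> i = 8)"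
  by code_simp+

lemma par_node_D:
  assumes "4 \<le> n"
  shows "par_node (TypeD n) 1 = 2" "par_node (TypeD n) 2 = 0" "par_node (TypeD n) n = n - 2"
    "3 \<le> k \<Longrightarrow> k < n \<Longrightarrow> par_node (TypeD n) k = k - 1"
  using assms by auto

lemma node_D_cases:
  assumes "1 \<le> k" "k \<le> n"
  obtains "k = 1" | "k = 2" | "k = (n :: nat)" | "3 \<le> k" "k < n"
  using assms by linarith

lemma par_node_props:
  assumes "valid_type T" "i \<in> {1..dynkin_rank T}"
  shows "par_node T i \<le> dynkin_rank T" "dep_node T i = Suc (dep_node T (par_node T i))"
    "par_node T i = 0 \<longleftrightarrow> i = hook T"
proof -
  have "par_node T i \<le> dynkin_rank T \<and> dep_node T i = Suc (dep_node T (par_node T i)) \<and>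
    (par_node T i = 0 \<longleftrightarrow> i = hook T)"
  proof (cases T)
    case (TypeD n)
    then have n: "4 \<le> n" and i: "1 \<le> i" "i \<le> n" using assms by auto
    note p = par_node_D[OF n]
    from i show ?thesis
    proof (cases rule: node_D_cases)
      case 1
      then show ?thesis unfolding TypeD 1 p using n by simp
    next
      case 2
      then show ?thesis unfolding TypeD 2 p using n by simp
    next
      case 3
      have "n - 2 \<noteq> 0" "n - 2 \<noteq> 1" "n - 2 \<noteq> n" "n - 2 \<noteq> Suc n" "n - 1 = Suc (n - 2)" using n by auto
      then show ?thesis unfolding TypeD 3 p using n by simp
    next
      case 4
      then have "i - 1 \<noteq> 0" "i - 1 \<noteq> 1" "i - 1 \<noteq> n" "i - 1 \<noteq> Suc n" "i = Suc (i - 1)" by auto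
      then show ?thesis unfolding TypeD p(4)[OF 4] using 4 by simp
    qed
  next
    case TypeE6
    then have "i \<in> set [1..<7]" using assms by auto
    then show ?thesis
      unfolding TypeE6 dynkin_rank.simps hook.simps by (rule par_node_props_E(1)[THEN bspec])
  next
    case TypeE7
    then have "i \<in> set [1..<8]" using assms by auto
    then show ?thesis
      unfolding TypeE7 dynkin_rank.simps hook.simps by (rule par_node_props_E(2)[THEN bspec])
  next
    case TypeE8
    then have "i \<in> set [1..<9]" using assms by auto
    then show ?thesis
      unfolding TypeE8 dynkin_rank.simps hook.simps by (rule par_node_props_E(3)[THEN bspec])
  qed
  then show "par_node T i \<le> dynkin_rank T" "dep_node T i = Suc (dep_node T (par_node T i))"
    "par_node T i = 0 \<longleftrightarrow> i = hook T" by auto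
qed

section \<open>Adjacency in terms of parents\<close>

lemma edges_E:
  assumes "T = TypeE6 \<or> T = TypeE7 \<or> T = TypeE8"
  shows "(i, j) \<in> dynkin_edges T \<longleftrightarrow>
    i = 1 \<and> j = 3 \<or> i = 2 \<and> j = 4 \<or> 3 \<le> i \<and> i < dynkin_rank T \<and> j = Suc i"
  using assms by auto

text \<open>The set comprehension in \<open>dynkin_edges\<close> replaced by arithmetic conditions,
  so that the finitely many pairs can be checked by evaluation.\<close>

definition edge_E :: "nat \<Rightarrow> nat \<Rightarrow> nat \<Rightarrow> bool"
  where "edge_E r i j \<longleftrightarrow> i = 1 \<and> j = 3 \<or> i = 2 \<and> j = 4 \<or> 3 \<le> i \<and> i < r \<and> j = Suc i"

lemma edge_E_iff_par:
  "\<forall>i\<in>set [1..<7]. \<forall>j\<in>set [1..<7]. (edge_E 6 i j \<or> edge_E 6 j i) = (par_node TypeE6 i = j \<or> par_node TypeE6 j = i)"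
  "\<forall>i\<in>set [1..<8]. \<forall>j\<in>set [1..<8]. (edge_E 7 i j \<or> edge_E 7 j i) = (par_node TypeE7 i = j \<or> par_node TypeE7 j = i)"
  "\<forall>i\<in>set [1..<9]. \<forall>j\<in>set [1..<9]. (edge_E 8 i j \<or> edge_E 8 j i) = (par_node TypeE8 i = j \<or> par_node TypeE8 j = i)"
  by code_simp+

lemma edges_D:
  "(i, j) \<in> dynkin_edges (TypeD n) \<longleftrightarrow> 1 \<le> i \<and> i + 2 \<le> n \<and> j = i + 1 \<or> i = n - 2 \<and> j = n"
  by auto

lemma edges_iff_par_D:
  assumes "4 \<le> n" "1 \<le> i" "i \<le> n" "1 \<le> j" "j \<le> n"
  shows "(i, j) \<in> dynkin_edges (TypeD n) \<or> (j, i) \<in> dynkin_edges (TypeD n) \<longleftrightarrow>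
    par_node (TypeD n) i = j \<or> par_node (TypeD n) j = i"
proof -
  have p: "par_node (TypeD n) k = l \<longleftrightarrow> k = 1 \<and> l = 2 \<or> k = n \<and> l = n - 2 \<or> 3 \<le> k \<and> k < n \<and> k = l + 1"
    if "1 \<le> k" "k \<le> n" "1 \<le> l" for k l
    using that(1,2)
  proof (cases rule: node_D_cases)
    case 1
    then show ?thesis unfolding 1 par_node_D[OF assms(1)] using assms(1) by auto
  next
    case 2
    then show ?thesis unfolding 2 par_node_D[OF assms(1)] using assms(1) that by auto
  next
    case 3
    then show ?thesis unfolding 3 par_node_D[OF assms(1)] using assms(1) by auto
  next
    case 4
    then show ?thesis unfolding par_node_D(4)[OF assms(1) 4] using that by auto
  qed
  have "par_node (TypeD n) k = l \<or> par_node (TypeD n) l = k"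
    if "1 \<le> k" "k \<le> n" "1 \<le> l" "l \<le> n" "(k, l) \<in> dynkin_edges (TypeD n)" for k l
  proof -
    from that(5) consider "k + 2 \<le> n" "l = k + 1" | "k = n - 2" "l = n" unfolding edges_D by blast
    then show ?thesis
    proof cases
      case 1
      then show ?thesis
        using that(1) par_node_D(1)[OF assms(1)] par_node_D(4)[OF assms(1), of l] by (cases "k = 1") auto
    next
      case 2
      then show ?thesis using par_node_D(3)[OF assms(1)] by simp
    qed
  qed
  moreover have "(l, k) \<in> dynkin_edges (TypeD n) \<or> (k, l) \<in> dynkin_edges (TypeD n)"
    if "1 \<le> k" "k \<le> n" "1 \<le> l" "l \<le> n" "par_node (TypeD n) k = l" for k l
    using that(5) that(1-4) assms(1) unfolding edges_D p[OF that(1-3)] by auto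
  ultimately show ?thesis using assms by metis
qed

lemma edges_iff_par:
  assumes "valid_type T" "i \<in> {1..dynkin_rank T}" "j \<in> {1..dynkin_rank T}"
  shows "(i, j) \<in> dynkin_edges T \<or> (j, i) \<in> dynkin_edges T \<longleftrightarrow> par_node T i = j \<or> par_node T j = i"
proof (cases T)
  case (TypeD n)
  show ?thesis unfolding TypeD
    by (rule edges_iff_par_D) (use assms TypeD in auto)
next
  case TypeE6
  have "i \<in> set [1..<7]" "j \<in> set [1..<7]" using assms TypeE6 by auto
  then have "(edge_E 6 i j \<or> edge_E 6 j i) = (par_node T i = j \<or> par_node T j = i)"
    using edge_E_iff_par(1) TypeE6 by blast
  then show ?thesis by (simp only: edges_E TypeE6 dynkin_rank.simps edge_E_def simp_thms)
next
  case TypeE7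
  have "i \<in> set [1..<8]" "j \<in> set [1..<8]" using assms TypeE7 by auto
  then have "(edge_E 7 i j \<or> edge_E 7 j i) = (par_node T i = j \<or> par_node T j = i)"
    using edge_E_iff_par(2) TypeE7 by blast
  then show ?thesis by (simp only: edges_E TypeE7 dynkin_rank.simps edge_E_def simp_thms)
next
  case TypeE8
  have "i \<in> set [1..<9]" "j \<in> set [1..<9]" using assms TypeE8 by auto
  then have "(edge_E 8 i j \<or> edge_E 8 j i) = (par_node T i = j \<or> par_node T j = i)"
    using edge_E_iff_par(3) TypeE8 by blast
  then show ?thesis by (simp only: edges_E TypeE8 dynkin_rank.simps edge_E_def simp_thms)
qed

lemma cartan_par:
  assumes "valid_type T" "i \<in> {1..dynkin_rank T}" "j \<in> {1..dynkin_rank T}"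
  shows "cartan T i j = (if i = j then 2 else if par_node T i = j \<or> par_node T j = i then - 1 else 0)"
  using edges_iff_par[OF assms] by (simp add: cartan_def)

section \<open>Pairings with simple coroots\<close>

definition nbrs :: "dynkin_type \<Rightarrow> nat \<Rightarrow> nat list"
  where "nbrs T i = filter (\<lambda>j. par_node T i = j \<or> par_node T j = i) [1..<Suc (dynkin_rank T)]"

lemma par_node_neq:
  assumes "valid_type T" "i \<in> {1..dynkin_rank T}" shows "par_node T i \<noteq> i"
  using par_node_props(2)[OF assms] by (auto dest: arg_cong[of _ _ "dep_node T"])

lemma form_par:
  assumes "valid_type T" "i \<in> {1..dynkin_rank T}"
  shows "form T x (simple_coroot i) = 2 * x i - (\<Sum>j\<in>set (nbrs T i). x j)"
proof -
  let ?r = "dynkin_rank T" and ?N = "\<lambda>j. par_node T i = j \<or> par_node T j = i"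
  have "form T x (simple_coroot i) =
      (\<Sum>j = 1..?r. (if j = i then 2 * x j else 0) - (if ?N j then x j else 0))"
    unfolding form_simple_right[OF assms(2)]
    by (intro sum.cong refl) (use assms cartan_par par_node_neq in auto)
  also have "\<dots> = 2 * x i - (\<Sum>j\<in>{1..?r} \<inter> {j. ?N j}. x j)"
    using assms by (simp add: sum_subtractf sum.If_cases)
  also have "{1..?r} \<inter> {j. ?N j} = set (nbrs T i)" by (auto simp: nbrs_def)
  finally show ?thesis .
qed

text \<open>An executable version of the form on coordinate lists; node i sits at list position i -
  1.\<close>

definition pairing :: "dynkin_type \<Rightarrow> int list \<Rightarrow> nat \<Rightarrow> int"
  where "pairing T xs i = 2 * xs ! (i - 1) - (\<Sum>j\<leftarrow>nbrs T i. xs ! (j - 1))"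

lemma form_vec:
  assumes "valid_type T" "i \<in> {1..dynkin_rank T}" "length xs = dynkin_rank T"
  shows "form T (vec xs) (simple_coroot i) = pairing T xs i"
proof -
  have d: "distinct (nbrs T i)" by (simp add: nbrs_def)
  have "(\<Sum>j\<in>set (nbrs T i). vec xs j) = (\<Sum>j\<leftarrow>nbrs T i. vec xs j)"
    by (rule sum_list_distinct_conv_sum_set[OF d, symmetric])
  also have "\<dots> = (\<Sum>j\<leftarrow>nbrs T i. xs ! (j - 1))"
    by (intro arg_cong[of _ _ sum_list] map_cong refl) (use assms in \<open>auto simp: vec_def nbrs_def\<close>)
  finally show ?thesis
    using form_par[OF assms(1,2)] assms by (simp add: pairing_def vec_def)
qed

definition bump :: "int list \<Rightarrow> nat \<Rightarrow> int list"
  where "bump xs i = xs[i - 1 := xs ! (i - 1) + 1]"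

text \<open>A certificate that a vector is a coroot: each step adds a simple coroot whose pairing
  with the current vector is -1, and then the sum is the reflected vector.\<close>

primrec climbs :: "dynkin_type \<Rightarrow> int list \<Rightarrow> nat list \<Rightarrow> bool" where
  "climbs T xs [] \<longleftrightarrow> True"
| "climbs T xs (i # is) \<longleftrightarrow> 1 \<le> i \<and> i \<le> dynkin_rank T \<and> pairing T xs i = - 1 \<and> climbs T (bump xs i) is"

lemma climbs_coroots:
  assumes "valid_type T" "length xs = dynkin_rank T" "vec xs \<in> coroots T" "climbs T xs is"
  shows "vec (foldl bump xs is) \<in> coroots T"
  using assms(2-4)
proof (induction "is" arbitrary: xs)
  case (Cons i "is")
  have i: "i \<in> {1..dynkin_rank T}" using Cons.prems by simp
  have "vec (bump xs i) = vec xs + simple_coroot i"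
    using i Cons.prems(1) by (auto simp: vec_def bump_def simple_coroot_def nth_list_update fun_eq_iff)
  moreover have "form T (vec xs) (simple_coroot i) = - 1"
    using form_vec[OF assms(1) i Cons.prems(1)] Cons.prems(3) by simp
  ultimately have "vec (bump xs i) \<in> coroots T" using coroot_add_simple[OF Cons.prems(2) i] by simp
  then show ?case using Cons by (simp add: bump_def)
qed simp

lemma vec_simple: "vec (1 # replicate n 0) = simple_coroot 1"
  by (auto simp: vec_def simple_coroot_def nth_Cons' fun_eq_iff)

lemma theta_coroot_E6: "theta TypeE6 \<in> coroots TypeE6"
proof -
  \<comment> \<open>A chain from \<alpha>_1 up to \<theta>; the length of the list is the height of
    \<theta> minus 1. The same holds for the lists in types E7 and E8.\<close>
  let ?p = "[3, 4, 2, 5, 4, 3, 6, 5, 4, 2]"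
  have c: "climbs TypeE6 (1 # replicate 5 0) ?p" and f: "foldl bump (1 # replicate 5 0) ?p = [1, 2, 2, 3, 2, 1]"
    by code_simp+
  have "vec (1 # replicate 5 0) \<in> coroots TypeE6"
    unfolding vec_simple by (rule simple_coroot_coroots) simp
  from climbs_coroots[OF _ _ this c] show ?thesis unfolding f by simp
qed

lemma theta_coroot_E7: "theta TypeE7 \<in> coroots TypeE7"
proof -
  let ?p = "[3, 4, 2, 5, 4, 3, 6, 5, 4, 2, 7, 6, 5, 4, 3, 1]"
  have c: "climbs TypeE7 (1 # replicate 6 0) ?p" and f: "foldl bump (1 # replicate 6 0) ?p = [2, 2, 3, 4, 3, 2, 1]"
    by code_simp+
  have "vec (1 # replicate 6 0) \<in> coroots TypeE7"
    unfolding vec_simple by (rule simple_coroot_coroots) simp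
  from climbs_coroots[OF _ _ this c] show ?thesis unfolding f by simp
qed

lemma theta_coroot_E8: "theta TypeE8 \<in> coroots TypeE8"
proof -
  let ?p = "[3, 4, 2, 5, 4, 3, 6, 5, 4, 2, 7, 6, 5, 4, 3, 1, 8, 7, 6, 5, 4, 2, 3, 4, 5, 6, 7, 8]"
  have c: "climbs TypeE8 (1 # replicate 7 0) ?p" and f: "foldl bump (1 # replicate 7 0) ?p = [2, 3, 4, 6, 5, 4, 3, 2]"
    by code_simp+
  have "vec (1 # replicate 7 0) \<in> coroots TypeE8"
    unfolding vec_simple by (rule simple_coroot_coroots) simp
  from climbs_coroots[OF _ _ this c] show ?thesis unfolding f by simp
qed

lemma set_nbrs_D:
  assumes "4 \<le> n"
  shows "set (nbrs (TypeD n) 1) = {2}"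
    "2 \<le> i \<Longrightarrow> i + 3 \<le> n \<Longrightarrow> set (nbrs (TypeD n) i) = {i - 1, i + 1}"
    "set (nbrs (TypeD n) (n - 2)) = {n - 3, n - 1, n}"
    "set (nbrs (TypeD n) (n - 1)) = {n - 2}"
    "set (nbrs (TypeD n) n) = {n - 2}"
proof -
  obtain k where n: "n = k + 4" using assms by (metis le_add_diff_inverse2)
  have m: "j \<in> set (nbrs (TypeD n) i) \<longleftrightarrow> (1 \<le> j \<and> j \<le> n) \<and>
      ((1 \<le> i \<and> i + 2 \<le> n \<and> j = i + 1 \<or> i = n - 2 \<and> j = n) \<or>
       (1 \<le> j \<and> j + 2 \<le> n \<and> i = j + 1 \<or> j = n - 2 \<and> i = n))"
    if i: "1 \<le> i" "i \<le> n" for i j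
  proof -
    have "j \<in> set (nbrs (TypeD n) i) \<longleftrightarrow> (1 \<le> j \<and> j \<le> n) \<and>
        (par_node (TypeD n) i = j \<or> par_node (TypeD n) j = i)"
      unfolding nbrs_def set_filter set_upt dynkin_rank.simps mem_Collect_eq atLeastLessThan_iff less_Suc_eq_le
      by (rule refl)
    then show ?thesis
      using edges_iff_par_D[OF assms i, of j] unfolding edges_D by blast
  qed
  show "set (nbrs (TypeD n) 1) = {2}"
    unfolding n by (auto simp: set_eq_iff m[unfolded n])
  show "set (nbrs (TypeD n) i) = {i - 1, i + 1}" if "2 \<le> i" "i + 3 \<le> n"
    using that unfolding n by (auto simp: set_eq_iff m[unfolded n])
  show "set (nbrs (TypeD n) (n - 2)) = {n - 3, n - 1, n}"
    unfolding n by (auto simp: set_eq_iff m[unfolded n])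
  show "set (nbrs (TypeD n) (n - 1)) = {n - 2}"
    unfolding n by (auto simp: set_eq_iff m[unfolded n])
  show "set (nbrs (TypeD n) n) = {n - 2}"
    unfolding n by (auto simp: set_eq_iff m[unfolded n])
qed

lemma form_D:
  assumes "4 \<le> n"
  shows "form (TypeD n) x (simple_coroot 1) = 2 * x 1 - x 2"
    "2 \<le> i \<Longrightarrow> i + 3 \<le> n \<Longrightarrow> form (TypeD n) x (simple_coroot i) = 2 * x i - (x (i - 1) + x (i + 1))"
    "form (TypeD n) x (simple_coroot (n - 2)) = 2 * x (n - 2) - (x (n - 3) + x (n - 1) + x n)"
    "form (TypeD n) x (simple_coroot (n - 1)) = 2 * x (n - 1) - x (n - 2)"
    "form (TypeD n) x (simple_coroot n) = 2 * x n - x (n - 2)"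
proof -
  have f: "form (TypeD n) x (simple_coroot k) = 2 * x k - (\<Sum>j\<in>set (nbrs (TypeD n) k). x j)"
    if "1 \<le> k" "k \<le> n" for k
    using form_par[of "TypeD n" k x] that assms by simp
  note s = set_nbrs_D[OF assms]
  have "n - 3 \<noteq> n - 1" "n - 3 \<noteq> n" "n - 1 \<noteq> n" using assms by auto
  then have "(\<Sum>j\<in>{n - 3, n - 1, n}. x j) = x (n - 3) + x (n - 1) + x n" by simp
  then show "form (TypeD n) x (simple_coroot (n - 2)) = 2 * x (n - 2) - (x (n - 3) + x (n - 1) + x n)"
    using f[of "n - 2"] assms s(3) by simp
  show "form (TypeD n) x (simple_coroot 1) = 2 * x 1 - x 2"
    "2 \<le> i \<Longrightarrow> i + 3 \<le> n \<Longrightarrow> form (TypeD n) x (simple_coroot i) = 2 * x i - (x (i - 1) + x (i + 1))"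
    "form (TypeD n) x (simple_coroot (n - 1)) = 2 * x (n - 1) - x (n - 2)"
    "form (TypeD n) x (simple_coroot n) = 2 * x n - x (n - 2)"
    using f[of 1] f[of i] f[of "n - 1"] f[of n] assms s(1) s(2) s(4) s(5) by simp_all
qed

text \<open>In the usual orthonormal coordinates this is the coroot with entries 1 at positions k
  and k + 1 and 0 elsewhere. Adding \<alpha>_k and then \<alpha>_{k+1} leads from index k + 1 to
  index k, and index 1 is \<theta>.\<close>

definition root_D :: "nat \<Rightarrow> nat \<Rightarrow> coroot_vec"
  where "root_D n k = (\<lambda>j. if j < k \<or> n < j then 0 else if j = k \<or> j = n - 1 \<or> j = n then 1 else 2)"

lemma root_D_coroot:
  assumes "4 \<le> n" "1 \<le> k" "k \<le> n - 2" shows "root_D n k \<in> coroots (TypeD n)"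
  using assms(3,2)
proof (induction k rule: inc_induct)
  case base
  let ?a = simple_coroot
  have a: "?a n \<in> coroots (TypeD n)" using assms by (intro simple_coroot_coroots) auto
  have "form (TypeD n) (?a n) (?a (n - 2)) = - 1"
    using assms(1) unfolding form_D(3)[OF assms(1)] by (auto simp: simple_coroot_def)
  then have 1: "?a n + ?a (n - 2) \<in> coroots (TypeD n)"
    using assms by (intro coroot_add_simple[OF a]) auto
  have "form (TypeD n) (?a n + ?a (n - 2)) (?a (n - 1)) = - 1"
    using assms(1) unfolding form_D(4)[OF assms(1)] by (auto simp: simple_coroot_def)
  then have "?a n + ?a (n - 2) + ?a (n - 1) \<in> coroots (TypeD n)"
    using assms by (intro coroot_add_simple[OF 1]) auto
  moreover have "?a n + ?a (n - 2) + ?a (n - 1) = root_D n (n - 2)"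
    using assms by (intro ext) (auto simp: simple_coroot_def root_D_def)
  ultimately show ?case by simp
next
  case (step k)
  let ?a = simple_coroot and ?b = "root_D n (Suc k)"
  have b: "?b \<in> coroots (TypeD n)" using step by simp
  have k: "1 \<le> k" "k + 3 \<le> n" using step by auto
  have "form (TypeD n) ?b (?a k) = - 1"
  proof (cases "k = 1")
    case True
    have "?b 1 = 0" "?b 2 = 1" using True assms(1) by (auto simp: root_D_def)
    then show ?thesis using True form_D(1)[OF assms(1), of ?b] by simp
  next
    case False
    have "?b (k - 1) = 0" "?b k = 0" "?b (k + 1) = 1" using k by (auto simp: root_D_def)
    then show ?thesis using k False form_D(2)[OF assms(1), of k ?b] by simp
  qed
  then have 1: "?b + ?a k \<in> coroots (TypeD n)"
    using k by (intro coroot_add_simple[OF b]) auto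
  have "form (TypeD n) (?b + ?a k) (?a (Suc k)) = - 1"
  proof (cases "k + 3 = n")
    case True
    have "(?b + ?a k) (n - 3) = 1" "(?b + ?a k) (n - 2) = 1" "(?b + ?a k) (n - 1) = 1" "(?b + ?a k) n = 1"
      using True by (auto simp: root_D_def simple_coroot_def)
    moreover have "Suc k = n - 2" using True by simp
    ultimately show ?thesis using form_D(3)[OF assms(1), of "?b + ?a k"] by simp
  next
    case False
    have "(?b + ?a k) k = 1" "(?b + ?a k) (Suc k) = 1" "(?b + ?a k) (Suc (Suc k)) = 2"
      using False k by (auto simp: root_D_def simple_coroot_def)
    then show ?thesis using k False form_D(2)[OF assms(1), of "Suc k" "?b + ?a k"] by simp
  qed
  then have "?b + ?a k + ?a (Suc k) \<in> coroots (TypeD n)"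
    using k by (intro coroot_add_simple[OF 1]) auto
  moreover have "?b + ?a k + ?a (Suc k) = root_D n k"
    using k by (intro ext) (auto simp: simple_coroot_def root_D_def)
  ultimately show ?case by simp
qed

lemma theta_coroot: assumes "valid_type T" shows "theta T \<in> coroots T"
proof (cases T)
  case (TypeD n)
  then have "4 \<le> n" using assms by simp
  moreover have "theta T = root_D n 1" unfolding TypeD by (auto simp: root_D_def fun_eq_iff)
  ultimately show ?thesis using root_D_coroot[of n 1] TypeD by simp
qed (use theta_coroot_E6 theta_coroot_E7 theta_coroot_E8 in simp_all)

lemma theta_in_lattice: "valid_type T \<Longrightarrow> theta T \<in> coroot_lattice T"
  by (simp add: theta_coroot coroot_in_lattice)

lemma theta_norm: "valid_type T \<Longrightarrow> form T (theta T) (theta T) = 2"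
  by (simp add: theta_coroot coroot_norm)

lemma theta_pairing_E:
  "\<forall>i\<in>set [1..<7]. pairing TypeE6 [1, 2, 2, 3, 2, 1] i = (if i = 2 then 1 else 0)"
  "\<forall>i\<in>set [1..<8]. pairing TypeE7 [2, 2, 3, 4, 3, 2, 1] i = (if i = 1 then 1 else 0)"
  "\<forall>i\<in>set [1..<9]. pairing TypeE8 [2, 3, 4, 6, 5, 4, 3, 2] i = (if i = 8 then 1 else 0)"
  by code_simp+

lemma form_theta_simple:
  assumes "valid_type T" "i \<in> {1..dynkin_rank T}"
  shows "form T (theta T) (simple_coroot i) = (if i = hook T then 1 else 0)"
proof (cases T)
  case (TypeD n)
  then have n: "4 \<le> n" and i: "1 \<le> i" "i \<le> n" using assms by auto
  define x where "x = theta T"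
  have x: "x k = (if k = 0 \<or> n < k then 0 else if k = 1 \<or> k = n - 1 \<or> k = n then 1 else 2)" for k
    by (simp add: x_def TypeD)
  consider "i = 1" | "2 \<le> i" "i + 3 \<le> n" | "i = n - 2" | "i = n - 1" | "i = n"
    using n i by linarith
  then have "form (TypeD n) x (simple_coroot i) = (if i = 2 then 1 else 0)"
  proof cases
    case 1
    show ?thesis unfolding 1 form_D(1)[OF n] using n by (auto simp: x)
  next
    case 2
    show ?thesis unfolding form_D(2)[OF n 2] using n 2 by (auto simp: x)
  next
    case 3
    show ?thesis unfolding 3 form_D(3)[OF n] using n by (auto simp: x)
  next
    case 4
    show ?thesis unfolding 4 form_D(4)[OF n] using n by (auto simp: x)
  next
    case 5
    show ?thesis unfolding 5 form_D(5)[OF n] using n by (auto simp: x)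
  qed
  then show ?thesis by (simp add: x_def TypeD)
next
  case TypeE6
  then show ?thesis using assms theta_pairing_E(1) by (simp add: form_vec)
next
  case TypeE7
  then show ?thesis using assms theta_pairing_E(2) by (simp add: form_vec)
next
  case TypeE8
  then show ?thesis using assms theta_pairing_E(3) by (simp add: form_vec)
qed

section \<open>The affine Weyl group\<close>

text \<open>Stated for an arbitrary group of affine reflections because it is used twice: for the
  finite Weyl group, where it shows that \<theta> is highest, and for the affine group.\<close>

lemma simply_laced_words_affine:
  fixes H :: "aff monoid" and f :: "nat \<Rightarrow> coroot_vec" and k :: "nat \<Rightarrow> int"
  assumes "group H" and mult: "monoid.mult H = aff_mult T" and one: "\<one>\<^bsub>H\<^esub> = (0, id)"
    and carrier: "carrier H \<subseteq> carrier (affine_weyl T)"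
    and "finite I" and s_closed: "\<And>i. i \<in> I \<Longrightarrow> s i \<in> carrier H"
    and s: "\<And>i. i \<in> I \<Longrightarrow> s i = arefl T (f i) (k i)"
    and norm: "\<And>i. i \<in> I \<Longrightarrow> form T (f i) (f i) = 2"
    and adj: "\<And>i j. i \<in> I \<Longrightarrow> j \<in> I \<Longrightarrow> i \<noteq> j \<Longrightarrow> form T (f i) (f j) = (if adj i j then - 1 else 0)"
    and adj_sym: "\<And>i j. adj i j \<Longrightarrow> adj j i"
    and generated: "\<And>w. w \<in> carrier H \<Longrightarrow> \<exists>is. set is \<subseteq> I \<and> w = word_prod H (map s is)"
    and pos: "\<And>i. i \<in> I \<Longrightarrow> cone T t (f i, k i)"
  shows "simply_laced_words H I s adj (aff_act T) (\<lambda>i. (f i, k i)) (cone T t)"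
proof -
  have snd_weyl: "snd g \<in> weyl_group T" if "g \<in> carrier H" for g
    using that carrier by (auto simp: aff_carrier)
  interpret group H by fact
  show ?thesis
  proof
    show "finite I" by fact
    show "s i \<in> carrier H" if "i \<in> I" for i using s_closed that .
    show "s i \<otimes>\<^bsub>H\<^esub> s i = \<one>\<^bsub>H\<^esub>" if "i \<in> I" for i
      using that arefl_invol[OF norm] by (simp add: mult one s)
    show "\<exists>is. set is \<subseteq> I \<and> w = word_prod H (map s is)" if "w \<in> carrier H" for w
      using generated that .
    show "adj j i" if "adj i j" for i j using adj_sym that .
    show "s i \<otimes>\<^bsub>H\<^esub> s j = s j \<otimes>\<^bsub>H\<^esub> s i" if "i \<in> I" "j \<in> I" "\<not> adj i j" "i \<noteq> j" for i j
      using arefl_commute[OF norm[OF that(1)] norm[OF that(2)]] adj[OF that(1,2)] that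
      by (simp add: mult s)
    show "s i \<otimes>\<^bsub>H\<^esub> (s j \<otimes>\<^bsub>H\<^esub> s i) = s j \<otimes>\<^bsub>H\<^esub> (s i \<otimes>\<^bsub>H\<^esub> s j)"
      if "i \<in> I" "j \<in> I" "adj i j" "i \<noteq> j" for i j
      using arefl_braid[OF norm[OF that(1)] norm[OF that(2)]] adj[OF that(1,2)] that
      by (simp add: mult s)
    show "aff_act T \<one>\<^bsub>H\<^esub> x = x" for x
      by (cases x) (simp add: one aff_act_def)
    show "aff_act T (g \<otimes>\<^bsub>H\<^esub> h) x = aff_act T g (aff_act T h x)"
      if "g \<in> carrier H" "h \<in> carrier H" for g h x
      using aff_act_mult[OF snd_weyl[OF that(1)], of "fst g" "fst h" "snd h" x] by (simp add: mult)
    show "aff_act T g (x + y) = aff_act T g x + aff_act T g y" if "g \<in> carrier H" for g x y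
      using aff_act_add[OF snd_weyl[OF that], of "fst g" x y] by simp
    show "aff_act T (s i) (f j, k j) =
        (if i = j then - (f i, k i) else if adj i j then (f j, k j) + (f i, k i) else (f j, k j))"
      if "i \<in> I" "j \<in> I" for i j
      using that norm[of i] adj[of j i] adj_sym
      by (auto simp: s aff_act_arefl[OF norm] fun_eq_iff)
    show "cone T t (f i, k i)" if "i \<in> I" for i using pos that .
    show "cone T t (x + y)" if "cone T t x" "cone T t y" for x y using cone_add that .
    show "\<not> cone T t (- x)" if "cone T t x" for x using cone_uminus that .
  qed
qed

lemma aff_coroot_fin_simple: "1 \<le> i \<Longrightarrow> aff_coroot_fin T i = simple_coroot i"
  by (simp add: aff_coroot_fin_def)

lemma aff_adjacent_sym: "aff_adjacent T i j \<Longrightarrow> aff_adjacent T j i"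
  by (simp add: aff_adjacent_def form_sym[of T "aff_coroot_fin T j"])

lemma simple_refl_simple: "1 \<le> i \<Longrightarrow> simple_refl T i = arefl T (simple_coroot i) 0"
  by (simp add: simple_refl_def arefl_def zero_fun_def)

lemma form_simple_adjacent:
  assumes "i \<in> {1..dynkin_rank T}" "j \<in> {1..dynkin_rank T}" "i \<noteq> j"
  shows "form T (simple_coroot i) (simple_coroot j) = (if aff_adjacent T i j then - 1 else 0)"
  using assms by (simp add: aff_adjacent_def aff_coroot_fin_simple form_simple_simple cartan_def)

lemma finite_weyl_word:
  assumes "w \<in> weyl_group T"
  shows "\<exists>is. set is \<subseteq> {1..dynkin_rank T} \<and> (0, w) = word_prod (affine_weyl T) (map (simple_refl T) is)"
  using assms
proof (induction w rule: weyl_group.induct)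
  case weyl_id
  have "word_prod (affine_weyl T) (map (simple_refl T) []) = (0, id)"
    by (subst aff_one[symmetric]) (simp add: word_prod_def del: aff_one)
  then show ?case by (intro exI[of _ "[]"]) (metis empty_subsetI list.set(1))
next
  case (weyl_step w i)
  then obtain "is" where "is": "set is \<subseteq> {1..dynkin_rank T}"
    "(0, w) = word_prod (affine_weyl T) (map (simple_refl T) is)" by blast
  have z: "reflection T (simple_coroot i) 0 = 0" by (rule ext) (simp add: reflection_apply)
  have "word_prod (affine_weyl T) (map (simple_refl T) (i # is)) =
      aff_mult T (simple_refl T i) (0, w)"
    by (simp add: "is"(2) word_prod_def)
  also have "\<dots> = (0, reflection T (simple_coroot i) \<circ> w)"
    using weyl_step(2) z by (simp add: simple_refl_def)
  finally show ?case using weyl_step(2) "is"(1) by (intro exI[of _ "i # is"]) auto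
qed

section \<open>Identification of the highest coroot by means of the finite Weyl group\<close>

abbreviation finite_weyl_grp :: "dynkin_type \<Rightarrow> aff monoid"
  where "finite_weyl_grp T \<equiv> (affine_weyl T)\<lparr>carrier := finite_weyl T\<rparr>"

lemma simply_laced_finite:
  "simply_laced_words (finite_weyl_grp T) {1..dynkin_rank T} (simple_refl T) (aff_adjacent T)
    (aff_act T) (\<lambda>i. (simple_coroot i, 0)) (cone T 0)"
proof (rule simply_laced_words_affine)
  show "carrier (finite_weyl_grp T) \<subseteq> carrier (affine_weyl T)"
    by (auto simp: finite_weyl_def aff_carrier coroot_lattice_def)
  show "simple_refl T i \<in> carrier (finite_weyl_grp T)" if "i \<in> {1..dynkin_rank T}" for i
    using that weyl_simple[OF that] by (simp add: simple_refl_def finite_weyl_def)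
  show "\<exists>is. set is \<subseteq> {1..dynkin_rank T} \<and> w = word_prod (finite_weyl_grp T) (map (simple_refl T) is)"
    if "w \<in> carrier (finite_weyl_grp T)" for w
    using that finite_weyl_word by (auto simp: finite_weyl_def word_prod_def)
  show "cone T 0 (simple_coroot i, 0)" if "i \<in> {1..dynkin_rank T}" for i
    using that by (auto simp: cone_def simple_coroot_def)
qed (auto simp: group_finite_weyl simple_refl_simple form_simple_adjacent aff_adjacent_sym)

text \<open>\<theta> is dominant. If s_i lengthens w, then w^{-1} \<alpha>_i is positive, so (w
  \<theta>, \<alpha>_i) = (\<theta>, w^{-1} \<alpha>_i) is nonnegative and s_i can only lower w
  \<theta>. Induction on the length then starts from \<theta> itself.\<close>

lemma weyl_theta_le:
  assumes T: "valid_type T" and w: "w \<in> weyl_group T" shows "w (theta T) \<le> theta T"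
proof -
  interpret F: simply_laced_words "finite_weyl_grp T" "{1..dynkin_rank T}" "simple_refl T" "aff_adjacent T"
    "aff_act T" "\<lambda>i. (simple_coroot i, 0)" "cone T 0"
    by (rule simply_laced_finite)
  have "snd g (theta T) \<le> theta T" if "g \<in> carrier (finite_weyl_grp T)" for g
    using that
  proof (induction g rule: F.len_induct)
    case one
    show ?case by simp
  next
    case (step i g)
    obtain w where g: "g = (0, w)" "w \<in> weyl_group T" using step(2) by (auto simp: finite_weyl_def)
    have "inv\<^bsub>finite_weyl_grp T\<^esub> g \<in> carrier (finite_weyl_grp T)" using step(2) by blast
    then obtain v where v: "inv\<^bsub>finite_weyl_grp T\<^esub> g = (0, v)" "v \<in> weyl_group T"
      by (auto simp: finite_weyl_def)
    have "aff_mult T (0, v) g = (0, id)" using F.l_inv[OF step(2)] v by simp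
    then have vw: "v (w x) = x" for x using g by (simp add: pointfree_idE)
    have "cone T 0 (aff_act T (0, v) (simple_coroot i, 0))"
      using F.pull_pos[OF step(2,1)] step(3) v by simp
    then have nn: "0 \<le> v (simple_coroot i) j" if "j \<in> {1..dynkin_rank T}" for j
      using that by (simp add: cone_def aff_act_def)
    have "form T (w (theta T)) (simple_coroot i) = form T (theta T) (v (simple_coroot i))"
      using weyl_form[OF v(2), of "w (theta T)"] vw by simp
    also have "\<dots> = (\<Sum>j = 1..dynkin_rank T. v (simple_coroot i) j * form T (simple_coroot j) (theta T))"
      by (subst form_sym) (rule form_expand)
    also have "\<dots> \<ge> 0"
      using nn form_theta_simple[OF T] form_sym[of T "theta T"] by (intro sum_nonneg) simp
    finally have "snd (simple_refl T i \<otimes>\<^bsub>finite_weyl_grp T\<^esub> g) (theta T) l \<le> w (theta T) l" for l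
      using step(1) by (simp add: g simple_refl_def reflection_apply) (simp add: simple_coroot_def)
    then show ?case using step.IH g by (auto simp: le_fun_def intro: order_trans)
  qed
  from this[of "(0, w)"] show ?thesis using w by (simp add: finite_weyl_def)
qed

text \<open>For adjacent nodes s_i s_j maps \<alpha>_i to \<alpha>_j.\<close>

lemma simple_adjacent_orbit:
  assumes "i \<in> {1..dynkin_rank T}" "j \<in> {1..dynkin_rank T}" "aff_adjacent T i j"
    and w: "w \<in> weyl_group T" "w t = simple_coroot i"
  shows "\<exists>w\<in>weyl_group T. w t = simple_coroot j"
proof -
  have ij: "i \<noteq> j" using assms(3) by (simp add: aff_adjacent_def)
  have c: "form T (simple_coroot i) (simple_coroot j) = - 1"
    "form T (simple_coroot j) (simple_coroot i) = - 1"
    using assms ij aff_adjacent_sym[of T i j] by (simp_all add: form_simple_adjacent)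
  let ?w = "reflection T (simple_coroot i) \<circ> (reflection T (simple_coroot j) \<circ> w)"
  have "?w t = simple_coroot j"
    using assms c by (intro ext) (simp add: w(2) reflection_apply form_reflection_left)
  then show ?thesis using w assms weyl_step by metis
qed

lemma aff_adjacent_simple_iff:
  assumes "valid_type T" "i \<in> {1..dynkin_rank T}" "j \<in> {1..dynkin_rank T}"
  shows "aff_adjacent T i j \<longleftrightarrow> par_node T i = j \<or> par_node T j = i"
  using assms cartan_par[OF assms] par_node_neq
  by (auto simp: aff_adjacent_def aff_coroot_fin_simple form_simple_simple)

lemma simple_coroot_theta_orbit:
  assumes T: "valid_type T" and i: "i \<in> {1..dynkin_rank T}"
  shows "\<exists>w\<in>weyl_group T. w (theta T) = simple_coroot i"
proof -
  let ?O = "\<lambda>i. \<exists>w\<in>weyl_group T. w (theta T) = simple_coroot i"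
  \<comment> \<open>An equivalence, because \<theta> is only known to lie in the orbit of some
    simple coroot: the argument goes from that node to the hook and from there to i.\<close>
  have iff: "?O i \<longleftrightarrow> ?O (hook T)" if "i \<in> {1..dynkin_rank T}" for i
    using that
  proof (induction "dep_node T i" arbitrary: i rule: less_induct)
    case less
    note p = par_node_props[OF T less.prems]
    show ?case
    proof (cases "i = hook T")
      case False
      then have pi: "par_node T i \<in> {1..dynkin_rank T}" using p by auto
      have "aff_adjacent T i (par_node T i)" "aff_adjacent T (par_node T i) i"
        using aff_adjacent_simple_iff[OF T] less.prems pi by auto
      then have "?O i \<longleftrightarrow> ?O (par_node T i)"
        using simple_adjacent_orbit less.prems pi by blast
      then show ?thesis using less.hyps[OF _ pi] p by simp
    qed simp
  qed
  obtain w k where w: "w \<in> weyl_group T" "k \<in> {1..dynkin_rank T}" "theta T = w (simple_coroot k)"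
    using theta_coroot[OF T] by (auto simp: coroots_def)
  obtain v where "v \<in> weyl_group T" "v \<circ> w = id" using weyl_inverse[OF w(1)] by blast
  then have "?O k" using w(3) by (metis comp_apply id_apply)
  then show ?thesis using iff i w(2) by blast
qed

lemma highest_coroot_eq: assumes "valid_type T" shows "highest_coroot T = theta T"
  unfolding highest_coroot_def
proof (rule the_equality)
  have "b \<le> theta T" if b: "b \<in> coroots T" for b
  proof -
    obtain w i where w: "w \<in> weyl_group T" "i \<in> {1..dynkin_rank T}" "b = w (simple_coroot i)"
      using b unfolding coroots_def by blast
    obtain u where "u \<in> weyl_group T" "u (theta T) = simple_coroot i"
      using simple_coroot_theta_orbit[OF assms w(2)] by blast
    then show ?thesis using weyl_theta_le[OF assms weyl_comp[OF w(1)], of u] w(3) by simp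
  qed
  then show t: "theta T \<in> coroots T \<and> (\<forall>b\<in>coroots T. b \<le> theta T)"
    using theta_coroot[OF assms] by blast
  show "t = theta T" if "t \<in> coroots T \<and> (\<forall>b\<in>coroots T. b \<le> t)" for t
    using that t by (auto intro: order_antisym)
qed

section \<open>The affine simple reflections and generation by them\<close>

abbreviation aff_level :: "nat \<Rightarrow> int" where "aff_level i \<equiv> (if i = 0 then 1 else 0)"

lemma simple_refl_arefl:
  assumes "valid_type T"
  shows "simple_refl T i = arefl T (aff_coroot_fin T i) (aff_level i)"
proof (cases "i = 0")
  case True
  then show ?thesis
    by (simp add: simple_refl_def translation_def arefl_def aff_coroot_fin_def
        reflection_uminus_root fun_eq_iff)
next
  case False
  then show ?thesis by (simp add: simple_refl_simple aff_coroot_fin_simple)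
qed

lemma aff_coroot_fin_norm:
  assumes "valid_type T" "i \<in> {0..dynkin_rank T}"
  shows "form T (aff_coroot_fin T i) (aff_coroot_fin T i) = 2"
  using assms by (cases "i = 0")
    (simp_all add: aff_coroot_fin_def highest_coroot_eq form_uminus theta_norm)

lemma aff_coroot_fin_adjacent:
  assumes T: "valid_type T" and i: "i \<in> {0..dynkin_rank T}" "j \<in> {0..dynkin_rank T}" "i \<noteq> j"
  shows "form T (aff_coroot_fin T i) (aff_coroot_fin T j) = (if aff_adjacent T i j then - 1 else 0)"
    "aff_adjacent T i j \<longleftrightarrow> par_node T i = j \<or> par_node T j = i"
proof -
  have z: "form T (aff_coroot_fin T 0) (aff_coroot_fin T k) = (if k = hook T then - 1 else 0)"
    if "k \<in> {1..dynkin_rank T}" for k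
    using that form_theta_simple[OF T that] by (simp add: aff_coroot_fin_def highest_coroot_eq[OF T] form_uminus)
  have z': "form T (aff_coroot_fin T 0) (aff_coroot_fin T k) = (if aff_adjacent T 0 k then - 1 else 0)"
    "aff_adjacent T 0 k \<longleftrightarrow> par_node T k = 0" "par_node T 0 \<noteq> k"
    if "k \<in> {1..dynkin_rank T}" for k
    using that z[OF that] par_node_props(3)[OF T that] by (auto simp: aff_adjacent_def)
  have "form T (aff_coroot_fin T i) (aff_coroot_fin T j) = (if aff_adjacent T i j then - 1 else 0)
    \<and> (aff_adjacent T i j \<longleftrightarrow> par_node T i = j \<or> par_node T j = i)"
  proof (cases "i = 0")
    case True
    then show ?thesis using i z'[of j] by auto
  next
    case i0: False
    show ?thesis
    proof (cases "j = 0")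
      case True
      have "aff_adjacent T i 0 \<longleftrightarrow> aff_adjacent T 0 i" using aff_adjacent_sym by blast
      then show ?thesis
        using True i i0 z'[of i] form_sym[of T "aff_coroot_fin T i" "aff_coroot_fin T 0"] by auto
    next
      case False
      then show ?thesis using i i0 aff_adjacent_simple_iff[OF T, of i j] form_simple_adjacent[of i T j]
        by (simp add: aff_coroot_fin_simple)
    qed
  qed
  then show "form T (aff_coroot_fin T i) (aff_coroot_fin T j) = (if aff_adjacent T i j then - 1 else 0)"
    "aff_adjacent T i j \<longleftrightarrow> par_node T i = j \<or> par_node T j = i" by blast+
qed

lemma simple_refl_in:
  assumes T: "valid_type T" and i: "i \<in> {0..dynkin_rank T}"
  shows "simple_refl T i \<in> carrier (affine_weyl T)"
proof (cases "i = 0")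
  case True
  then show ?thesis
    using theta_in_lattice[OF T] coroot_reflection[OF theta_coroot[OF T]]
    by (simp add: simple_refl_def translation_def highest_coroot_eq[OF T] aff_carrier)
next
  case False
  then show ?thesis using i weyl_simple[of i T]
    by (simp add: simple_refl_def aff_carrier coroot_lattice_def)
qed

text \<open>s_0 s_\<theta> is the translation by \<theta>, and its conjugates under the finite group
  are the translations by the orbit of \<theta>. This orbit contains the simple coroots and their
  negatives, which generate the coroot lattice.\<close>

lemma affine_generated:
  assumes T: "valid_type T" and g: "g \<in> carrier (affine_weyl T)"
  shows "\<exists>is. set is \<subseteq> {0..dynkin_rank T} \<and> g = word_prod (affine_weyl T) (map (simple_refl T) is)"
proof -
  interpret group "affine_weyl T" by (rule group_affine_weyl)
  define W where "W = {g. \<exists>is. set is \<subseteq> {0..dynkin_rank T} \<and> g = word_prod (affine_weyl T) (map (simple_refl T) is)}"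
  have closed: "word_prod (affine_weyl T) (map (simple_refl T) is) \<in> carrier (affine_weyl T)"
    if "set is \<subseteq> {0..dynkin_rank T}" for "is"
    using that by (induction "is") (auto simp: word_prod_def simple_refl_in[OF T] simp del: aff_one)
  have app: "word_prod (affine_weyl T) (map (simple_refl T) (is @ js)) =
      aff_mult T (word_prod (affine_weyl T) (map (simple_refl T) is)) (word_prod (affine_weyl T) (map (simple_refl T) js))"
    if "set is \<subseteq> {0..dynkin_rank T}" "set js \<subseteq> {0..dynkin_rank T}" for "is" js
    using that(1)
  proof (induction "is")
    case Nil
    then show ?case using closed[OF that(2)] by (simp add: word_prod_def del: aff_one)
  next
    case (Cons i "is")
    then show ?case using closed[of "is"] closed[OF that(2)] simple_refl_in[OF T, of i]
      by (simp add: word_prod_def m_assoc)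
  qed
  have W_mult: "aff_mult T a b \<in> W" if ab: "a \<in> W" "b \<in> W" for a b
  proof -
    obtain "is" js where ij: "set is \<subseteq> {0..dynkin_rank T}" "a = word_prod (affine_weyl T) (map (simple_refl T) is)"
      "set js \<subseteq> {0..dynkin_rank T}" "b = word_prod (affine_weyl T) (map (simple_refl T) js)"
      using ab unfolding W_def by blast
    then have "set (is @ js) \<subseteq> {0..dynkin_rank T}" by simp
    then show ?thesis using app[OF ij(1,3)] ij(2,4) unfolding W_def by (metis (mono_tags) mem_Collect_eq)
  qed
  have W_fin: "(0, w) \<in> W" if "w \<in> weyl_group T" for w
    using finite_weyl_word[OF that] by (fastforce simp: W_def)
  have W_0: "simple_refl T 0 \<in> W"
  proof -
    have "simple_refl T 0 \<otimes>\<^bsub>affine_weyl T\<^esub> \<one>\<^bsub>affine_weyl T\<^esub> = simple_refl T 0"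
      using simple_refl_in[OF T, of 0] by (intro r_one) auto
    then show ?thesis unfolding W_def by (intro CollectI exI[of _ "[0]"]) (simp add: word_prod_def)
  qed
  have W_theta: "(theta T, id) \<in> W"
  proof -
    have r: "reflection T (theta T) \<in> weyl_group T" using coroot_reflection theta_coroot T by blast
    have "aff_mult T (simple_refl T 0) (0, reflection T (theta T)) = (theta T, id)"
      using reflection_invol[OF theta_norm[OF T]] weyl_zero[OF r]
      by (simp add: simple_refl_def translation_def highest_coroot_eq[OF T] fun_eq_iff)
    then show ?thesis using W_mult[OF W_0 W_fin[OF r]] by simp
  qed
  have W_orbit: "(w (theta T), id) \<in> W" if "w \<in> weyl_group T" for w
  proof -
    obtain v where v: "v \<in> weyl_group T" "v \<circ> w = id" "w \<circ> v = id" using weyl_inverse[OF \<open>w \<in> _\<close>] by blast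
    have "aff_mult T (0, w) (aff_mult T (theta T, id) (0, v)) = (w (theta T), id)"
      using v by simp
    then show ?thesis using W_mult[OF W_fin[OF that] W_mult[OF W_theta W_fin[OF v(1)]]] by simp
  qed
  define Q where "Q = {x. (x, id) \<in> W}"
  have Q_add: "x + y \<in> Q" if "x \<in> Q" "y \<in> Q" for x y
    using W_mult[of "(x, id)" "(y, id)"] that by (simp add: Q_def)
  have Q_0: "0 \<in> Q" using W_fin[OF weyl_id] by (simp add: Q_def)
  have Q_simple: "simple_coroot i \<in> Q \<and> - simple_coroot i \<in> Q" if i: "i \<in> {1..dynkin_rank T}" for i
  proof -
    obtain w where w: "w \<in> weyl_group T" "w (theta T) = simple_coroot i"
      using simple_coroot_theta_orbit[OF T i] by blast
    have "reflection T (simple_coroot i) (simple_coroot i) = - simple_coroot i"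
      using i by (intro ext) (simp add: reflection_apply)
    then show ?thesis
      using W_orbit[OF w(1)] W_orbit[OF weyl_step[OF w(1) i]] w(2) by (simp add: Q_def)
  qed
  have Q_mult: "(\<lambda>k. c * simple_coroot i k) \<in> Q" if i: "i \<in> {1..dynkin_rank T}" for i c
  proof (induction c rule: int_induct[of _ 0])
    case base
    then show ?case using Q_0 by (simp add: zero_fun_def)
  next
    case (step1 c)
    have "(\<lambda>k. (c + 1) * simple_coroot i k) = (\<lambda>k. c * simple_coroot i k) + simple_coroot i"
      by (simp add: fun_eq_iff algebra_simps)
    then show ?case using Q_add step1 Q_simple[OF i] by simp
  next
    case (step2 c)
    have "(\<lambda>k. (c - 1) * simple_coroot i k) = (\<lambda>k. c * simple_coroot i k) + - simple_coroot i"
      by (simp add: fun_eq_iff algebra_simps)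
    then show ?case using Q_add step2 Q_simple[OF i] by metis
  qed
  \<comment> \<open>Truncation after m coordinates allows a lattice vector to be assembled from
    multiples of simple coroots one coordinate at a time.\<close>
  have Q_trunc: "(\<lambda>k. if k \<le> m then x k else 0) \<in> Q" if "m \<le> dynkin_rank T" "x \<in> coroot_lattice T" for m x
    using that(1)
  proof (induction m)
    case 0
    have "(\<lambda>k. if k \<le> 0 then x k else 0) = 0" using that(2) by (auto simp: coroot_lattice_def fun_eq_iff)
    then show ?case using Q_0 by simp
  next
    case (Suc m)
    have "(\<lambda>k. if k \<le> Suc m then x k else 0) =
        (\<lambda>k. if k \<le> m then x k else 0) + (\<lambda>k. x (Suc m) * simple_coroot (Suc m) k)"
      by (auto simp: simple_coroot_def fun_eq_iff le_Suc_eq)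
    then show ?case using Q_add Suc Q_mult[of "Suc m"] by simp
  qed
  obtain x w where xw: "g = (x, w)" "x \<in> coroot_lattice T" "w \<in> weyl_group T"
    using g by (auto simp: aff_carrier)
  have "(\<lambda>k. if k \<le> dynkin_rank T then x k else 0) = x" using xw(2) by (auto simp: coroot_lattice_def fun_eq_iff)
  then have "x \<in> Q" using Q_trunc[OF order_refl xw(2)] by simp
  then have "aff_mult T (x, id) (0, w) \<in> W"
    unfolding Q_def mem_Collect_eq by (rule W_mult) (rule W_fin[OF xw(3)])
  then show ?thesis using xw(1) by (simp add: W_def)
qed

lemma simply_laced_affine:
  assumes T: "valid_type T"
  shows "simply_laced_words (affine_weyl T) {0..dynkin_rank T} (simple_refl T) (aff_adjacent T)
    (aff_act T) (\<lambda>i. (aff_coroot_fin T i, aff_level i)) (cone T (theta T))"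
proof (rule simply_laced_words_affine)
  show "cone T (theta T) (aff_coroot_fin T i, aff_level i)" if "i \<in> {0..dynkin_rank T}" for i
    using that by (auto simp: cone_def aff_coroot_fin_def highest_coroot_eq[OF T] simple_coroot_def)
  show "\<exists>is. set is \<subseteq> {0..dynkin_rank T} \<and> w = word_prod (affine_weyl T) (map (simple_refl T) is)"
    if "w \<in> carrier (affine_weyl T)" for w
    using affine_generated[OF T that] .
  show "simple_refl T i \<in> carrier (affine_weyl T)" if "i \<in> {0..dynkin_rank T}" for i
    using simple_refl_in[OF T that] .
  show "simple_refl T i = arefl T (aff_coroot_fin T i) (aff_level i)" for i
    by (rule simple_refl_arefl[OF T])
qed (auto simp: group_affine_weyl aff_coroot_fin_norm[OF T] aff_coroot_fin_adjacent(1)[OF T] aff_adjacent_sym)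

section \<open>Segments from the affine node and the elements w_i\<close>

definition is_segment :: "dynkin_type \<Rightarrow> nat \<Rightarrow> nat list \<Rightarrow> bool"
  where "is_segment T i js \<longleftrightarrow> js \<noteq> [] \<and> hd js = 0 \<and> last js = i \<and> set js \<subseteq> {0..dynkin_rank T} \<and>
    distinct js \<and> successively (aff_adjacent T) js"

text \<open>The node before the end i is adjacent to i, hence its parent or one of its children. A
  child cannot occur: by induction a segment that reaches the child has passed through i
  already.\<close>

lemma is_segment_cases:
  assumes T: "valid_type T" and "is_segment T i js"
  shows "i = 0 \<and> js = [0] \<or> i \<noteq> 0 \<and> (\<exists>ks. js = ks @ [i] \<and> is_segment T (par_node T i) ks)"
  using assms(2)
proof (induction js arbitrary: i rule: rev_induct)
  case Nil
  then show ?case by (simp add: is_segment_def)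
next
  case (snoc a ks)
  have a: "a = i" using snoc.prems by (simp add: is_segment_def)
  show ?case
  proof (cases "ks = []")
    case True
    then show ?thesis using snoc.prems by (simp add: is_segment_def)
  next
    case False
    define l where "l = last ks"
    have l: "l \<in> set ks" using False by (simp add: l_def)
    have ks: "is_segment T l ks"
      using snoc.prems False by (auto simp: is_segment_def l_def successively_append_iff)
    have lr: "l \<in> {0..dynkin_rank T}" using l ks unfolding is_segment_def by blast
    have il: "i \<in> {0..dynkin_rank T}" "i \<noteq> l" "aff_adjacent T l i" "i \<notin> set ks"
      using snoc.prems False l a by (auto simp: is_segment_def l_def successively_append_iff)
    have "0 \<in> set ks" using ks by (metis is_segment_def hd_in_set)
    then have i0: "i \<noteq> 0" using il(4) by metis
    \<comment> \<open>For \<open>l = 0\<close> the parent is the formal node, which lies outside the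
      diagram; otherwise the induction hypothesis puts i into \<open>ks\<close>, against
      distinctness.\<close>
    have "par_node T l \<noteq> i"
    proof
      assume p: "par_node T l = i"
      have "l \<noteq> 0"
      proof
        assume "l = 0"
        then have "i = Suc (dynkin_rank T)" using p by simp
        then show False using il(1) by simp
      qed
      then obtain ls where "ks = ls @ [l]" "is_segment T i ls" using snoc.IH[OF ks] p by auto
      then have "i \<in> set ks" by (auto simp: is_segment_def)
      then show False using il by simp
    qed
    then have "par_node T i = l" using aff_coroot_fin_adjacent(2)[OF T lr il(1)] il by auto
    then show ?thesis using ks a i0 by auto
  qed
qed

text \<open>The bound on depths is carried along to see that i has not occurred before it is
  appended.\<close>

lemma segment_exists:
  assumes T: "valid_type T" and "i \<in> {0..dynkin_rank T}"
  shows "\<exists>js. is_segment T i js \<and> (\<forall>k\<in>set js. dep_node T k \<le> dep_node T i)"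
  using assms(2)
proof (induction "dep_node T i" arbitrary: i rule: less_induct)
  case less
  show ?case
  proof (cases "i = 0")
    case True
    then show ?thesis by (intro exI[of _ "[0]"]) (simp add: is_segment_def)
  next
    case False
    then have i: "i \<in> {1..dynkin_rank T}" using less.prems by simp
    note p = par_node_props[OF T i]
    obtain js where js: "is_segment T (par_node T i) js" "\<forall>k\<in>set js. dep_node T k \<le> dep_node T (par_node T i)"
      using less.hyps[of "par_node T i"] p by auto
    have "i \<notin> set js" using js(2) p(2) by auto
    moreover have "aff_adjacent T (par_node T i) i"
      using aff_coroot_fin_adjacent(2)[OF T, of "par_node T i" i] p par_node_neq[OF T i] i by auto
    ultimately have "is_segment T i (js @ [i])"
      using js(1) i by (auto simp: is_segment_def successively_append_iff)
    then show ?thesis using js(2) p(2) by (intro exI[of _ "js @ [i]"]) auto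
  qed
qed

lemma segment_unique:
  assumes T: "valid_type T"
  shows "is_segment T i js \<Longrightarrow> is_segment T i ks \<Longrightarrow> js = ks"
proof (induction "length js" arbitrary: i js ks rule: less_induct)
  case less
  show ?case
  proof (cases "i = 0")
    case True
    then show ?thesis using is_segment_cases[OF T] less.prems by blast
  next
    case False
    then obtain js' ks' where "js = js' @ [i]" "is_segment T (par_node T i) js'"
      "ks = ks' @ [i]" "is_segment T (par_node T i) ks'"
      using is_segment_cases[OF T less.prems(1)] is_segment_cases[OF T less.prems(2)] by blast
    then show ?thesis using less.hyps[of js' "par_node T i" ks'] by simp
  qed
qed

lemma aff_segment_eq:
  assumes T: "valid_type T" and "is_segment T i js" shows "aff_segment T i = js"
  unfolding aff_segment_def is_segment_def[symmetric]
  by (rule the_equality) (use assms segment_unique in blast)+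

lemma w_node_0: assumes T: "valid_type T" shows "w_node T 0 = simple_refl T 0"
proof -
  interpret group "affine_weyl T" by (rule group_affine_weyl)
  have "aff_segment T 0 = [0]" by (rule aff_segment_eq[OF T]) (simp add: is_segment_def)
  then show ?thesis
    using r_one[OF simple_refl_in[OF T, of 0]] by (simp add: w_node_def word_prod_def)
qed

lemma w_node_par:
  assumes T: "valid_type T" and i: "i \<in> {1..dynkin_rank T}"
  shows "w_node T i = aff_mult T (simple_refl T i) (w_node T (par_node T i))"
proof -
  obtain js where js: "is_segment T i js" using segment_exists[OF T, of i] i by auto
  obtain ks where ks: "js = ks @ [i]" "is_segment T (par_node T i) ks"
    using is_segment_cases[OF T js] i by auto
  show ?thesis
    unfolding w_node_def aff_segment_eq[OF T js] aff_segment_eq[OF T ks(2)] ks(1)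
    by (simp add: word_prod_def)
qed

definition wn_node :: "dynkin_type \<Rightarrow> nat \<Rightarrow> aff"
  where "wn_node T i = (if i = Suc (dynkin_rank T) then (0, id) else w_node T i)"

lemma tree_words_affine:
  assumes T: "valid_type T"
  shows "tree_words (affine_weyl T) {0..dynkin_rank T} (simple_refl T) (aff_adjacent T) (aff_act T)
    (\<lambda>i. (aff_coroot_fin T i, aff_level i)) (cone T (theta T)) (Suc (dynkin_rank T)) (par_node T)
    (dep_node T) (wn_node T)"
proof -
  interpret simply_laced_words "affine_weyl T" "{0..dynkin_rank T}" "simple_refl T" "aff_adjacent T"
    "aff_act T" "\<lambda>i. (aff_coroot_fin T i, aff_level i)" "cone T (theta T)"
    by (rule simply_laced_affine[OF T])
  have cases: "i = 0 \<or> i \<in> {1..dynkin_rank T}" if "i \<in> {0..dynkin_rank T}" for i using that by auto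
  show ?thesis
  proof
    fix i assume i: "i \<in> {0..dynkin_rank T}"
    show "par_node T i \<in> insert (Suc (dynkin_rank T)) {0..dynkin_rank T}"
      using cases[OF i] par_node_props(1)[OF T, of i] by auto
    show "dep_node T i = Suc (dep_node T (par_node T i))"
      using cases[OF i] par_node_props(2)[OF T, of i] by auto
    show "wn_node T i = simple_refl T i \<otimes>\<^bsub>affine_weyl T\<^esub> wn_node T (par_node T i)"
    proof (cases "i = 0")
      case True
      then show ?thesis
        using r_one[OF simple_refl_in[OF T, of 0]] by (simp add: wn_node_def w_node_0[OF T])
    next
      case False
      then show ?thesis
        using i w_node_par[OF T, of i] par_node_props(1)[OF T, of i] by (simp add: wn_node_def)
    qed
    fix j assume j: "j \<in> {0..dynkin_rank T}"
    show "aff_adjacent T i j \<longleftrightarrow> par_node T i = j \<or> par_node T j = i"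
    proof (cases "i = j")
      case True
      have "par_node T i \<noteq> i" using cases[OF i] par_node_neq[OF T, of i] by auto
      then show ?thesis using True by (simp add: aff_adjacent_def)
    next
      case False
      then show ?thesis using aff_coroot_fin_adjacent(2)[OF T i j] by simp
    qed
  qed (simp_all add: wn_node_def)
qed

section \<open>Coordinates of the translated fundamental weight\<close>

text \<open>The coordinates of \<open>- x + (x, x)/2 K\<close> in the affine simple coroots, with the coordinate
  \<open>1\<close> at the formal node \<open>r + 1\<close>: up to sign these are the coordinates of the translate of
  the fundamental weight \<open>\<Lambda>\<^sub>0\<close>, with the affine roots identified with the coroots.\<close>

definition weight_coord :: "dynkin_type \<Rightarrow> aff \<Rightarrow> nat \<Rightarrow> complex"
  where "weight_coord T g i =
    (let x = fst g; c = of_int (form T x x) / 2 in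
      if i = Suc (dynkin_rank T) then 1 else if i = 0 then c else c * of_int (theta T i) - of_int (x i))"

lemma weight_coord_one:
  "i \<in> insert (Suc (dynkin_rank T)) {0..dynkin_rank T} \<Longrightarrow>
    weight_coord T \<one>\<^bsub>affine_weyl T\<^esub> i = (if i = Suc (dynkin_rank T) then 1 else 0)"
  by (simp add: weight_coord_def)

text \<open>With m = (x, f) + level, (x - m f, x - m f) = (x, x) + 2 m (m - (x, f)), since (f, f) =
  2. So only s_0 changes the norm, by 2 m.\<close>

lemma fst_simple_refl_mult:
  assumes T: "valid_type T" and j: "j \<in> {0..dynkin_rank T}"
  defines "f \<equiv> aff_coroot_fin T j"
  shows "fst (aff_mult T (simple_refl T j) g) l = fst g l - (form T (fst g) f + aff_level j) * f l"
    "form T (fst (aff_mult T (simple_refl T j) g)) (fst (aff_mult T (simple_refl T j) g)) =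
      form T (fst g) (fst g) + 2 * (form T (fst g) f + aff_level j) * aff_level j"
proof -
  have n: "form T f f = 2" using aff_coroot_fin_norm[OF T j] by (simp add: f_def)
  have e: "fst (aff_mult T (simple_refl T j) g) =
      (\<lambda>l. fst g l - (form T (fst g) f + aff_level j) * f l)"
    using arefl_mult[OF n, of "aff_level j" "fst g" "snd g"] simple_refl_arefl[OF T, of j]
    by (simp add: f_def)
  show "fst (aff_mult T (simple_refl T j) g) l = fst g l - (form T (fst g) f + aff_level j) * f l"
    unfolding e ..
  show "form T (fst (aff_mult T (simple_refl T j) g)) (fst (aff_mult T (simple_refl T j) g)) =
      form T (fst g) (fst g) + 2 * (form T (fst g) f + aff_level j) * aff_level j"
    unfolding e form_diff_scale form_diff_scale_right n form_sym[of T f "fst g"] by (simp add: algebra_simps)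
qed

text \<open>For j = 0 both the half norm and the vector along \<theta> grow by m, so the coordinates
  at the finite nodes do not change. For the other j the norm is fixed and just one coordinate of x
  moves.\<close>

lemma weight_coord_refl:
  assumes T: "valid_type T" and j: "j \<in> {0..dynkin_rank T}"
    and i: "i \<in> insert (Suc (dynkin_rank T)) {0..dynkin_rank T}"
  shows "weight_coord T (aff_mult T (simple_refl T j) g) i = weight_coord T g i +
    (if i = j then of_int (form T (fst g) (aff_coroot_fin T j) + aff_level j) else 0)"
proof -
  define m where "m = form T (fst g) (aff_coroot_fin T j) + aff_level j"
  note r = fst_simple_refl_mult[OF T j, of g, folded m_def]
  consider "j = 0" | "1 \<le> j" by linarith
  then show ?thesis
    unfolding m_def[symmetric]
  proof cases
    case 1
    then show "weight_coord T (aff_mult T (simple_refl T j) g) i =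
        weight_coord T g i + (if i = j then of_int m else 0)"
      unfolding weight_coord_def Let_def r using T i
      by (auto simp: aff_coroot_fin_def highest_coroot_eq field_simps)
  next
    case 2
    then show "weight_coord T (aff_mult T (simple_refl T j) g) i =
        weight_coord T g i + (if i = j then of_int m else 0)"
      unfolding weight_coord_def Let_def r using i j
      by (auto simp: aff_coroot_fin_def simple_coroot_def)
  qed
qed

text \<open>The element K has finite part 0, so the combination of the finite parts of the affine
  simple coroots with these coefficients is -x. Concretely, the contribution of node 0 cancels the
  multiple of \<theta>.\<close>

lemma weight_coord_form:
  assumes T: "valid_type T" and j: "j \<in> {0..dynkin_rank T}"
  shows "(\<Sum>i = 0..dynkin_rank T. weight_coord T g i * of_int (form T (aff_coroot_fin T i) (aff_coroot_fin T j)))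
    = - of_int (form T (fst g) (aff_coroot_fin T j))"
proof -
  let ?f = "aff_coroot_fin T" and ?r = "dynkin_rank T" and ?x = "fst g"
  define c :: complex where "c = of_int (form T ?x ?x) / 2"
  have "(\<Sum>i = 0..?r. weight_coord T g i * of_int (form T (?f i) (?f j))) =
      c * of_int (form T (?f 0) (?f j)) + (\<Sum>i = 1..?r. weight_coord T g i * of_int (form T (?f i) (?f j)))"
    by (subst sum.atLeast_Suc_atMost) (simp_all add: weight_coord_def c_def Let_def)
  also have "(\<Sum>i = 1..?r. weight_coord T g i * of_int (form T (?f i) (?f j))) =
      (\<Sum>i = 1..?r. c * of_int (theta T i * form T (simple_coroot i) (?f j)) -
        of_int (?x i * form T (simple_coroot i) (?f j)))"
    by (intro sum.cong refl) (simp add: weight_coord_def c_def Let_def aff_coroot_fin_def algebra_simps)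
  also have "\<dots> = c * of_int (\<Sum>i = 1..?r. theta T i * form T (simple_coroot i) (?f j)) -
      of_int (\<Sum>i = 1..?r. ?x i * form T (simple_coroot i) (?f j))"
    by (simp add: sum_subtractf sum_distrib_left)
  also have "\<dots> = c * of_int (form T (theta T) (?f j)) - of_int (form T ?x (?f j))"
    unfolding form_expand[symmetric] ..
  also have "form T (?f 0) (?f j) = - form T (theta T) (?f j)"
    by (simp add: aff_coroot_fin_def[of T 0] highest_coroot_eq[OF T] form_uminus)
  finally show ?thesis by simp
qed

lemma weight_coord_self:
  assumes T: "valid_type T" and j: "j \<in> {0..dynkin_rank T}"
  shows "weight_coord T (aff_mult T (simple_refl T j) g) j = - weight_coord T g j +
    (\<Sum>i | i \<in> {0..dynkin_rank T} \<and> aff_adjacent T i j. weight_coord T g i) +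
    (if par_node T j = Suc (dynkin_rank T) then weight_coord T g (Suc (dynkin_rank T)) else 0)"
proof -
  let ?f = "aff_coroot_fin T" and ?r = "dynkin_rank T"
  have "weight_coord T g i * of_int (form T (?f i) (?f j)) =
      (if i = j then 2 * weight_coord T g i else 0) - (if aff_adjacent T i j then weight_coord T g i else 0)"
    if "i \<in> {0..?r}" for i
    using aff_coroot_fin_adjacent(1)[OF T that j] aff_coroot_fin_norm[OF T j] by (auto simp: aff_adjacent_def)
  then have "- of_int (form T (fst g) (?f j)) =
      (\<Sum>i = 0..?r. (if i = j then 2 * weight_coord T g i else 0) -
        (if aff_adjacent T i j then weight_coord T g i else 0))"
    unfolding weight_coord_form[OF T j, of g, symmetric] by (intro sum.cong refl)
  also have "\<dots> = 2 * weight_coord T g j - (\<Sum>i | i \<in> {0..?r} \<and> aff_adjacent T i j. weight_coord T g i)"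
    using j by (simp add: sum_subtractf sum.If_cases Int_def)
  finally have 1: "of_int (form T (fst g) (?f j)) =
      - 2 * weight_coord T g j + (\<Sum>i | i \<in> {0..?r} \<and> aff_adjacent T i j. weight_coord T g i)"
    by (simp add: algebra_simps minus_equation_iff)
  have "par_node T j = Suc ?r \<longleftrightarrow> j = 0"
    using par_node_props(1)[OF T, of j] j by (cases "j = 0") auto
  \<comment> \<open>The coordinate 1 at the formal node supplies the constant term of s_0; node 0 is
    the only child of that node.\<close>
  then have 2: "(if par_node T j = Suc ?r then weight_coord T g (Suc ?r) else 0) = of_int (aff_level j)"
    by (simp add: weight_coord_def)
  show ?thesis
    using j unfolding 2 weight_coord_refl[OF T j insertI2[OF j]] by (simp add: 1)
qed

text \<open>The minimum of a natural number valued function on a nonempty coset is attained in the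
  coset, which fixes the translation part; \<open>weight_coord\<close> is computed from that
  part.\<close>

lemma w_coset_props:
  assumes T: "valid_type T" and "\<gamma> \<in> coroot_lattice T"
  shows "fst (w_coset T \<gamma>) = \<gamma>" "w_coset T \<gamma> \<in> carrier (affine_weyl T)"
proof -
  let ?C = "translation \<gamma> <#\<^bsub>affine_weyl T\<^esub> finite_weyl T"
  have C: "g \<in> ?C \<longleftrightarrow> (\<exists>w\<in>weyl_group T. g = (\<gamma>, w))" for g
    by (auto simp: l_coset_def finite_weyl_def translation_def)
  then have "(\<gamma>, id) \<in> ?C" using weyl_id by blast
  then have "w_coset T \<gamma> \<in> ?C" unfolding w_coset_def by (rule arg_min_natI)
  then show "fst (w_coset T \<gamma>) = \<gamma>" "w_coset T \<gamma> \<in> carrier (affine_weyl T)"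
    using C assms by (auto simp: aff_carrier)
qed

section \<open>Expansion in the affine simple coroots and the values of the fundamental
  weights\<close>

lemma sum_pointwise: "(\<Sum>j\<in>S. g j) k = (\<Sum>j\<in>S. g j k)"
  by (induction S rule: infinite_finite_induct) simp_all

text \<open>Linearity is given on \<open>hK_space\<close> only, so membership of the partial sums is
  proved along with additivity.\<close>

lemma linear_hK_sum:
  assumes f: "is_linear_hK T f" and "finite S" "\<And>s. s \<in> S \<Longrightarrow> v s \<in> hK_space T"
  shows "sum v S \<in> hK_space T \<and> f (sum v S) = (\<Sum>s\<in>S. f (v s))"
  using assms(2,3)
proof (induction S rule: finite_induct)
  case empty
  have z: "(0 :: hK) \<in> hK_space T" by (simp add: hK_space_def zero_prod_def)
  then have "f (0 + 0) = f 0 + f 0" using f unfolding is_linear_hK_def by blast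
  then show ?case using z by simp
next
  case (insert s S)
  then have v: "v s \<in> hK_space T" "sum v S \<in> hK_space T" "f (sum v S) = (\<Sum>s\<in>S. f (v s))" by auto
  then have "v s + sum v S \<in> hK_space T" by (auto simp: hK_space_def)
  moreover have "f (v s + sum v S) = f (v s) + f (sum v S)"
    using f v unfolding is_linear_hK_def by blast
  ultimately show ?case using insert v by simp
qed

text \<open>The numbers \<open>weight_coord\<close> are the coefficients of the vector in the basis
  of affine simple coroots: K is \<alpha>_0 plus \<theta>, whence the coefficient c at node 0 and c
  \<theta>_j - x_j at node j. The fundamental weights are dual to this basis.\<close>

lemma fundamental_weight_value:
  assumes T: "valid_type T" and L: "is_fundamental_weights T \<Lambda>" and x: "x \<in> coroot_lattice T"
    and i: "i \<in> {0..dynkin_rank T}"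
  shows "\<Lambda> i (- hK_of_coroot x + hK_scale (of_int (form T x x) / 2) K_elt) = weight_coord T (x, w) i"
proof -
  let ?r = "dynkin_rank T" and ?W = "weight_coord T (x, w)"
  define c :: complex where "c = of_int (form T x x) / 2"
  have lin: "is_linear_hK T (\<Lambda> i)" and dual: "\<And>j. j \<le> ?r \<Longrightarrow> \<Lambda> i (aff_coroot T j) = (if i = j then 1 else 0)"
    using L i by (auto simp: is_fundamental_weights_def)
  have a: "aff_coroot T j \<in> hK_space T" if "j \<in> {0..?r}" for j
    using that theta_in_lattice[OF T]
    by (auto simp: aff_coroot_def hK_space_def K_elt_def hK_of_coroot_def highest_coroot_eq[OF T]
        coroot_lattice_def simple_coroot_def)
  have s: "hK_scale d v \<in> hK_space T" if "v \<in> hK_space T" for d v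
    using that by (auto simp: hK_scale_def hK_space_def)
  have "- hK_of_coroot x + hK_scale c K_elt = (\<Sum>j = 0..?r. hK_scale (?W j) (aff_coroot T j))"
  proof (rule prod_eqI)
    have "snd (\<Sum>j = 0..?r. hK_scale (?W j) (aff_coroot T j)) = (\<Sum>j = 0..?r. if j = 0 then ?W j else 0)"
      unfolding snd_sum by (intro sum.cong refl)
        (auto simp: hK_scale_def aff_coroot_def K_elt_def hK_of_coroot_def)
    then show "snd (- hK_of_coroot x + hK_scale c K_elt) = snd (\<Sum>j = 0..?r. hK_scale (?W j) (aff_coroot T j))"
      by (simp add: hK_scale_def K_elt_def hK_of_coroot_def weight_coord_def c_def)
    have "fst (\<Sum>j = 0..?r. hK_scale (?W j) (aff_coroot T j)) k = - of_int (x k)" for k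
    proof -
      have "fst (\<Sum>j = 0..?r. hK_scale (?W j) (aff_coroot T j)) k =
          (\<Sum>j = 0..?r. fst (hK_scale (?W j) (aff_coroot T j)) k)"
        unfolding fst_sum by (rule sum_pointwise)
      also have "\<dots> = fst (hK_scale (?W 0) (aff_coroot T 0)) k + (\<Sum>j = 1..?r. fst (hK_scale (?W j) (aff_coroot T j)) k)"
        by (subst sum.atLeast_Suc_atMost) simp_all
      also have "(\<Sum>j = 1..?r. fst (hK_scale (?W j) (aff_coroot T j)) k) = (\<Sum>j = 1..?r. if j = k then ?W j else 0)"
        by (intro sum.cong refl) (auto simp: hK_scale_def aff_coroot_def hK_of_coroot_def simple_coroot_def)
      also have "\<dots> = (if k \<in> {1..?r} then ?W k else 0)" by simp
      finally show ?thesis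
        using x theta_in_lattice[OF T]
        by (auto simp: hK_scale_def aff_coroot_def K_elt_def hK_of_coroot_def highest_coroot_eq[OF T]
            weight_coord_def coroot_lattice_def)
    qed
    then show "fst (- hK_of_coroot x + hK_scale c K_elt) = fst (\<Sum>j = 0..?r. hK_scale (?W j) (aff_coroot T j))"
      by (simp add: hK_scale_def K_elt_def hK_of_coroot_def fun_eq_iff)
  qed
  then have "\<Lambda> i (- hK_of_coroot x + hK_scale c K_elt) = (\<Sum>j = 0..?r. \<Lambda> i (hK_scale (?W j) (aff_coroot T j)))"
    using linear_hK_sum[OF lin, of "{0..?r}" "\<lambda>j. hK_scale (?W j) (aff_coroot T j)"] a s by simp
  also have "\<dots> = (\<Sum>j = 0..?r. if j = i then ?W j else 0)"
    using lin a dual by (intro sum.cong refl) (auto simp: is_linear_hK_def)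
  finally show ?thesis using i by (simp add: c_def)
qed

theorem mainTheorem10:
  fixes T :: dynkin_type
    and A :: "(aff \<Rightarrow>\<^sub>0 laurent) ring"
    and P m :: "aff \<Rightarrow> aff \<Rightarrow> int poly"
    and \<Lambda> :: "nat \<Rightarrow> hK \<Rightarrow> complex"
    and \<gamma> :: coroot_vec and i :: nat
  assumes "valid_type T"
    and "is_hecke_algebra (affine_weyl T) (simple_refls T) A"
    and "is_KL_polynomials (affine_weyl T) (simple_refls T) A P"
    and "is_inverse_KL_polynomials (affine_weyl T) (simple_refls T) P m"
    and "is_fundamental_weights T \<Lambda>"
    and "\<gamma> \<in> coroot_lattice T"
    and "i \<in> {0..dynkin_rank T}"
  shows "of_int (poly (m (w_coset T \<gamma>) (w_node T i)) 1) =
    \<Lambda> i (- hK_of_coroot \<gamma> + hK_scale (of_int (form T \<gamma> \<gamma>) / 2) K_elt)"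
proof -
  interpret tree_words "affine_weyl T" "{0..dynkin_rank T}" "simple_refl T" "aff_adjacent T" "aff_act T"
    "\<lambda>i. (aff_coroot_fin T i, aff_level i)" "cone T (theta T)" "Suc (dynkin_rank T)" "par_node T"
    "dep_node T" "wn_node T"
    by (rule tree_words_affine[OF assms(1)])
  interpret hecke_tree "affine_weyl T" "{0..dynkin_rank T}" "simple_refl T" "aff_adjacent T" "aff_act T"
    "\<lambda>i. (aff_coroot_fin T i, aff_level i)" "cone T (theta T)" "Suc (dynkin_rank T)" "par_node T"
    "dep_node T" "wn_node T" A
    by unfold_locales (use assms(2) in \<open>simp add: simple_refls_def\<close>)
  note c = w_coset_props[OF assms(1,6)]
  \<comment> \<open>The untwisted coordinates \<open>F\<close> are taken to be
    \<open>weight_coord T\<close>: a simple reflection changes the coordinate at its own node only,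
    by the rule of the reflection representation.\<close>
  have "of_int (poly (m (w_coset T \<gamma>) (wn_node T i)) 1) = weight_coord T (w_coset T \<gamma>) i"
  proof (rule inverse_KL_at_one)
    show "is_KL_polynomials (affine_weyl T) (simple_refl T ` {0..dynkin_rank T}) A P"
      "is_inverse_KL_polynomials (affine_weyl T) (simple_refl T ` {0..dynkin_rank T}) P m"
      using assms(3,4) by (simp_all add: simple_refls_def)
  qed (use weight_coord_one weight_coord_refl[OF assms(1)] weight_coord_self[OF assms(1)] c assms(7) in auto)
  also have "\<dots> = \<Lambda> i (- hK_of_coroot \<gamma> + hK_scale (of_int (form T \<gamma> \<gamma>) / 2) K_elt)"
    using fundamental_weight_value[OF assms(1,5,6,7), of "snd (w_coset T \<gamma>)"] c(1)
    by (metis prod.collapse)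
  also have "wn_node T i = w_node T i" using assms(7) by (simp add: wn_node_def)
  finally show ?thesis .
qed

end
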